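(* Let $-\infty<a<b<\infty$, $N\ge1$, $M\ge 1$, and let $R$ be a measurable function on $\mathbb{R}$ whose values are self-adjoint $N\times N$ complex matrices with $I\le R(x)\le MI$ for $x\in[a,b]$ and $R(x)=I$ for $x\notin[a,b]$. Then the Wiener--Masani problem for $R$ has exactly one (maximal) solution.
   Context: $\mathbb{C}_+$ is the open upper half-plane; $V_+(x)=\lim_{y\to+0}V(x+iy)$. Consider the $N\times N$ matrix functions $V(z)$ that are analytic in $\mathbb{C}_+$, satisfy $\lim_{z\to\infty}V(z)=I$, and satisfy $V_+^*(x)V_+(x)=R^2(x)$ for almost every $x\in\mathbb{R}$. The Wiener--Masani problem for $R$ is to find a maximal function among them, that is, a function $W$ of this kind such that $W^*(z)W(z)\ge V^*(z)V(z)$ (as self-adjoint matrices) for every function $V$ of this kind and every $z\in\mathbb{C}_+$.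
   Formalization: The functions V in the Wiener–Masani problem (the solution and all competitors) are also required to be bounded in the upper half-plane; without this no maximal function exists, since multiplying by exp(ic/z), c>0, keeps all the other conditions and increases V*V. *)

theory Defs
  imports "HOL-Analysis.Analysis"
begin

unbundle no fps_syntax

definition upper_half_plane :: "complex set"
  where "upper_half_plane = {z. 0 < Im z}"

definition adj :: "complex^'n^'n \<Rightarrow> complex^'n^'n"
  where "adj A = map_matrix cnj (transpose A)"

definition hermitian :: "complex^'n^'n \<Rightarrow> bool"
  where "hermitian A \<longleftrightarrow> adj A = A"

definition quad_form :: "complex^'n^'n \<Rightarrow> complex^'n \<Rightarrow> complex"
  where "quad_form A v = (\<Sum>i\<in>UNIV. cnj (v $ i) * (A *v v) $ i)"

(* The order of self-adjoint matrices. Their quadratic forms are real-valued,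
   so taking real parts loses nothing. *)
definition loewner_le :: "complex^'n^'n \<Rightarrow> complex^'n^'n \<Rightarrow> bool"
  where "loewner_le A B \<longleftrightarrow>
    hermitian A \<and> hermitian B \<and> (\<forall>v. Re (quad_form A v) \<le> Re (quad_form B v))"

definition has_boundary_value :: "(complex \<Rightarrow> complex^'n^'n) \<Rightarrow> real \<Rightarrow> complex^'n^'n \<Rightarrow> bool"
  where "has_boundary_value V x L \<longleftrightarrow> ((\<lambda>y. V (Complex x y)) \<longlongrightarrow> L) (at_right 0)"

(* The competing functions. Boundedness on the half-plane makes explicit the
   Hardy-class assumption behind the Wiener-Masani problem. Without it no maximal
   function exists: for N = 1 and R = 1 all the functions exp (i c / z) with c > 0
   satisfy the other conditions, but their moduli exp (c Im z / |z|^2) have no common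
   bound at any point z. Since the boundary values are bounded and V tends to I at
   infinity, requiring V to be in the Smirnov class, or V - I to be in H^2, instead
   of bounded gives the same functions whenever R is essentially bounded and
   equal to I outside a bounded interval. *)
definition wiener_masani_class ::
    "(real \<Rightarrow> complex^'n^'n) \<Rightarrow> (complex \<Rightarrow> complex^'n^'n) \<Rightarrow> bool"
  where "wiener_masani_class R V \<longleftrightarrow>
    (\<forall>i j. (\<lambda>z. V z $ i $ j) holomorphic_on upper_half_plane) \<and>
    bounded (V ` upper_half_plane) \<and>
    (V \<longlongrightarrow> mat 1) (inf at_infinity (principal upper_half_plane)) \<and>
    (AE x in lebesgue. \<exists>L. has_boundary_value V x L \<and> adj L ** L = R x ** R x)"

definition wiener_masani_solution ::
    "(real \<Rightarrow> complex^'n^'n) \<Rightarrow> (complex \<Rightarrow> complex^'n^'n) \<Rightarrow> bool"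
  where "wiener_masani_solution R W \<longleftrightarrow>
    wiener_masani_class R W \<and>
    (\<forall>V. wiener_masani_class R V \<longrightarrow>
      (\<forall>z\<in>upper_half_plane. loewner_le (adj (V z) ** V z) (adj (W z) ** W z)))"

end

theory Submission
  imports Defs "HOL-Complex_Analysis.Conformal_Mappings" "HOL-Real_Asymp.Real_Asymp"
begin

unbundle no fps_syntax

text \<open>
  Let \<open>S = R\<^sup>2\<close> and \<open>K = S - I\<close>. Since \<open>S \<ge> I\<close>, minimising the coercive quadratic functional
  \<open>\<integral> (S \<phi> \<bullet> \<phi> + 2 K \<bullet> \<phi>)\<close> over the Hardy space \<open>H\<^sup>2\<close> of the upper half-plane yields \<open>\<Phi>\<close> in \<open>H\<^sup>2\<close>
  such that, with \<open>X = I + \<Phi>\<close>, the function \<open>S X - I\<close> is orthogonal to \<open>H\<^sup>2\<close>. Hence \<open>X\<close> and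
  \<open>W = (S X)\<^sup>*\<close> are both boundary values of functions holomorphic in the upper half-plane. The matrix
  \<open>W X - I = X\<^sup>* S X - I\<close> is self-adjoint and its Cauchy integral vanishes in one half-plane, hence in
  both, so its Poisson integral is zero and \<open>W X = I\<close>. Consequently \<open>W\<^sup>* W = S\<close> almost everywhere,
  \<open>X\<^sup>* X \<le> X\<^sup>* S X = I\<close>, and \<open>W\<close> and \<open>X = W\<^sup>-\<^sup>1\<close> are bounded; they tend to \<open>I\<close> at infinity
  because they are Cauchy integrals of the compactly supported \<open>K X\<close> and its adjoint.

  For every competitor \<open>V\<close> the bounded function \<open>V X\<close> has unitary boundary values and so is contractive
  inside, i.e. \<open>V\<^sup>* V \<le> W\<^sup>* W\<close>. If \<open>V\<close> is maximal as well, \<open>V X\<close> is isometric, hence constant by the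
  maximum principle, and equal to its limit \<open>I\<close> at infinity.
\<close>

section \<open>Differentiation of the integral\<close>

text \<open>Three difficulties shape the details. The variational solution is known only as a
  square-integrable function on the line, so membership in the Hardy space is handled on the line by
  approximation (\<open>hardy\<close>) or by vanishing pairings (\<open>annihilates_hardy\<close>).
  Values inside come afterwards from Poisson integrals, which return the boundary function almost
  everywhere by Lebesgue differentiation; symmetric intervals suffice for that because the Poisson
  kernel is a mixture of their averaging kernels. Next, a product of two square-integrable functions
  is only integrable, so the matrix W X - I is tested directly against the kernels 1/(t - w), and
  the vertical limit theorem is proved for every function that is integrable against all Poisson
  kernels. Last, boundary values on almost every vertical line must control a bounded function
  inside: the Poisson formula is applied along lines slightly above the axis, which then descend to
  it. Matrix statements become scalar ones by pairing with fixed vectors. The assumption S = I off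
  [a,b] makes the linear term of the functional square-integrable, which the constant I is
  not.\<close>

lemma negligible_upper_density:
  fixes \<nu> :: "real measure"
  assumes fin: "finite_measure \<nu>" and sets: "sets \<nu> = sets borel"
    and B: "B \<in> sets borel" "emeasure \<nu> B = 0" and c: "0 < c"
  shows "negligible {x\<in>B. \<forall>d>0. \<exists>h. 0 < h \<and> h < d \<and> c * h < measure \<nu> (cball x h)}"
    (is "negligible ?E0")
proof -
  define E where "E = ?E0"
  have "negligible E"
    unfolding negligible_outer_le
  proof (intro allI impI)
    interpret finite_measure \<nu> by fact
    fix e :: real
    assume e: "0 < e"
    have pos: "0 < e * c / 2" using e c by simp
    \<comment> \<open>The target e * c / 2 is chosen so that the factor 2 / c, which converts
      \<open>\<nu>\<close>-mass of a ball into length, turns it into exactly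
      \<open>e\<close>.\<close>
    have "(INF U\<in>{U. B \<subseteq> U \<and> open U}. emeasure \<nu> U) < ennreal (e * c / 2)"
      using outer_regular[OF sets _ , of B] B pos by (simp add: sets)
    then obtain U where U: "B \<subseteq> U" "open U" and small: "emeasure \<nu> U < ennreal (e * c / 2)"
      by (auto simp: INF_less_iff)
    have smallU: "measure \<nu> U \<le> e * c / 2"
      using small pos by (simp add: emeasure_eq_measure ennreal_less_iff)
    \<comment> \<open>Every point of \<open>E\<close> is the centre of arbitrarily small balls in
      \<open>K\<close>, so Vitali yields a disjoint subfamily covering \<open>E\<close> up to a null
      set. Each ball is shorter than 2 / c times its mass, and all of them lie in \<open>U\<close>,
      so their total length is at most 2 / c times the mass of \<open>U\<close>.\<close>
    define K where "K = {(x, h). x \<in> E \<and> 0 < h \<and> cball x h \<subseteq> U \<and> c * h < measure \<nu> (cball x h)}"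
    have KD: "0 < snd i" "c * snd i < measure \<nu> (cball (fst i) (snd i))" "cball (fst i) (snd i) \<subseteq> U"
      if "i \<in> K" for i using that by (auto simp only: K_def mem_Collect_eq case_prod_beta)
    have cover: "\<exists>i\<in>K. x \<in> cball (fst i) (snd i) \<and> snd i < d" if x: "x \<in> E" and d: "0 < d" for x d
    proof -
      obtain r where r: "0 < r" "cball x r \<subseteq> U"
      proof -
        have "x \<in> U" using x U(1) unfolding E_def by blast
        then show thesis using U(2) that unfolding open_contains_cball by blast
      qed
      obtain h where h: "0 < h" "h < min d r" "c * h < measure \<nu> (cball x h)"
      proof -
        have "0 < min d r" using d r by simp
        then show thesis using x that unfolding E_def by blast
      qed
      have "cball x h \<subseteq> cball x r" using h by (intro subset_cball) auto
      with r have "cball x h \<subseteq> U" by blast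
      with x h have "(x, h) \<in> K" by (simp only: K_def mem_Collect_eq case_prod_conv simp_thms)
      then show ?thesis using h by (intro bexI[of _ "(x, h)"]) auto
    qed
    obtain C where C: "countable C" "C \<subseteq> K"
        "pairwise (\<lambda>i j. disjnt (cball (fst i) (snd i)) (cball (fst j) (snd j))) C"
        "negligible (E - (\<Union>i\<in>C. cball (fst i) (snd i)))"
    proof (rule Vitali_covering_theorem_cballs[of K snd E fst])
      show "0 < snd i" if "i \<in> K" for i using KD(1)[OF that] .
      show "\<exists>i. i \<in> K \<and> x \<in> cball (fst i) (snd i) \<and> snd i < d" if "x \<in> E" "0 < d" for x d
        using cover[OF that] by (simp only: Bex_def)
    qed (rule that)
    define V where "V = (\<Union>i\<in>C. cball (fst i) (snd i))"
    have bound: "measure lebesgue (\<Union>i\<in>I. cball (fst i) (snd i)) \<le> e"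
      if I: "I \<subseteq> C" "finite I" for I
    proof -
      have disj: "disjoint_family_on (\<lambda>i. cball (fst i) (snd i)) I"
        unfolding disjoint_family_on_def using C(3) I(1) by (meson disjnt_def pairwiseD subsetD)
      have "measure lebesgue (\<Union>i\<in>I. cball (fst i) (snd i)) \<le> (\<Sum>i\<in>I. measure lebesgue (cball (fst i) (snd i)))"
        by (rule measure_UNION_le) (use I in auto)
      also have "\<dots> \<le> (\<Sum>i\<in>I. 2 / c * measure \<nu> (cball (fst i) (snd i)))"
      proof (rule sum_mono)
        fix i assume "i \<in> I"
        then have "0 < snd i" "c * snd i < measure \<nu> (cball (fst i) (snd i))"
          using KD[of i] I C(2) by blast+
        then show "measure lebesgue (cball (fst i) (snd i)) \<le> 2 / c * measure \<nu> (cball (fst i) (snd i))"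
          using c by (simp add: cball_eq_atLeastAtMost field_simps)
      qed
      also have "\<dots> = 2 / c * measure \<nu> (\<Union>i\<in>I. cball (fst i) (snd i))"
      proof -
        have "(\<lambda>i. cball (fst i) (snd i)) ` I \<subseteq> sets \<nu>" by (simp add: sets image_subset_iff)
        from finite_measure_finite_Union[OF I(2) this disj] show ?thesis
          by (simp only: sum_distrib_left)
      qed
      also have "\<dots> \<le> 2 / c * measure \<nu> U"
      proof (rule mult_left_mono[OF finite_measure_mono[OF UN_least]])
        show "cball (fst i) (snd i) \<subseteq> U" if "i \<in> I" for i
          using KD(3)[of i] that I(1) C(2) by blast
        show "U \<in> sets \<nu>" using U by (simp add: sets)
        show "0 \<le> 2 / c" using c by simp
      qed
      also have "\<dots> \<le> 2 / c * (e * c / 2)" using c smallU by (intro mult_left_mono) auto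
      finally show ?thesis using c by simp
    qed
    have V: "V \<in> lmeasurable" "measure lebesgue V \<le> e"
    proof -
      show "V \<in> lmeasurable"
        unfolding V_def by (rule fmeasurable_UN_bound[where B = e]) (use C(1) bound in simp_all)
      show "measure lebesgue V \<le> e"
        unfolding V_def by (rule measure_UN_bound) (use C(1) bound in simp_all)
    qed
    define N where "N = E - V"
    have N: "negligible N" using C(4) by (simp only: N_def V_def)
    have "E \<subseteq> V \<union> N" by (auto simp: N_def)
    moreover have "V \<union> N \<in> lmeasurable" 
      using V N by (intro fmeasurable.Un) (auto simp: negligible_imp_measurable)
    moreover have "measure lebesgue (V \<union> N) \<le> e"
    proof -
      have "measure lebesgue (V \<union> N) \<le> measure lebesgue V + measure lebesgue N"
        using V(1) negligible_imp_sets[OF N] by (intro measure_Un_le) auto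
      with V(2) negligible_imp_measure0[OF N] show ?thesis by simp
    qed
    ultimately show "\<exists>T. E \<subseteq> T \<and> T \<in> lmeasurable \<and> measure lebesgue T \<le> e"
      by (intro exI[of _ "V \<union> N"] conjI)
  qed
  then show ?thesis by (simp only: E_def)
qed

text \<open>The measure with density max(g - p, 0) gives no mass to the set where g < p, yet
  wherever the averages of \<open>g\<close> exceed \<open>q\<close> it charges balls of radius h by
  more than 2 (q - p) h. The preceding density lemma makes the set of such points
  negligible.\<close>

lemma negligible_upper_derivate:
  fixes g :: "real \<Rightarrow> real"
  assumes g: "integrable lborel g" and pq: "p < q"
  shows "negligible {x. g x < p \<and> (\<forall>d>0. \<exists>h. 0 < h \<and> h < d \<and> q * (2 * h) < (LINT t:cball x h|lborel. g t))}"
    (is "negligible ?E0")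
proof -
  define E where "E = ?E0"
  have [measurable]: "g \<in> borel_measurable borel" using g by simp
  have main: "negligible (E \<inter> ball 0 (real n))" for n
  proof -
    \<comment> \<open>Truncation makes the measure finite, since a constant \<open>p\<close> is not
      integrable on the line. The margin 1 in the radius leaves room for balls of radius below 1
      around points of \<open>ball 0 (real n)\<close>.\<close>
    define w where "w = (\<lambda>t. indicator (ball 0 (real n + 1)) t * max (g t - p) 0)"
    have [measurable]: "w \<in> borel_measurable borel" unfolding w_def by (intro borel_measurable_times borel_measurable_indicator borel_measurable_max) auto
    have w0: "0 \<le> w t" for t by (simp add: w_def)
    have intc: "integrable lborel (\<lambda>t. indicator A t * g t)" if "A \<in> sets borel" for A
      using integrable_mult_indicator[OF _ g, of A] that by simp
    have indb: "integrable lborel (\<lambda>t. indicator (ball 0 (real n + 1)) t * c :: real)" for c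
      by (intro integrable_mult_left) (auto simp: integrable_indicator_iff emeasure_bounded_finite[OF bounded_ball, unfolded infinity_ennreal_def])
    have "integrable lborel (\<lambda>t. max (indicator (ball 0 (real n + 1)) t * g t - indicator (ball 0 (real n + 1)) t * p) 0)"
      by (intro integrable_max Bochner_Integration.integrable_diff intc indb) auto
    moreover have "(\<lambda>t. max (indicator (ball 0 (real n + 1)) t * g t - indicator (ball 0 (real n + 1)) t * p) 0) = w"
      by (auto simp: w_def fun_eq_iff indicator_def)
    ultimately have wint: "integrable lborel w" by (simp only:)
    have winti: "integrable lborel (\<lambda>t. indicator A t * w t)" if "A \<in> sets borel" for A
      using integrable_mult_indicator[OF _ wint, of A] that by simp
    define \<nu> where "\<nu> = density lborel (\<lambda>t. ennreal (w t))"
    have em: "emeasure \<nu> A = ennreal (LINT t:A|lborel. w t)" if "A \<in> sets borel" for A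
    proof -
      have "emeasure \<nu> A = (\<integral>\<^sup>+t. ennreal (indicator A t * w t) \<partial>lborel)"
        using that by (simp add: \<nu>_def emeasure_density) (auto intro!: nn_integral_cong simp: indicator_def)
      also have "\<dots> = ennreal (\<integral>t. indicator A t * w t \<partial>lborel)"
        by (rule nn_integral_eq_integral[OF winti[OF that]]) (simp add: w0)
      finally show ?thesis by (simp add: set_lebesgue_integral_def)
    qed
    have meas: "measure \<nu> A = (LINT t:A|lborel. w t)" if "A \<in> sets borel" for A
      unfolding measure_def em[OF that]
      by (rule enn2real_ennreal) (simp add: set_lebesgue_integral_def w0)
    define B where "B = {x. g x < p} \<inter> ball 0 (real n)"
    have B: "B \<in> sets borel" unfolding B_def by measurable
    have sp: "space \<nu> = UNIV" by (simp add: \<nu>_def)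
    have B0: "emeasure \<nu> B = 0"
    proof -
      have "(LINT t:B|lborel. w t) = (LINT t:B|lborel. 0)"
        by (rule set_lebesgue_integral_cong) (use B in \<open>auto simp: B_def w_def\<close>)
      then show ?thesis by (simp add: em[OF B])
    qed
    have fin: "finite_measure \<nu>"
      by (rule finite_measureI) (simp add: sp em)
    have neg: "negligible {x\<in>B. \<forall>d>0. \<exists>h. 0 < h \<and> h < d \<and> (2 * (q - p)) * h < measure \<nu> (cball x h)}"
      by (rule negligible_upper_density[OF fin _ B B0]) (use pq in \<open>auto simp: \<nu>_def\<close>)
    have "\<exists>h. 0 < h \<and> h < d \<and> (2 * (q - p)) * h < measure \<nu> (cball x h)"
      if x: "x \<in> E" "x \<in> ball 0 (real n)" and d: "0 < d" for x d
    proof -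
      have "0 < min d 1" using d by simp
      then obtain h where h: "0 < h" "h < min d 1" "q * (2 * h) < (LINT t:cball x h|lborel. g t)"
        using x(1) unfolding E_def by blast
      have sub: "t \<in> ball 0 (real n + 1)" if "t \<in> cball x h" for t
        using that h x(2) by (auto simp: dist_real_def)
      have ic: "integrable lborel (\<lambda>t. indicator (cball x h) t * c :: real)" for c
        by (intro integrable_mult_left) (auto simp: integrable_indicator_iff emeasure_bounded_finite[OF bounded_cball, unfolded infinity_ennreal_def])
      have "(LINT t:cball x h|lborel. g t) - p * (2 * h) = (\<integral>t. indicator (cball x h) t * g t - indicator (cball x h) t * p \<partial>lborel)"
        using h by (subst Bochner_Integration.integral_diff[OF intc ic])
          (auto simp: set_lebesgue_integral_def cball_eq_atLeastAtMost)
      also have "\<dots> \<le> (\<integral>t. indicator (cball x h) t * w t \<partial>lborel)"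
      proof (rule integral_mono[OF Bochner_Integration.integrable_diff[OF intc ic] winti])
        show "indicator (cball x h) t * g t - indicator (cball x h) t * p \<le> indicator (cball x h) t * w t" for t
          using sub[of t] by (cases "t \<in> cball x h") (simp_all add: w_def)
      qed auto
      also have "\<dots> = measure \<nu> (cball x h)" by (simp add: meas set_lebesgue_integral_def)
      finally have "2 * (q - p) * h < measure \<nu> (cball x h)" using h(3) by (simp add: algebra_simps)
      with h show ?thesis by auto
    qed
    then have "E \<inter> ball 0 (real n) \<subseteq> {x\<in>B. \<forall>d>0. \<exists>h. 0 < h \<and> h < d \<and> (2 * (q - p)) * h < measure \<nu> (cball x h)}"
      unfolding B_def E_def by blast
    with neg show ?thesis by (rule negligible_subset)
  qed
  have "negligible (\<Union>n. E \<inter> ball 0 (real n))" using main by (intro negligible_countable_Union) auto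
  moreover have "E \<subseteq> (\<Union>n. E \<inter> ball 0 (real n))"
  proof
    fix x assume "x \<in> E"
    moreover obtain n where "\<bar>x\<bar> < real n" using reals_Archimedean2 by blast
    ultimately show "x \<in> (\<Union>n. E \<inter> ball 0 (real n))" by (intro UN_I[of n]) (simp_all add: dist_real_def)
  qed
  ultimately have "negligible E" by (rule negligible_subset)
  then show ?thesis by (simp only: E_def)
qed

text \<open>If the upper limit of the averages exceeds g x, then x lies in one of the null sets of
  the previous lemma for a pair of rationals p < q. There are countably many pairs, and the lower
  limit is the same statement for -g.\<close>

lemma lebesgue_differentiation_symmetric:
  fixes g :: "real \<Rightarrow> real"
  assumes g: "integrable lborel g"
  shows "AE x in lborel. ((\<lambda>h. (LINT t:cball x h|lborel. g t) / (2 * h)) \<longlongrightarrow> g x) (at_right 0)"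
proof -
  define E where "E f p q = {x. f x < p \<and> (\<forall>d>0. \<exists>h. 0 < h \<and> h < d \<and> q * (2 * h) < (LINT t:cball x h|lborel. f t))}"
    for f :: "real \<Rightarrow> real" and p q :: real
  define N where "N f = (\<Union>(p, q)\<in>{(p, q). p \<in> \<rat> \<and> q \<in> \<rat> \<and> p < q}. E f p q)" for f
  have negl: "negligible (N f)" if f: "integrable lborel f" for f
    unfolding N_def
  proof (rule negligible_countable_Union)
    have negl1: "negligible (E f p q)" if "p < q" for p q
      unfolding E_def by (rule negligible_upper_derivate[OF f that])
    have "countable (\<rat> \<times> \<rat> :: (real \<times> real) set)" by (intro countable_SIGMA countable_rat)
    then show "countable ((\<lambda>(p, q). E f p q) ` {(p, q). p \<in> \<rat> \<and> q \<in> \<rat> \<and> p < q})"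
      by (intro countable_image) (rule countable_subset[rotated], auto)
    show "negligible A" if "A \<in> (\<lambda>(p, q). E f p q) ` {(p, q). p \<in> \<rat> \<and> q \<in> \<rat> \<and> p < q}" for A
      using that by (auto intro: negl1)
  qed
  have upper: "\<forall>\<^sub>F h in at_right 0. (LINT t:cball x h|lborel. f t) / (2 * h) < a"
    if x: "x \<notin> N f" and a: "f x < a" for f x a
  proof -
    obtain q where q: "q \<in> \<rat>" "f x < q" "q < a" using Rats_dense_in_real[OF a] by auto
    obtain p where p: "p \<in> \<rat>" "f x < p" "p < q" using Rats_dense_in_real[OF q(2)] by auto
    have "x \<notin> E f p q" using x p q by (auto simp: N_def)
    then obtain d where d: "0 < d" "\<And>h. 0 < h \<Longrightarrow> h < d \<Longrightarrow> (LINT t:cball x h|lborel. f t) \<le> q * (2 * h)"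
    proof -
      have "\<exists>d>0. \<forall>h. 0 < h \<longrightarrow> h < d \<longrightarrow> (LINT t:cball x h|lborel. f t) \<le> q * (2 * h)"
        using \<open>x \<notin> E f p q\<close> p(2) unfolding E_def mem_Collect_eq not_less[symmetric] by blast
      then show thesis using that by blast
    qed
    show ?thesis
      unfolding eventually_at_right_field
    proof (intro exI[of _ d] conjI allI impI d(1))
      fix h assume h: "0 < h" "h < d"
      then have "(LINT t:cball x h|lborel. f t) / (2 * h) \<le> q" using d(2)[of h] by (simp add: field_simps)
      then show "(LINT t:cball x h|lborel. f t) / (2 * h) < a" using q by simp
    qed
  qed
  have "AE x in lebesgue. x \<notin> N g \<union> N (\<lambda>t. - g t)"
    using negl[of g] negl[of "\<lambda>t. - g t"] g
    by (intro AE_not_in) (auto simp: negligible_iff_null_sets[symmetric])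
  then have "AE x in lborel. x \<notin> N g \<union> N (\<lambda>t. - g t)"
    by (simp add: AE_completion_iff)
  then show ?thesis
  proof eventually_elim
    case (elim x)
    show ?case
    proof (rule order_tendstoI)
      fix a assume "a < g x"
      then have "\<forall>\<^sub>F h in at_right 0. (LINT t:cball x h|lborel. - g t) / (2 * h) < - a"
        using upper[of x "\<lambda>t. - g t" "- a"] elim by auto
      then show "\<forall>\<^sub>F h in at_right 0. a < (LINT t:cball x h|lborel. g t) / (2 * h)"
        by eventually_elim (simp add: set_lebesgue_integral_def)
    next
      fix a assume "g x < a"
      then show "\<forall>\<^sub>F h in at_right 0. (LINT t:cball x h|lborel. g t) / (2 * h) < a"
        using upper[of x g a] elim by auto
    qed
  qed
qed

section \<open>The Poisson kernel\<close>

definition poisson :: "complex \<Rightarrow> real \<Rightarrow> real"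
  where "poisson z t = Im z / (pi * ((t - Re z)\<^sup>2 + (Im z)\<^sup>2))"

lemma poisson_nonneg: "0 \<le> Im z \<Longrightarrow> 0 \<le> poisson z t"
  by (simp add: poisson_def)

lemma borel_measurable_poisson [measurable]: "poisson z \<in> borel_measurable borel"
  unfolding poisson_def[abs_def] by measurable

lemma
  assumes z: "0 < Im z"
  shows integrable_poisson: "integrable lborel (poisson z)"
    and integral_poisson: "(\<integral>t. poisson z t \<partial>lborel) = 1"
proof -
  define F where "F t = arctan ((t - Re z) / Im z) / pi" for t
  have der: "DERIV F t :> poisson z t" for t
  proof -
    have "DERIV F t :> (1 / Im z) / (1 + ((t - Re z) / Im z)\<^sup>2) / pi"
      unfolding F_def using z by (auto intro!: derivative_eq_intros simp: inverse_eq_divide)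
    also have "1 + ((t - Re z) / Im z)\<^sup>2 = ((t - Re z)\<^sup>2 + (Im z)\<^sup>2) / (Im z)\<^sup>2"
      using z by (simp add: power_divide field_simps)
    finally show ?thesis using z by (simp add: poisson_def power2_eq_square mult.commute)
  qed
  have cont: "isCont (poisson z) t" for t
    unfolding poisson_def[abs_def] using z
    by (intro continuous_intros) (simp_all add: add_nonneg_eq_0_iff)
  have top: "(F \<longlongrightarrow> (pi / 2) / pi) at_top" "(F \<longlongrightarrow> (- (pi / 2)) / pi) at_bot"
  proof -
    have "filterlim (\<lambda>t. (t - Re z) / Im z) at_top at_top" using z by real_asymp
    from filterlim_compose[OF tendsto_arctan_at_top this]
    show "(F \<longlongrightarrow> (pi / 2) / pi) at_top" unfolding F_def by (intro tendsto_divide tendsto_const) auto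
    have "filterlim (\<lambda>t. (t - Re z) / Im z) at_bot at_bot" using z by real_asymp
    from filterlim_compose[OF tendsto_arctan_at_bot this]
    show "(F \<longlongrightarrow> (- (pi / 2)) / pi) at_bot" unfolding F_def by (intro tendsto_divide tendsto_const) auto
  qed
  have *: "set_integrable lborel (einterval (- \<infinity>) \<infinity>) (poisson z)"
      "(LBINT t=-\<infinity>..\<infinity>. poisson z t) = (pi / 2) / pi - (- (pi / 2)) / pi"
    by (rule interval_integral_FTC_nonneg[of "-\<infinity>" "\<infinity>" F]; use z der cont top in \<open>simp add: ereal_tendsto_simps poisson_nonneg\<close>)+
  have e: "einterval (-\<infinity>) \<infinity> = UNIV" by (auto simp: einterval_def)
  show "integrable lborel (poisson z)" "(\<integral>t. poisson z t \<partial>lborel) = 1"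
    using * by (simp_all add: e set_integrable_def set_lebesgue_integral_def interval_lebesgue_integral_def)
qed

text \<open>The Poisson kernel is a superposition of the averaging kernels of intervals, with weight
  \<^term>\<open>poisson_weight\<close> for the interval of half-width \<^term>\<open>y * s :: real\<close>.\<close>

definition poisson_weight :: "real \<Rightarrow> real"
  where "poisson_weight s = (2 / pi) * s / (1 + s\<^sup>2)\<^sup>2"

lemma borel_measurable_poisson_weight [measurable]: "poisson_weight \<in> borel_measurable borel"
  unfolding poisson_weight_def[abs_def] by measurable

lemma poisson_weight_nonneg: "0 \<le> s \<Longrightarrow> 0 \<le> poisson_weight s"
  by (simp add: poisson_weight_def)

lemma has_bochner_integral_FTC_atLeast:
  fixes f F :: "real \<Rightarrow> real"
  assumes f: "f \<in> borel_measurable borel" and F: "\<And>x. a \<le> x \<Longrightarrow> DERIV F x :> f x"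
    and nonneg: "\<And>x. a \<le> x \<Longrightarrow> 0 \<le> f x" and lim: "(F \<longlongrightarrow> T) at_top"
  shows "has_bochner_integral lborel (\<lambda>x. indicator {a..} x * f x) (T - F a)"
proof (rule has_bochner_integral_nn_integral)
  have "F a \<le> F x" if "a \<le> x" for x
    using that F nonneg by (intro DERIV_nonneg_imp_nondecreasing[of a x F]) (auto intro: order_trans)
  then show "0 \<le> T - F a"
    using tendsto_lowerbound[OF lim, of "F a"] by (auto simp: eventually_at_top_linorder)
  have "(\<integral>\<^sup>+ x. ennreal (indicator {a..} x * f x) \<partial>lborel)
      = (\<integral>\<^sup>+ x. ennreal (f x) * indicator {a..} x \<partial>lborel)"
    by (intro nn_integral_cong) (auto simp: indicator_def)
  also have "\<dots> = ennreal (T - F a)" by (rule nn_integral_FTC_atLeast[OF f F nonneg lim])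
  finally show "(\<integral>\<^sup>+ x. ennreal (indicator {a..} x * f x) \<partial>lborel) = ennreal (T - F a)" .
qed (use f nonneg in \<open>auto simp: indicator_def\<close>)

text \<open>The tail of the weight from \<open>a\<close> on is the profile of the Poisson kernel at
  height 1. With a = |t - x| / y it collects exactly the intervals of half-width y s around x that
  contain t.\<close>

lemma poisson_weight_tail:
  assumes "0 \<le> a"
  shows "has_bochner_integral lborel (\<lambda>s. indicator {a..} s * poisson_weight s) (1 / (pi * (1 + a\<^sup>2)))"
proof -
  have pos: "1 + s\<^sup>2 \<noteq> 0" for s :: real by (simp add: add_nonneg_eq_0_iff)
  have "has_bochner_integral lborel (\<lambda>s. indicator {a..} s * poisson_weight s) (0 - (- 1 / (pi * (1 + a\<^sup>2))))"
  proof (rule has_bochner_integral_FTC_atLeast[where F = "\<lambda>s. - 1 / (pi * (1 + s\<^sup>2))"])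
    show "((\<lambda>s. - 1 / (pi * (1 + s\<^sup>2))) has_real_derivative poisson_weight s) (at s)" for s
    proof -
      have "((\<lambda>s. - 1 / (pi * (1 + s\<^sup>2))) has_real_derivative (pi * (2 * s)) / (pi * (1 + s\<^sup>2))\<^sup>2) (at s)"
        using pos[of s] by (auto intro!: derivative_eq_intros simp: power2_eq_square)
      then show ?thesis by (simp add: poisson_weight_def power2_eq_square mult_ac)
    qed
    show "((\<lambda>s::real. - 1 / (pi * (1 + s\<^sup>2))) \<longlongrightarrow> 0) at_top" by real_asymp
  qed (use assms in \<open>auto intro: poisson_weight_nonneg\<close>)
  then show ?thesis by simp
qed

text \<open>The factor 2 s is the length of an interval of half-width s. Hence, once the integrals
  over intervals are rewritten as averages, the mixture is with respect to a probability
  density.\<close>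

lemma poisson_weight_total:
  "has_bochner_integral lborel (\<lambda>s. indicator {0..} s * (poisson_weight s * (2 * s))) 1"
proof -
  have pos: "1 + s\<^sup>2 \<noteq> 0" for s :: real by (simp add: add_nonneg_eq_0_iff)
  define F where "F s = (2 / pi) * (arctan s - s / (1 + s\<^sup>2))" for s :: real
  have "has_bochner_integral lborel (\<lambda>s. indicator {0..} s * (poisson_weight s * (2 * s))) (1 - F 0)"
  proof (rule has_bochner_integral_FTC_atLeast)
    show "(F has_real_derivative poisson_weight s * (2 * s)) (at s)" for s
    proof -
      have "(F has_real_derivative (2 / pi) * (1 / (1 + s\<^sup>2) - (1 * (1 + s\<^sup>2) - s * (2 * s)) / (1 + s\<^sup>2)\<^sup>2)) (at s)"
        unfolding F_def using pos[of s]
        by (auto intro!: derivative_eq_intros simp: power2_eq_square inverse_eq_divide)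
      also have "1 / (1 + s\<^sup>2) - (1 * (1 + s\<^sup>2) - s * (2 * s)) / (1 + s\<^sup>2)\<^sup>2 = 2 * s\<^sup>2 / (1 + s\<^sup>2)\<^sup>2"
        using pos[of s] by (simp add: divide_simps) (simp add: power2_eq_square algebra_simps)
      finally show ?thesis by (simp add: poisson_weight_def power2_eq_square)
    qed
    show "(F \<longlongrightarrow> 1) at_top" unfolding F_def by real_asymp
  qed (auto simp: poisson_weight_nonneg)
  then show ?thesis by (simp add: F_def)
qed

text \<open>Fubini for the indicator of |t - x| / y \<le> s: integrating s out first gives the
  Poisson kernel by the tail formula, integrating t out first gives integrals over
  intervals.\<close>

lemma poisson_layer_cake:
  fixes g :: "real \<Rightarrow> real"
  assumes g: "integrable lborel g" and y: "0 < y"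
  shows "(\<integral>t. poisson (Complex x y) t * g t \<partial>lborel) =
    (\<integral>s. indicator {0..} s * (poisson_weight s * ((LINT t:cball x (y * s)|lborel. g t) / y)) \<partial>lborel)"
proof -
  have [measurable]: "g \<in> borel_measurable borel" using g by simp
  define f where "f t s = indicator {\<bar>t - x\<bar> / y..} s * poisson_weight s * (g t / y)" for t s
  have fm: "case_prod f \<in> borel_measurable (lborel \<Otimes>\<^sub>M lborel)"
  proof -
    have "(\<lambda>(t, s). (if \<bar>t - x\<bar> / y \<le> s then 1 else 0) * poisson_weight s * (g t / y)) \<in> borel_measurable (lborel \<Otimes>\<^sub>M lborel)"
      by measurable
    also have "(\<lambda>(t, s). (if \<bar>t - x\<bar> / y \<le> s then 1 else 0) * poisson_weight s * (g t / y)) = case_prod f"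
      by (auto simp: f_def fun_eq_iff)
    finally show ?thesis .
  qed
  have P: "1 / (pi * (1 + (\<bar>t - x\<bar> / y)\<^sup>2)) * (c / y) = poisson (Complex x y) t * c" for t c
    using y by (simp add: poisson_def power_divide field_simps power2_eq_square)
  have inner: "has_bochner_integral lborel (\<lambda>s. f t s) (poisson (Complex x y) t * g t)" for t
    using has_bochner_integral_mult_left[OF poisson_weight_tail[of "\<bar>t - x\<bar> / y"], of "g t / y"] y
    unfolding f_def P by simp
  have norm_inner: "has_bochner_integral lborel (\<lambda>s. norm (f t s)) (poisson (Complex x y) t * norm (g t))" for t
  proof -
    have "norm (f t s) = indicator {\<bar>t - x\<bar> / y..} s * poisson_weight s * (norm (g t) / y)" for s
    proof (cases "\<bar>t - x\<bar> / y \<le> s")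
      case True
      moreover have "0 \<le> \<bar>t - x\<bar> / y" using y by simp
      ultimately have "0 \<le> s" by linarith
      with True y show ?thesis by (simp add: f_def abs_mult poisson_weight_nonneg)
    qed (simp add: f_def)
    then show ?thesis
      using has_bochner_integral_mult_left[OF poisson_weight_tail[of "\<bar>t - x\<bar> / y"], of "norm (g t) / y"] y
      unfolding P by simp
  qed
  have Pbound: "poisson (Complex x y) t \<le> 1 / (pi * y)" for t
  proof -
    have "pi * y * y \<le> pi * ((t - x)\<^sup>2 + y\<^sup>2)" using y by (simp add: power2_eq_square)
    then show ?thesis using y by (simp add: poisson_def divide_simps add_nonneg_pos power2_eq_square mult.assoc)
  qed
  have "integrable (lborel \<Otimes>\<^sub>M lborel) (case_prod f)"
  proof (rule lborel_pair.Fubini_integrable[OF fm])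
    have "integrable lborel (\<lambda>t. poisson (Complex x y) t * norm (g t))"
    proof (rule Bochner_Integration.integrable_bound[where f = "\<lambda>t. (1 / (pi * y)) * g t"])
      show "AE t in lborel. norm (poisson (Complex x y) t * norm (g t)) \<le> norm ((1 / (pi * y)) * g t)"
        using Pbound y by (intro AE_I2) (simp add: abs_mult poisson_nonneg mult_right_mono del: times_divide_eq_left)
    qed (use g in \<open>simp_all\<close>)
    then show "integrable lborel (\<lambda>t. \<integral>s. norm (case_prod f (t, s)) \<partial>lborel)"
      using has_bochner_integral_integral_eq[OF norm_inner] by simp
    show "AE t in lborel. integrable lborel (\<lambda>s. case_prod f (t, s))"
      using inner by (intro AE_I2) (auto simp: has_bochner_integral_iff)
  qed
  from lborel_pair.Fubini_integral[OF this]
  have "(\<integral>t. poisson (Complex x y) t * g t \<partial>lborel) = (\<integral>s. \<integral>t. f t s \<partial>lborel \<partial>lborel)"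
    using has_bochner_integral_integral_eq[OF inner] by simp
  also have "\<dots> = (\<integral>s. indicator {0..} s * (poisson_weight s * ((LINT t:cball x (y * s)|lborel. g t) / y)) \<partial>lborel)"
  proof (intro Bochner_Integration.integral_cong refl)
    fix s :: real
    have "f t s = (indicator {0..} s * poisson_weight s / y) * (indicator (cball x (y * s)) t * g t)" for t
    proof -
      have "\<bar>t - x\<bar> / y \<le> s \<longleftrightarrow> dist x t \<le> y * s" using y by (simp add: field_simps dist_real_def abs_minus_commute)
      moreover have "0 \<le> s" if "\<bar>t - x\<bar> / y \<le> s" using order_trans[OF _ that, of 0] y by simp
      ultimately show ?thesis by (simp add: f_def indicator_def)
    qed
    then show "(\<integral>t. f t s \<partial>lborel) = indicator {0..} s * (poisson_weight s * ((LINT t:cball x (y * s)|lborel. g t) / y))"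
      by (simp add: set_lebesgue_integral_def)
  qed
  finally show ?thesis .
qed

text \<open>In the layer-cake formula the inner average has half-width y * s, so for each fixed s >
  0 it tends to \<open>c\<close> as y tends to 0. Dominated convergence in s, against the weight of
  total mass 1, finishes the argument.\<close>

lemma poisson_integral_tendsto:
  fixes g :: "real \<Rightarrow> real"
  assumes g: "integrable lborel g"
    and lim: "((\<lambda>h. (LINT t:cball x h|lborel. g t) / (2 * h)) \<longlongrightarrow> c) (at_right 0)"
  shows "((\<lambda>y. \<integral>t. poisson (Complex x y) t * g t \<partial>lborel) \<longlongrightarrow> c) (at_right 0)"
  unfolding tendsto_at_iff_sequentially
proof (intro allI impI)
  fix Y :: "nat \<Rightarrow> real"
  assume "\<forall>i. Y i \<in> {0<..} - {0}" and Y0: "Y \<longlonglongrightarrow> 0"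
  then have Y: "0 < Y i" for i by auto
  have [measurable]: "g \<in> borel_measurable borel" using g by simp
  define m where "m h = (LINT t:cball x h|lborel. g t)" for h
  have mm [measurable]: "m \<in> borel_measurable borel"
  proof -
    have "(\<lambda>h. \<integral>t. (if dist x t \<le> h then 1 else 0) * g t \<partial>lborel) \<in> borel_measurable borel"
      by measurable
    moreover have "m = (\<lambda>h. \<integral>t. (if dist x t \<le> h then 1 else 0) * g t \<partial>lborel)"
      unfolding m_def set_lebesgue_integral_def
      by (intro ext Bochner_Integration.integral_cong) (auto simp: indicator_def)
    ultimately show ?thesis by simp
  qed
  define A where "A = (\<integral>t. \<bar>g t\<bar> \<partial>lborel)"
  have mA: "\<bar>m h\<bar> \<le> A" for h
  proof -
    have "\<bar>m h\<bar> \<le> (\<integral>t. norm (indicator (cball x h) t *\<^sub>R g t) \<partial>lborel)"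
      unfolding m_def set_lebesgue_integral_def using integral_norm_bound[of lborel] by force
    also have "\<dots> \<le> A" unfolding A_def
      using g by (intro integral_mono integrable_norm integrable_mult_indicator) (auto simp: indicator_def)
    finally show ?thesis .
  qed
  \<comment> \<open>A bound linear in h at all scales is what dominates the integrand uniformly in
    y. Below \<open>d\<close> it comes from convergence of the averages, and from \<open>d\<close>
    on from the total mass \<open>A\<close>, as A \<le> (A / d) * h.\<close>
  obtain C where C: "\<And>h. 0 < h \<Longrightarrow> \<bar>m h\<bar> \<le> C * h"
  proof -
    have "\<forall>\<^sub>F h in at_right 0. \<bar>m h / (2 * h)\<bar> < \<bar>c\<bar> + 1"
      using tendsto_rabs[OF lim] unfolding m_def by (rule order_tendstoD) simp
    then obtain d where d: "0 < d" "\<And>h. 0 < h \<Longrightarrow> h < d \<Longrightarrow> \<bar>m h / (2 * h)\<bar> < \<bar>c\<bar> + 1"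
      unfolding eventually_at_right_field by blast
    have A0: "0 \<le> A" unfolding A_def by simp
    have "\<bar>m h\<bar> \<le> (2 * (\<bar>c\<bar> + 1) + A / d) * h" if h: "0 < h" for h
    proof (cases "h < d")
      case True
      then have "\<bar>m h\<bar> \<le> (2 * (\<bar>c\<bar> + 1)) * h" using d(2)[OF h True] h by (simp add: abs_mult field_simps)
      also have "\<dots> \<le> (2 * (\<bar>c\<bar> + 1) + A / d) * h" using h A0 d by (intro mult_right_mono) auto
      finally show ?thesis .
    next
      case False
      have "A / d * d \<le> A / d * h" using False d A0 by (intro mult_left_mono) auto
      then have "\<bar>m h\<bar> \<le> A / d * h" using mA[of h] d by simp
      also have "\<dots> \<le> (2 * (\<bar>c\<bar> + 1) + A / d) * h" using h by (intro mult_right_mono) auto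
      finally show ?thesis .
    qed
    then show ?thesis by (rule that)
  qed
  have w: "has_bochner_integral lborel (\<lambda>s. indicator {0..} s * (poisson_weight s * (2 * s)) * k) k" for k
    using has_bochner_integral_mult_left[OF poisson_weight_total, of k] by simp
  have "(\<lambda>i. \<integral>s. indicator {0..} s * (poisson_weight s * (m (Y i * s) / Y i)) \<partial>lborel)
    \<longlonglongrightarrow> (\<integral>s. indicator {0..} s * (poisson_weight s * (2 * s)) * c \<partial>lborel)"
  proof (rule integral_dominated_convergence[where w = "\<lambda>s. indicator {0..} s * (poisson_weight s * (2 * s)) * (C / 2)"])
    show "integrable lborel (\<lambda>s. indicator {0..} s * (poisson_weight s * (2 * s)) * (C / 2))"
      using w[of "C / 2"] by (rule integrable.intros)
    show "AE s in lborel. (\<lambda>i. indicator {0..} s * (poisson_weight s * (m (Y i * s) / Y i)))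
        \<longlonglongrightarrow> indicator {0..} s * (poisson_weight s * (2 * s)) * c"
    proof (rule AE_I2)
      fix s :: real
      consider "s < 0" | "s = 0" | "0 < s" by linarith
      then show "(\<lambda>i. indicator {0..} s * (poisson_weight s * (m (Y i * s) / Y i)))
        \<longlonglongrightarrow> indicator {0..} s * (poisson_weight s * (2 * s)) * c"
      proof cases
        case 3
        have "filterlim (\<lambda>i. Y i * s) (at_right 0) sequentially"
          using Y 3 tendsto_mult[OF Y0 tendsto_const[of s]]
          by (auto simp: filterlim_at less_imp_neq[symmetric] intro!: always_eventually)
        from filterlim_compose[OF lim this] 
        have "(\<lambda>i. 2 * s * (m (Y i * s) / (2 * (Y i * s)))) \<longlonglongrightarrow> 2 * s * c"
          unfolding m_def by (intro tendsto_mult tendsto_const)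
        moreover have "2 * s * (m (Y i * s) / (2 * (Y i * s))) = m (Y i * s) / Y i" for i
          using 3 by simp
        ultimately have "(\<lambda>i. m (Y i * s) / Y i) \<longlonglongrightarrow> 2 * s * c" by simp
        then have "(\<lambda>i. poisson_weight s * (m (Y i * s) / Y i)) \<longlonglongrightarrow> poisson_weight s * (2 * s * c)"
          by (intro tendsto_mult tendsto_const)
        then show ?thesis using 3 by (simp add: mult.assoc)
      qed (simp_all add: poisson_weight_def)
    qed
    show "AE s in lborel. norm (indicator {0..} s * (poisson_weight s * (m (Y i * s) / Y i)))
        \<le> indicator {0..} s * (poisson_weight s * (2 * s)) * (C / 2)" for i
    proof (rule AE_I2)
      fix s :: real
      consider "s < 0" | "s = 0" | "0 < s" by linarith
      then show "norm (indicator {0..} s * (poisson_weight s * (m (Y i * s) / Y i)))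
        \<le> indicator {0..} s * (poisson_weight s * (2 * s)) * (C / 2)"
      proof cases
        case 3
        have "\<bar>m (Y i * s)\<bar> / Y i \<le> C * s"
          using C[of "Y i * s"] Y[of i] 3 by (simp add: field_simps)
        then have "poisson_weight s * (\<bar>m (Y i * s)\<bar> / Y i) \<le> poisson_weight s * (C * s)"
          using 3 by (intro mult_left_mono poisson_weight_nonneg) auto
        then show ?thesis using 3 Y[of i] by (simp add: abs_mult poisson_weight_nonneg mult_ac)
      qed (simp_all add: poisson_weight_def)
    qed
  qed measurable
  then show "((\<lambda>y. \<integral>t. poisson (Complex x y) t * g t \<partial>lborel) \<circ> Y) \<longlonglongrightarrow> c"
    unfolding has_bochner_integral_integral_eq[OF w]
    using poisson_layer_cake[OF g Y] by (simp add: o_def m_def)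
qed

text \<open>Near x the truncation of \<open>g\<close> is integrable and the preceding lemma applies.
  The part of \<open>g\<close> at distance at least 1 from x contributes O(y), because there the
  Poisson kernel at height y is at most 2 y times the one at height 1.\<close>

lemma poisson_vertical_limit_real:
  fixes g :: "real \<Rightarrow> real"
  assumes gm: "g \<in> borel_measurable borel"
    and int: "\<And>z. 0 < Im z \<Longrightarrow> integrable lborel (\<lambda>t. poisson z t * g t)"
  shows "AE x in lborel. ((\<lambda>y. \<integral>t. poisson (Complex x y) t * g t \<partial>lborel) \<longlongrightarrow> g x) (at_right 0)"
proof -
  note [measurable] = gm
  \<comment> \<open>The cut is at n + 1 while the point x will satisfy |x| < n; the part that is
    removed thus keeps distance at least 1 from x.\<close>
  define G where "G n t = indicator (cball 0 (real n + 1)) t * g t" for n t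
  have G: "integrable lborel (G n)" for n
  proof (rule Bochner_Integration.integrable_bound)
    show "integrable lborel (\<lambda>t. (pi * ((real n + 1)\<^sup>2 + 1)) * (poisson \<i> t * g t))"
      using int[of \<i>] by simp
    show "G n \<in> borel_measurable lborel"
      unfolding G_def[abs_def] using gm by (intro borel_measurable_times borel_measurable_indicator) auto
    show "AE t in lborel. norm (G n t) \<le> norm ((pi * ((real n + 1)\<^sup>2 + 1)) * (poisson \<i> t * g t))"
    proof (rule AE_I2)
      fix t
      show "norm (G n t) \<le> norm ((pi * ((real n + 1)\<^sup>2 + 1)) * (poisson \<i> t * g t))"
      proof (cases "\<bar>t\<bar> \<le> real n + 1")
        case True
        then have "t\<^sup>2 \<le> (real n + 1)\<^sup>2" by (simp add: abs_le_square_iff[symmetric])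
        then have "1 \<le> (pi * ((real n + 1)\<^sup>2 + 1)) * poisson \<i> t"
          by (simp add: poisson_def divide_simps add_nonneg_pos)
        then have "1 * norm (g t) \<le> ((pi * ((real n + 1)\<^sup>2 + 1)) * poisson \<i> t) * norm (g t)"
          by (rule mult_right_mono) simp
        with True show ?thesis
          by (simp add: G_def abs_mult poisson_nonneg mult.assoc)
      qed (simp add: G_def)
    qed
  qed
  have "AE x in lborel. \<forall>n. ((\<lambda>h. (LINT t:cball x h|lborel. G n t) / (2 * h)) \<longlongrightarrow> G n x) (at_right 0)"
    unfolding AE_all_countable using lebesgue_differentiation_symmetric[OF G] by blast
  then show ?thesis
  proof eventually_elim
    case (elim x)
    obtain n where n: "\<bar>x\<bar> < real n" using reals_Archimedean2 by blast
    define r where "r t = g t - G n t" for t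
    have [measurable]: "r \<in> borel_measurable borel" using G[of n] unfolding r_def[abs_def] by measurable
    have lim1: "((\<lambda>y. \<integral>t. poisson (Complex x y) t * G n t \<partial>lborel) \<longlongrightarrow> G n x) (at_right 0)"
      using elim by (intro poisson_integral_tendsto G) blast
    define A where "A = (\<integral>t. 2 * norm (poisson (Complex x 1) t * g t) \<partial>lborel)"
    have bnd: "norm (poisson (Complex x y) t * r t) \<le> y * (2 * norm (poisson (Complex x 1) t * g t))"
      if y: "0 < y" for y t
    proof (cases "\<bar>t\<bar> \<le> real n + 1")
      case False
      then have "1 \<le> \<bar>t - x\<bar>" using n by linarith
      then have 1: "1 \<le> (t - x)\<^sup>2" using abs_le_square_iff[of 1 "t - x"] by simp
      have "poisson (Complex x y) t \<le> y / (pi * (t - x)\<^sup>2)"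
        unfolding poisson_def complex.sel using 1 y
        by (intro divide_left_mono mult_left_mono mult_pos_pos add_pos_nonneg) auto
      also have "\<dots> = (y / pi) * (1 / (t - x)\<^sup>2)" by simp
      also have "\<dots> \<le> (y / pi) * (2 / ((t - x)\<^sup>2 + 1))"
      proof (rule mult_left_mono)
        have "0 < (t - x)\<^sup>2" using 1 by linarith
        then show "1 / (t - x)\<^sup>2 \<le> 2 / ((t - x)\<^sup>2 + 1)" using 1 by (simp add: divide_le_eq le_divide_eq add_pos_pos)
      qed (use y in simp)
      also have "\<dots> = y * (2 * poisson (Complex x 1) t)" by (simp add: poisson_def)
      finally have "poisson (Complex x y) t * \<bar>g t\<bar> \<le> y * (2 * poisson (Complex x 1) t) * \<bar>g t\<bar>"
        by (rule mult_right_mono) simp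
      with False y show ?thesis
        by (simp add: r_def G_def abs_mult poisson_nonneg mult_ac)
    qed (use y in \<open>simp add: r_def G_def\<close>)
    have int1: "integrable lborel (\<lambda>t. 2 * norm (poisson (Complex x 1) t * g t))"
      using int[of "Complex x 1"] by (intro integrable_mult_right integrable_norm) simp
    have intr: "integrable lborel (\<lambda>t. poisson (Complex x y) t * r t)" if y: "0 < y" for y
    proof (rule Bochner_Integration.integrable_bound[OF integrable_mult_right[OF int1]])
      show "AE t in lborel. norm (poisson (Complex x y) t * r t) \<le> norm (y * (2 * norm (poisson (Complex x 1) t * g t)))"
      proof (rule AE_I2)
        fix t
        show "norm (poisson (Complex x y) t * r t) \<le> norm (y * (2 * norm (poisson (Complex x 1) t * g t)))"
          using order_trans[OF bnd[OF y, of t] abs_ge_self] by simp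
      qed
    qed measurable
    have lim2: "((\<lambda>y. \<integral>t. poisson (Complex x y) t * r t \<partial>lborel) \<longlongrightarrow> 0) (at_right 0)"
    proof (rule Lim_null_comparison)
      show "\<forall>\<^sub>F y in at_right 0. norm (\<integral>t. poisson (Complex x y) t * r t \<partial>lborel) \<le> y * A"
        unfolding eventually_at_right_field
      proof (intro exI[of _ 1] conjI allI impI)
        fix y :: real assume y: "0 < y"
        have "norm (\<integral>t. poisson (Complex x y) t * r t \<partial>lborel) \<le> (\<integral>t. y * (2 * norm (poisson (Complex x 1) t * g t)) \<partial>lborel)"
          by (rule Bochner_Integration.integral_norm_bound_integral) (use intr[OF y] int1 bnd[OF y] in simp_all)
        then show "norm (\<integral>t. poisson (Complex x y) t * r t \<partial>lborel) \<le> y * A"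
          unfolding A_def using int1 by simp
      qed simp
      show "((\<lambda>y. y * A) \<longlongrightarrow> 0) (at_right 0)" by (auto intro!: tendsto_eq_intros)
    qed
    have "G n x = g x" using n by (simp add: G_def)
    with tendsto_add[OF lim1 lim2]
    have "((\<lambda>y. (\<integral>t. poisson (Complex x y) t * G n t \<partial>lborel) + (\<integral>t. poisson (Complex x y) t * r t \<partial>lborel)) \<longlongrightarrow> g x) (at_right 0)"
      by simp
    then show ?case
    proof (rule Lim_transform_eventually)
      show "\<forall>\<^sub>F y in at_right 0. (\<integral>t. poisson (Complex x y) t * G n t \<partial>lborel) + (\<integral>t. poisson (Complex x y) t * r t \<partial>lborel)
          = (\<integral>t. poisson (Complex x y) t * g t \<partial>lborel)"
        unfolding eventually_at_right_field
      proof (intro exI[of _ 1] conjI allI impI)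
        fix y :: real assume y: "0 < y"
        have "integrable lborel (\<lambda>t. poisson (Complex x y) t * g t - poisson (Complex x y) t * r t)"
          by (intro Bochner_Integration.integrable_diff int intr y) (simp add: y)
        then have "integrable lborel (\<lambda>t. poisson (Complex x y) t * G n t)"
          by (simp add: r_def algebra_simps)
        from Bochner_Integration.integral_add[OF this intr[OF y]]
        show "(\<integral>t. poisson (Complex x y) t * G n t \<partial>lborel) + (\<integral>t. poisson (Complex x y) t * r t \<partial>lborel)
          = (\<integral>t. poisson (Complex x y) t * g t \<partial>lborel)"
          by (simp add: r_def algebra_simps)
      qed simp
    qed
  qed
qed

definition poisson_integral :: "(real \<Rightarrow> complex) \<Rightarrow> complex \<Rightarrow> complex"
  where "poisson_integral g z = (\<integral>t. poisson z t *\<^sub>R g t \<partial>lborel)"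

theorem poisson_vertical_limit:
  fixes g :: "real \<Rightarrow> complex"
  assumes [measurable]: "g \<in> borel_measurable borel"
    and int: "\<And>z. 0 < Im z \<Longrightarrow> integrable lborel (\<lambda>t. poisson z t *\<^sub>R g t)"
  shows "AE x in lborel. ((\<lambda>y. poisson_integral g (Complex x y)) \<longlongrightarrow> g x) (at_right 0)"
proof -
  have "AE x in lborel. ((\<lambda>y. \<integral>t. poisson (Complex x y) t * Re (g t) \<partial>lborel) \<longlongrightarrow> Re (g x)) (at_right 0)"
    using integrable_Re[OF int] by (intro poisson_vertical_limit_real) simp_all
  moreover have "AE x in lborel. ((\<lambda>y. \<integral>t. poisson (Complex x y) t * Im (g t) \<partial>lborel) \<longlongrightarrow> Im (g x)) (at_right 0)"
    using integrable_Im[OF int] by (intro poisson_vertical_limit_real) simp_all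
  ultimately show ?thesis
  proof eventually_elim
    case (elim x)
    have ev: "\<forall>\<^sub>F y in at_right 0. (0::real) < y" by (simp add: eventually_at_right_less)
    have re: "\<forall>\<^sub>F y in at_right 0. (\<integral>t. poisson (Complex x y) t * Re (g t) \<partial>lborel) = Re (poisson_integral g (Complex x y))"
      using ev unfolding poisson_integral_def
      by eventually_elim (use integral_Re[OF int[of "Complex x _"]] in simp)
    have im: "\<forall>\<^sub>F y in at_right 0. (\<integral>t. poisson (Complex x y) t * Im (g t) \<partial>lborel) = Im (poisson_integral g (Complex x y))"
      using ev unfolding poisson_integral_def
      by eventually_elim (use integral_Im[OF int[of "Complex x _"]] in simp)
    show ?case
      unfolding tendsto_complex_iff
      using Lim_transform_eventually[OF elim(1) re] Lim_transform_eventually[OF elim(2) im] by simp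
  qed
qed

section \<open>Bounded holomorphic functions on the upper half-plane\<close>

text \<open>The segment [-n, n] is closed by the upper semicircle, on which quadratic decay leaves
  at most C pi / n. Holomorphy slightly below the axis puts the whole contour inside the
  domain.\<close>

lemma half_plane_Cauchy:
  assumes holo: "F holomorphic_on {z. - d < Im z}" and d: "0 < d"
    and bound: "\<And>z. 0 \<le> Im z \<Longrightarrow> r \<le> cmod z \<Longrightarrow> cmod (F z) \<le> C / (cmod z)\<^sup>2"
  shows "integrable lborel (\<lambda>t. F (of_real t))" (is ?int)
    and "(\<integral>t. F (of_real t) \<partial>lborel) = 0" (is ?zero)
proof -
  define r' where "r' = max r 1"
  have contF: "continuous_on {z. - d < Im z} F" using holo by (rule holomorphic_on_imp_continuous_on)
  have cont: "continuous_on A (\<lambda>t::real. F (of_real t))" for A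
    by (rule continuous_on_compose2[OF contF]) (use d in \<open>auto intro: continuous_intros\<close>)
  have [measurable]: "(\<lambda>t::real. F (of_real t)) \<in> borel_measurable borel"
    by (rule borel_measurable_continuous_onI[OF cont])
  have "compact ((\<lambda>t::real. F (of_real t)) ` {-r'..r'})"
    by (intro compact_continuous_image cont) simp
  then obtain B where B: "\<And>t. \<bar>t\<bar> \<le> r' \<Longrightarrow> cmod (F (of_real t)) \<le> B"
  proof -
    have "bounded ((\<lambda>t::real. F (of_real t)) ` {-r'..r'})"
      by (rule compact_imp_bounded) fact
    then obtain b where b: "\<forall>z\<in>(\<lambda>t::real. F (of_real t)) ` {-r'..r'}. cmod z \<le> b"
      unfolding bounded_iff by blast
    show ?thesis by (rule that[of b]) (use b in \<open>simp add: abs_le_iff\<close>)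
  qed
  have C0: "0 \<le> C"
  proof -
    have r': "1 \<le> r'" "r \<le> r'" by (auto simp: r'_def)
    then have "cmod (F (of_real r')) \<le> C / r'\<^sup>2" using bound[of "of_real r'"] by simp
    from order_trans[OF norm_ge_zero this] show ?thesis using r' by (simp add: zero_le_divide_iff)
  qed
  have B0: "0 \<le> B" using order_trans[OF norm_ge_zero B[of 0]] by (simp add: r'_def)
  \<comment> \<open>One majorant for both ranges: the term with \<open>B\<close> covers the compact
    part |t| \<le> r', and 2 * C covers the rest, where 1 + t^2 \<le> 2 t^2.\<close>
  have dom: "cmod (F (of_real t)) \<le> pi * (B * (1 + r'\<^sup>2) + 2 * C) * poisson \<i> t" for t
  proof (cases "\<bar>t\<bar> \<le> r'")
    case True
    then have "t\<^sup>2 \<le> r'\<^sup>2" by (metis abs_ge_zero power2_abs power_mono)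
    then have "B * (1 + t\<^sup>2) \<le> B * (1 + r'\<^sup>2) + 2 * C"
      using B0 C0 mult_left_mono[of "1 + t\<^sup>2" "1 + r'\<^sup>2" B] by simp
    moreover have "0 < 1 + t\<^sup>2" by (simp add: add_pos_nonneg)
    ultimately have "B \<le> (B * (1 + r'\<^sup>2) + 2 * C) / (1 + t\<^sup>2)" by (simp only: pos_le_divide_eq)
    also have "\<dots> = pi * (B * (1 + r'\<^sup>2) + 2 * C) * poisson \<i> t"
      by (simp add: poisson_def add.commute)
    finally have "B \<le> pi * (B * (1 + r'\<^sup>2) + 2 * C) * poisson \<i> t" .
    with B[OF True] show ?thesis by linarith
  next
    case False
    then have t: "1 \<le> \<bar>t\<bar>" "r \<le> \<bar>t\<bar>" by (auto simp: r'_def)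
    then have t2: "1 \<le> t\<^sup>2" using abs_le_square_iff[of 1 t] by simp
    have "cmod (F (of_real t)) \<le> C / t\<^sup>2" using bound[of "of_real t"] t by simp
    also have "\<dots> \<le> (B * (1 + r'\<^sup>2) + 2 * C) / (1 + t\<^sup>2)"
    proof -
      have "C * (1 + t\<^sup>2) \<le> C * (2 * t\<^sup>2)" using t2 C0 by (intro mult_left_mono) auto
      also have "\<dots> \<le> (B * (1 + r'\<^sup>2) + 2 * C) * t\<^sup>2"
        using B0 by (simp add: algebra_simps)
      finally have "C * (1 + t\<^sup>2) \<le> (B * (1 + r'\<^sup>2) + 2 * C) * t\<^sup>2" .
      then show ?thesis using t2 by (intro frac_le_eq[THEN iffD2] divide_nonpos_pos)
        (auto simp: algebra_simps intro!: add_pos_pos)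
    qed
    also have "\<dots> = pi * (B * (1 + r'\<^sup>2) + 2 * C) * poisson \<i> t"
      by (simp add: poisson_def add.commute)
    finally show ?thesis .
  qed
  have dom_int: "integrable lborel (\<lambda>t. pi * (B * (1 + r'\<^sup>2) + 2 * C) * poisson \<i> t)"
    using integrable_poisson[of \<i>] by simp
  show ?int
    by (rule Bochner_Integration.integrable_bound[OF dom_int])
      (use dom in \<open>auto intro!: AE_I2 intro: order_trans[OF _ abs_ge_self]\<close>)
  have lim: "(\<lambda>n. LINT t:{- real n..real n}|lborel. F (of_real t)) \<longlonglongrightarrow> (\<integral>t. F (of_real t) \<partial>lborel)"
    unfolding set_lebesgue_integral_def
  proof (rule integral_dominated_convergence[OF _ _ dom_int])
    show "AE t in lborel. (\<lambda>n. indicator {- real n..real n} t *\<^sub>R F (of_real t)) \<longlonglongrightarrow> F (of_real t)"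
    proof (rule AE_I2)
      fix t :: real
      obtain N where N: "\<bar>t\<bar> \<le> real N" using real_arch_simple by blast
      have "\<forall>\<^sub>F n in sequentially. indicator {- real n..real n} t *\<^sub>R F (of_real t) = F (of_real t)"
        using eventually_ge_at_top[of N] by eventually_elim (use N in \<open>auto simp: indicator_def\<close>)
      then show "(\<lambda>n. indicator {- real n..real n} t *\<^sub>R F (of_real t)) \<longlonglongrightarrow> F (of_real t)"
        by (rule tendsto_eventually)
    qed
    show "AE t in lborel. norm (indicator {- real n..real n} t *\<^sub>R F (of_real t)) \<le> pi * (B * (1 + r'\<^sup>2) + 2 * C) * poisson \<i> t" for n
    proof (rule AE_I2)
      fix t :: real
      have "norm (indicator {- real n..real n} t *\<^sub>R F (of_real t)) \<le> cmod (F (of_real t))"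
        by (simp add: indicator_def)
      with dom[of t] show "norm (indicator {- real n..real n} t *\<^sub>R F (of_real t)) \<le> pi * (B * (1 + r'\<^sup>2) + 2 * C) * poisson \<i> t"
        by linarith
    qed
  qed measurable
  have small: "norm (LINT t:{- real n..real n}|lborel. F (of_real t)) \<le> C * pi / real n"
    if n: "r' \<le> real n" for n
  proof -
    have n1: "1 \<le> real n" "r \<le> real n" using n unfolding r'_def by auto
    let ?l = "linepath (of_real (- real n)) (of_real (real n)) :: real \<Rightarrow> complex"
    let ?c = "part_circlepath 0 (real n) 0 pi"
    have sub: "path_image ?l \<subseteq> {z. - d < Im z}" "path_image ?c \<subseteq> {z. - d < Im z}"
    proof -
      show "path_image ?l \<subseteq> {z. - d < Im z}"
        using d by (auto simp: path_image_linepath closed_segment_def)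
      show "path_image ?c \<subseteq> {z. - d < Im z}"
      proof
        fix z assume "z \<in> path_image ?c"
        then obtain u where u: "0 \<le> u" "u \<le> pi" "z = of_real (real n) * cis u"
          by (auto simp: path_image_part_circlepath cis_conv_exp mult.commute)
        then have "0 \<le> Im z" using sin_ge_zero by simp
        with d show "z \<in> {z. - d < Im z}" by simp
      qed
    qed
    have cl: "F contour_integrable_on ?l"
      by (rule contour_integrable_continuous_linepath, rule continuous_on_subset[OF contF])
        (use sub in \<open>simp add: path_image_linepath\<close>)
    have cc: "F contour_integrable_on ?c"
      by (rule contour_integrable_continuous_part_circlepath, rule continuous_on_subset[OF contF sub(2)])
    have fin: "pathfinish ?l = pathstart ?c" "pathfinish ?c = pathstart ?l"
      by (simp_all add: cis_conv_exp[symmetric] exp_pi_i')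
    have "(F has_contour_integral 0) (?l +++ ?c)"
    proof (rule Cauchy_theorem_convex_simple[OF holo])
      show "convex {z. - d < Im z}" using convex_halfspace_Im_gt[of "- d"] by simp
      show "valid_path (?l +++ ?c)" using fin by (intro valid_path_join) auto
      show "path_image (?l +++ ?c) \<subseteq> {z. - d < Im z}" using sub fin by (simp add: path_image_join)
      show "pathfinish (?l +++ ?c) = pathstart (?l +++ ?c)" using fin by simp
    qed
    then have "contour_integral (?l +++ ?c) F = 0" by (rule contour_integral_unique)
    then have eq: "contour_integral ?l F = - contour_integral ?c F"
      using cl cc by (simp add: contour_integral_join add_eq_0_iff)
    have "norm (contour_integral ?c F) \<le> C / (real n)\<^sup>2 * real n * \<bar>pi - 0\<bar>"
    proof (rule contour_integral_bound_part_circlepath[OF cc])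
      fix z assume z: "z \<in> path_image ?c"
      then obtain u where u: "0 \<le> u" "u \<le> pi" "z = of_real (real n) * cis u"
        by (auto simp: path_image_part_circlepath cis_conv_exp mult.commute)
      then have "0 \<le> Im z" "cmod z = real n" using sin_ge_zero by (simp_all add: norm_mult)
      with bound[of z] n1 show "norm (F z) \<le> C / (real n)\<^sup>2" by simp
    qed (use C0 in auto)
    moreover have "C / (real n)\<^sup>2 * real n * \<bar>pi - 0\<bar> = C * pi / real n"
      using n1 by (simp add: power2_eq_square)
    moreover have "contour_integral ?l F = integral {- real n..real n} (\<lambda>x. F (of_real x))"
      using n1 by (subst contour_integral_linepath_Reals_eq) auto
    moreover have "integral {- real n..real n} (\<lambda>x. F (of_real x)) = (LINT t:{- real n..real n}|lborel. F (of_real t))"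
      by (rule set_borel_integral_eq_integral(2)[symmetric])
        (unfold set_integrable_def, rule borel_integrable_compact, auto intro: cont)
    ultimately show ?thesis using eq by simp
  qed
  have "(\<lambda>n. LINT t:{- real n..real n}|lborel. F (of_real t)) \<longlonglongrightarrow> 0"
  proof (rule Lim_null_comparison)
    obtain N where "r' \<le> real N" using real_arch_simple by blast
    show "\<forall>\<^sub>F n in sequentially. norm (LINT t:{- real n..real n}|lborel. F (of_real t)) \<le> C * pi / real n"
      using eventually_ge_at_top[of N]
    proof eventually_elim
      case (elim n)
      then have "real N \<le> real n" by simp
      with \<open>r' \<le> real N\<close> show ?case by (intro small) linarith
    qed
    show "(\<lambda>n. C * pi / real n) \<longlonglongrightarrow> 0" by real_asymp
  qed
  with lim show ?zero by (rule LIMSEQ_unique)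
qed

text \<open>Dividing f w - f z by (w - z)(w - cnj z) leaves a removable singularity at z and
  quadratic decay. Cauchy's theorem then says that the Poisson average of f - f z is zero, and the
  kernel has total mass 1.\<close>

lemma poisson_formula:
  assumes holo: "f holomorphic_on {z. - d < Im z}" and d: "0 < d"
    and bdd: "\<And>z. - d < Im z \<Longrightarrow> cmod (f z) \<le> M" and z: "0 < Im z"
  shows "integrable lborel (\<lambda>t. poisson z t *\<^sub>R f (of_real t))"
    and "poisson_integral (\<lambda>t. f (of_real t)) z = f z"
proof -
  \<comment> \<open>The bound by Im z keeps the second pole \<open>cnj z\<close> out of the
    half-plane Im w > -e on which \<open>F\<close> has to be holomorphic.\<close>
  define e where "e = min d (Im z)"
  define g where "g w = (if w = z then deriv f z else (f w - f z) / (w - z))" for w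
  define F where "F w = g w / (w - cnj z)" for w
  have e: "0 < e" "e \<le> d" "e \<le> Im z" using d z by (auto simp: e_def)
  have "open {z. - d < Im z}" using open_halfspace_Im_gt[of "- d"] by simp
  from pole_lemma_open[OF holo this]
  have "g holomorphic_on {z. - d < Im z}" unfolding g_def[abs_def] .
  then have "g holomorphic_on {z. - e < Im z}" by (rule holomorphic_on_subset) (use e in auto)
  moreover have "w - cnj z \<noteq> 0" if "- e < Im w" for w using that e by (auto simp: complex_eq_iff)
  ultimately have holF: "F holomorphic_on {z. - e < Im z}"
    unfolding F_def[abs_def] by (intro holomorphic_intros) auto
  have M0: "0 \<le> M" using bdd[of z] z d norm_ge_zero[of "f z"] by linarith
  \<comment> \<open>For |w| \<ge> 2 |z| + 1 both denominators are at least |w| / 2, and the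
    numerator is at most 2 M; hence the constant 8 M.\<close>
  have bF: "cmod (F w) \<le> (8 * M) / (cmod w)\<^sup>2" if w: "0 \<le> Im w" "2 * cmod z + 1 \<le> cmod w" for w
  proof -
    have 1: "cmod w / 2 \<le> cmod (w - z)" "cmod w / 2 \<le> cmod (w - cnj z)"
      using w norm_triangle_ineq2[of w z] norm_triangle_ineq2[of w "cnj z"] by auto
    have pos: "0 < cmod w" using w norm_ge_zero[of z] by linarith
    have "cmod z < cmod w" using w(2) norm_ge_zero[of z] by linarith
    then have "w \<noteq> z" by auto
    then have "cmod (F w) = cmod (f w - f z) / (cmod (w - z) * cmod (w - cnj z))"
      by (simp add: F_def g_def norm_divide norm_mult)
    also have "\<dots> \<le> (2 * M) / (cmod w / 2 * (cmod w / 2))"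
    proof (rule frac_le)
      show "cmod (f w - f z) \<le> 2 * M"
        using bdd[of w] bdd[of z] w z d norm_triangle_ineq4[of "f w" "f z"] by simp
      show "cmod w / 2 * (cmod w / 2) \<le> cmod (w - z) * cmod (w - cnj z)"
        using 1 pos by (intro mult_mono) auto
    qed (use M0 pos in auto)
    also have "\<dots> = (8 * M) / (cmod w)\<^sup>2" by (simp add: power2_eq_square)
    finally show ?thesis .
  qed
  note C = half_plane_Cauchy[OF holF e(1) bF]
  have Ft: "(Im z / pi) *\<^sub>R F (of_real t) = poisson z t *\<^sub>R (f (of_real t) - f z)" for t
  proof -
    have "of_real t \<noteq> z" using z by (auto simp: complex_eq_iff)
    moreover have "(of_real t - z) * (of_real t - cnj z) = of_real ((t - Re z)\<^sup>2 + (Im z)\<^sup>2)"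
      by (simp add: complex_eq_iff power2_eq_square algebra_simps)
    ultimately show ?thesis
      by (simp add: F_def g_def poisson_def scaleR_conv_of_real mult_ac)
  qed
  have i1: "integrable lborel (\<lambda>t. poisson z t *\<^sub>R (f (of_real t) - f z))"
    unfolding Ft[symmetric] using C(1) by (intro integrable_scaleR_right)
  have i2: "integrable lborel (\<lambda>t. poisson z t *\<^sub>R f z)"
    using integrable_poisson[OF z] by (intro integrable_scaleR_left)
  have i3: "integrable lborel (\<lambda>t. poisson z t *\<^sub>R (f (of_real t) - f z) + poisson z t *\<^sub>R f z)"
    by (intro Bochner_Integration.integrable_add i1 i2)
  then show "integrable lborel (\<lambda>t. poisson z t *\<^sub>R f (of_real t))"
    by (simp add: scaleR_diff_right)
  have "(\<integral>t. poisson z t *\<^sub>R (f (of_real t) - f z) + poisson z t *\<^sub>R f z \<partial>lborel)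
      = (\<integral>t. (Im z / pi) *\<^sub>R F (of_real t) \<partial>lborel) + (\<integral>t. poisson z t *\<^sub>R f z \<partial>lborel)"
    unfolding Bochner_Integration.integral_add[OF i1 i2] Ft ..
  also have "\<dots> = f z"
    using C(2) integral_poisson[OF z] integrable_poisson[OF z] by simp
  finally show "poisson_integral (\<lambda>t. f (of_real t)) z = f z"
    by (simp add: poisson_integral_def scaleR_diff_right)
qed

text \<open>The Poisson formula is applied to the translates of \<open>f\<close> by i e n, which are
  holomorphic across the axis. The bound \<open>M\<close> enters only through dominated convergence,
  so the conclusion holds with the boundary bound \<open>B\<close> instead. With B = 0 this is a
  uniqueness theorem for boundary values.\<close>

lemma half_plane_boundary_maximum:
  assumes holo: "f holomorphic_on {z. 0 < Im z}" and bdd: "\<And>z. 0 < Im z \<Longrightarrow> cmod (f z) \<le> M"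
    and bv: "AE x in lborel. \<exists>l. cmod l \<le> B \<and> ((\<lambda>y. f (Complex x y)) \<longlongrightarrow> l) (at_right 0)"
    and B: "0 \<le> B" and z: "0 < Im z"
  shows "cmod (f z) \<le> B"
proof -
  define e where "e n = 1 / real (Suc n)" for n
  have e: "0 < e n" for n by (simp add: e_def)
  have e0: "e \<longlonglongrightarrow> 0" unfolding e_def by real_asymp
  \<comment> \<open>Taking the maximum with \<open>B\<close> makes \<open>h n t\<close> converge to
    the constant \<open>B\<close> wherever the boundary limit has modulus at most \<open>B\<close>.
    In this way no boundary function, and no question of its measurability, appears.\<close>
  define h where "h n t = max (cmod (f (Complex t (e n)))) B" for n t
  have sh: "of_real t + \<i> * of_real (e n) = Complex t (e n)" for t n by (simp add: complex_eq_iff)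
  have hol: "(\<lambda>w. f (w + \<i> * of_real (e n))) holomorphic_on {w. - e n < Im w}" for n
    by (rule holomorphic_on_compose_gen[OF _ holo, unfolded o_def]) (auto intro!: holomorphic_intros)
  note P = poisson_formula[OF hol e bdd z]
  have hm: "(\<lambda>t. f (Complex t (e n))) \<in> borel_measurable borel" for n
  proof (rule borel_measurable_continuous_onI)
    show "continuous_on UNIV (\<lambda>t. f (Complex t (e n)))"
      by (rule continuous_on_compose2[OF holomorphic_on_imp_continuous_on[OF holo]])
        (use e in \<open>auto intro!: continuous_intros simp: Complex_eq\<close>)
  qed
  have [measurable]: "h n \<in> borel_measurable borel" for n
    unfolding h_def[abs_def] using hm by (intro borel_measurable_max borel_measurable_norm) auto
  have M0: "0 \<le> M" using bdd[OF z] norm_ge_zero[of "f z"] by linarith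
  have hM: "h n t \<le> max M B" "0 \<le> h n t" for n t
    using bdd[of "Complex t (e n)"] e[of n] B by (auto simp: h_def)
  have dom: "integrable lborel (\<lambda>t. poisson z t * max M B)"
    using integrable_poisson[OF z] by simp
  have lim: "(\<lambda>n. \<integral>t. poisson z t * h n t \<partial>lborel) \<longlonglongrightarrow> (\<integral>t. poisson z t * B \<partial>lborel)"
  proof (rule integral_dominated_convergence[OF _ _ dom])
    show "AE t in lborel. (\<lambda>n. poisson z t * h n t) \<longlonglongrightarrow> poisson z t * B"
      using bv
    proof eventually_elim
      case (elim t)
      then obtain l where l: "cmod l \<le> B" "((\<lambda>y. f (Complex t y)) \<longlongrightarrow> l) (at_right 0)" by blast
      have "filterlim e (at_right 0) sequentially"
        using e0 e by (auto simp: filterlim_at less_imp_neq[symmetric] intro!: always_eventually)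
      from tendsto_norm[OF filterlim_compose[OF l(2) this]]
      have "(\<lambda>n. h n t) \<longlonglongrightarrow> max (cmod l) B" unfolding h_def by (intro tendsto_max tendsto_const)
      then show ?case using l(1) by (intro tendsto_mult tendsto_const) (simp add: max_absorb2)
    qed
    show "AE t in lborel. norm (poisson z t * h n t) \<le> poisson z t * max M B" for n
      using hM z by (intro AE_I2) (simp add: abs_mult poisson_nonneg mult_left_mono)
  qed measurable
  have "cmod (f (z + \<i> * of_real (e n))) \<le> (\<integral>t. poisson z t * h n t \<partial>lborel)" for n
  proof -
    have "f (z + \<i> * of_real (e n)) = (\<integral>t. poisson z t *\<^sub>R f (of_real t + \<i> * of_real (e n)) \<partial>lborel)"
      using P(2)[of n] by (simp add: poisson_integral_def)
    also have "cmod \<dots> \<le> (\<integral>t. poisson z t * h n t \<partial>lborel)"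
    proof (rule Bochner_Integration.integral_norm_bound_integral)
      show "integrable lborel (\<lambda>t. poisson z t *\<^sub>R f (of_real t + \<i> * of_real (e n)))"
        using P(1)[of n] by simp
      show "integrable lborel (\<lambda>t. poisson z t * h n t)"
        by (rule Bochner_Integration.integrable_bound[OF dom])
          (use hM z in \<open>auto intro!: AE_I2 mult_left_mono order_trans[OF _ abs_ge_self] simp: abs_mult poisson_nonneg\<close>)
      show "cmod (poisson z t *\<^sub>R f (of_real t + \<i> * of_real (e n))) \<le> poisson z t * h n t" for t
        using z unfolding sh by (simp add: poisson_nonneg h_def mult_left_mono)
    qed
    finally show ?thesis .
  qed
  moreover have "(\<lambda>n. cmod (f (z + \<i> * of_real (e n)))) \<longlonglongrightarrow> cmod (f z)"
  proof (intro tendsto_norm)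
    have "isCont f z"
      using holomorphic_on_imp_continuous_on[OF holo] z continuous_on_eq_continuous_at[OF open_halfspace_Im_gt[of 0]] by auto
    moreover have "(\<lambda>n. z + \<i> * of_real (e n)) \<longlonglongrightarrow> z"
      using tendsto_add[OF tendsto_const tendsto_mult[OF tendsto_const tendsto_of_real[OF e0]], of z \<i>] by simp
    ultimately show "(\<lambda>n. f (z + \<i> * of_real (e n))) \<longlonglongrightarrow> f z"
      by (rule isCont_tendsto_compose)
  qed
  ultimately have "cmod (f z) \<le> (\<integral>t. poisson z t * B \<partial>lborel)"
    using lim by (meson LIMSEQ_le)
  also have "\<dots> = B" using integral_poisson[OF z] by simp
  finally show ?thesis .
qed

section \<open>Square-integrable functions\<close>

definition square_integrable :: "(real \<Rightarrow> 'a::euclidean_space) \<Rightarrow> bool"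
  where "square_integrable f \<longleftrightarrow> f \<in> borel_measurable borel \<and> integrable lborel (\<lambda>x. (norm (f x))\<^sup>2)"

lemma square_integrableD:
  assumes "square_integrable f"
  shows "f \<in> borel_measurable borel" "integrable lborel (\<lambda>x. (norm (f x))\<^sup>2)"
  using assms by (auto simp: square_integrable_def)

lemma square_integrable_bound:
  fixes g :: "real \<Rightarrow> real"
  assumes "integrable lborel g" "f \<in> borel_measurable borel" "AE x in lborel. (norm (f x))\<^sup>2 \<le> g x"
  shows "square_integrable f"
  unfolding square_integrable_def
proof
  note [measurable] = assms(2)
  show "integrable lborel (\<lambda>x. (norm (f x))\<^sup>2)"
  proof (rule Bochner_Integration.integrable_bound[OF assms(1)])
    show "AE x in lborel. norm ((norm (f x))\<^sup>2) \<le> norm (g x)"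
      using assms(3) by eventually_elim simp
  qed measurable
qed fact

lemma square_integrable_scaleR:
  assumes "square_integrable f"
  shows "square_integrable (\<lambda>x. c *\<^sub>R f x)"
  using square_integrableD[OF assms] by (auto simp: square_integrable_def power_mult_distrib)

lemma square_integrable_add:
  assumes "square_integrable f" "square_integrable g"
  shows "square_integrable (\<lambda>x. f x + g x)"
proof (rule square_integrable_bound)
  show "integrable lborel (\<lambda>x. 2 * (norm (f x))\<^sup>2 + 2 * (norm (g x))\<^sup>2)"
    using assms[THEN square_integrableD(2)] by simp
  show "(\<lambda>x. f x + g x) \<in> borel_measurable borel"
    using assms[THEN square_integrableD(1)] by simp
  show "AE x in lborel. (norm (f x + g x))\<^sup>2 \<le> 2 * (norm (f x))\<^sup>2 + 2 * (norm (g x))\<^sup>2"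
  proof (rule AE_I2)
    fix x
    have "(norm (f x + g x))\<^sup>2 \<le> (norm (f x) + norm (g x))\<^sup>2"
      by (intro power_mono norm_triangle_ineq) simp
    also have "\<dots> \<le> 2 * (norm (f x))\<^sup>2 + 2 * (norm (g x))\<^sup>2"
      using zero_le_power2[of "norm (f x) - norm (g x)"] by (simp add: power2_sum power2_diff)
    finally show "(norm (f x + g x))\<^sup>2 \<le> 2 * (norm (f x))\<^sup>2 + 2 * (norm (g x))\<^sup>2" .
  qed
qed

lemma square_integrable_diff:
  assumes "square_integrable f" "square_integrable g"
  shows "square_integrable (\<lambda>x. f x - g x)"
  using square_integrable_add[OF assms(1) square_integrable_scaleR[OF assms(2), of "-1"]] by simp

lemma integrable_product_bound:
  fixes p :: "real \<Rightarrow> 'b::{banach, second_countable_topology}"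
  assumes f: "square_integrable f" and g: "square_integrable g"
    and p: "p \<in> borel_measurable borel"
    and b: "\<And>x. norm (p x) \<le> C * (norm (f x) * norm (g x))"
  shows "integrable lborel p"
proof (rule Bochner_Integration.integrable_bound)
  show "integrable lborel (\<lambda>x. \<bar>C\<bar> * ((norm (f x))\<^sup>2 + (norm (g x))\<^sup>2))"
    using f g by (auto dest: square_integrableD)
  show "AE x in lborel. norm (p x) \<le> norm (\<bar>C\<bar> * ((norm (f x))\<^sup>2 + (norm (g x))\<^sup>2))"
  proof (rule AE_I2)
    fix x
    have "2 * (norm (f x) * norm (g x)) \<le> (norm (f x))\<^sup>2 + (norm (g x))\<^sup>2"
      using zero_le_power2[of "norm (f x) - norm (g x)"] by (simp add: power2_diff)
    moreover have "0 \<le> norm (f x) * norm (g x)" by simp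
    ultimately have 1: "norm (f x) * norm (g x) \<le> (norm (f x))\<^sup>2 + (norm (g x))\<^sup>2" by linarith
    have "norm (p x) \<le> \<bar>C\<bar> * (norm (f x) * norm (g x))"
      by (rule order_trans[OF b]) (intro mult_right_mono, auto)
    also have "\<dots> \<le> \<bar>C\<bar> * ((norm (f x))\<^sup>2 + (norm (g x))\<^sup>2)"
      using 1 by (intro mult_left_mono) auto
    finally show "norm (p x) \<le> norm (\<bar>C\<bar> * ((norm (f x))\<^sup>2 + (norm (g x))\<^sup>2))" by simp
  qed
qed (use p in simp)

lemma Cauchy_Schwarz_integral:
  assumes f: "square_integrable f" and g: "square_integrable g"
  shows "(\<integral>x. norm (f x) * norm (g x) \<partial>lborel)\<^sup>2 \<le> (\<integral>x. (norm (f x))\<^sup>2 \<partial>lborel) * (\<integral>x. (norm (g x))\<^sup>2 \<partial>lborel)"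
proof -
  note [measurable] = square_integrableD(1)[OF f] square_integrableD(1)[OF g]
  have int: "integrable lborel (\<lambda>x. norm (f x) * norm (g x))"
    by (rule integrable_product_bound[OF f g, of _ 1]) simp_all
  have eqs: "(\<integral>\<^sup>+x. ennreal (norm (f x)) * ennreal (norm (g x)) \<partial>lborel) = ennreal (\<integral>x. norm (f x) * norm (g x) \<partial>lborel)"
    "(\<integral>\<^sup>+x. (ennreal (norm (f x)))\<^sup>2 \<partial>lborel) = ennreal (\<integral>x. (norm (f x))\<^sup>2 \<partial>lborel)"
    "(\<integral>\<^sup>+x. (ennreal (norm (g x)))\<^sup>2 \<partial>lborel) = ennreal (\<integral>x. (norm (g x))\<^sup>2 \<partial>lborel)"
    using int f g by (simp_all add: nn_integral_eq_integral[symmetric] square_integrableD ennreal_mult' ennreal_power)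
  have "(\<integral>\<^sup>+x. ennreal (norm (f x)) * ennreal (norm (g x)) \<partial>lborel)\<^sup>2
    \<le> (\<integral>\<^sup>+x. (ennreal (norm (f x)))\<^sup>2 \<partial>lborel) * (\<integral>\<^sup>+x. (ennreal (norm (g x)))\<^sup>2 \<partial>lborel)"
    by (rule Cauchy_Schwarz_nn_integral) measurable
  then show ?thesis
    unfolding eqs by (simp add: ennreal_power ennreal_mult[symmetric] ennreal_le_iff)
qed

text \<open>Continuity under L2 convergence for integrands that depend on \<open>s n\<close> in a
  Lipschitz way with weight \<open>g\<close>, by Cauchy-Schwarz. It transfers vanishing integrals
  from test functions to their limits, and from a minimising sequence to its limit.\<close>

lemma tendsto_integral_L2:
  fixes p :: "nat \<Rightarrow> real \<Rightarrow> 'b::euclidean_space"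
  assumes g: "square_integrable g" and f: "square_integrable f" and s: "\<And>n. square_integrable (s n)"
    and lim: "(\<lambda>n. \<integral>x. (norm (s n x - f x))\<^sup>2 \<partial>lborel) \<longlonglongrightarrow> 0"
    and p: "\<And>n. integrable lborel (p n)" and q: "integrable lborel q"
    and b: "\<And>n x. norm (p n x - q x) \<le> C * (norm (g x) * norm (s n x - f x))"
  shows "(\<lambda>n. \<integral>x. p n x \<partial>lborel) \<longlonglongrightarrow> (\<integral>x. q x \<partial>lborel)"
proof -
  note [measurable] = square_integrableD(1)[OF g] square_integrableD(1)[OF f] square_integrableD(1)[OF s]
  define A where "A = (\<integral>x. (norm (g x))\<^sup>2 \<partial>lborel)"
  define a where "a n = (\<integral>x. (norm (s n x - f x))\<^sup>2 \<partial>lborel)" for n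
  have d: "square_integrable (\<lambda>x. s n x - f x)" for n by (intro square_integrable_diff s f)
  have bound: "norm ((\<integral>x. p n x \<partial>lborel) - (\<integral>x. q x \<partial>lborel)) \<le> \<bar>C\<bar> * sqrt (A * a n)" for n
  proof -
    have int: "integrable lborel (\<lambda>x. norm (g x) * norm (s n x - f x))"
      by (rule integrable_product_bound[OF g d[of n], of _ 1]) simp_all
    have "norm ((\<integral>x. p n x \<partial>lborel) - (\<integral>x. q x \<partial>lborel)) = norm (\<integral>x. p n x - q x \<partial>lborel)"
      using p q by simp
    also have "\<dots> \<le> (\<integral>x. \<bar>C\<bar> * (norm (g x) * norm (s n x - f x)) \<partial>lborel)"
    proof (rule Bochner_Integration.integral_norm_bound_integral)
      show "norm (p n x - q x) \<le> \<bar>C\<bar> * (norm (g x) * norm (s n x - f x))" for x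
        by (rule order_trans[OF b]) (intro mult_right_mono, auto)
    qed (use p q int in simp_all)
    also have "\<dots> = \<bar>C\<bar> * (\<integral>x. norm (g x) * norm (s n x - f x) \<partial>lborel)" using int by simp
    also have "\<dots> \<le> \<bar>C\<bar> * sqrt (A * a n)"
      using Cauchy_Schwarz_integral[OF g d[of n]] unfolding A_def a_def
      by (intro mult_left_mono real_le_rsqrt) auto
    finally show ?thesis .
  qed
  have "(\<lambda>n. \<bar>C\<bar> * sqrt (A * a n)) \<longlonglongrightarrow> \<bar>C\<bar> * sqrt (A * 0)"
    using lim unfolding a_def by (intro tendsto_intros)
  then have "(\<lambda>n. \<bar>C\<bar> * sqrt (A * a n)) \<longlonglongrightarrow> 0" by simp
  then have "(\<lambda>n. (\<integral>x. p n x \<partial>lborel) - (\<integral>x. q x \<partial>lborel)) \<longlonglongrightarrow> 0"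
    by (rule Lim_null_comparison[OF always_eventually, rotated]) (rule allI, rule bound)
  then show ?thesis by (rule LIM_zero_cancel)
qed

text \<open>The Riesz-Fischer argument for geometrically fast sequences: an integrable function
  \<open>H\<close> controls all increments pointwise, which gives both the almost everywhere limit
  and the L2 estimate of the remainder.\<close>

lemma square_integrable_fast_Cauchy_limit:
  fixes s :: "nat \<Rightarrow> real \<Rightarrow> 'a::euclidean_space"
  assumes s: "\<And>n. square_integrable (s n)"
    and fast: "\<And>n. (\<integral>x. (norm (s (Suc n) x - s n x))\<^sup>2 \<partial>lborel) \<le> C * (1 / 16) ^ n"
  obtains f where "square_integrable f" "(\<lambda>n. \<integral>x. (norm (s n x - f x))\<^sup>2 \<partial>lborel) \<longlonglongrightarrow> 0"
proof -
  note [measurable] = square_integrableD(1)[OF s]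
  \<comment> \<open>The weight 4^n leaves integrals of order (1/4)^n, still summable. Finiteness of
    the sum \<open>H x\<close> forces the n-th increment at x below sqrt (H x) * (1/2)^n, which is
    summable as well.\<close>
  define u where "u n x = 4 ^ n * (norm (s (Suc n) x - s n x))\<^sup>2" for n x
  define H where "H x = (\<Sum>n. u n x)" for x
  define f where "f x = lim (\<lambda>n. s n x)" for x
  have [measurable]: "u n \<in> borel_measurable borel" for n unfolding u_def[abs_def] by measurable
  have u0: "0 \<le> u n x" for n x by (simp add: u_def)
  have uint: "integrable lborel (u n)" for n
    unfolding u_def[abs_def] using square_integrableD(2)[OF square_integrable_diff[OF s s]] by simp
  have uI: "(\<integral>x. u n x \<partial>lborel) \<le> C * (1 / 4) ^ n" for n
  proof -
    have "(\<integral>x. u n x \<partial>lborel) \<le> 4 ^ n * (C * (1 / 16) ^ n)"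
      unfolding u_def using fast[of n] by simp
    also have "\<dots> = C * ((4 * (1 / 16)) ^ n)" unfolding power_mult_distrib by simp
    finally show ?thesis by simp
  qed
  have sumI: "summable (\<lambda>n. \<integral>x. u n x \<partial>lborel)"
    by (rule summable_comparison_test'[of "\<lambda>n. C * (1 / 4) ^ n" 0])
      (use uI u0 in \<open>auto intro!: summable_mult summable_geometric\<close>)
  have good: "AE x in lborel. summable (\<lambda>n. u n x)"
  proof -
    have "(\<integral>\<^sup>+x. (\<Sum>n. ennreal (u n x)) \<partial>lborel) = (\<Sum>n. \<integral>\<^sup>+x. ennreal (u n x) \<partial>lborel)"
      by (rule nn_integral_suminf) measurable
    also have "\<dots> = (\<Sum>n. ennreal (\<integral>x. u n x \<partial>lborel))"
      using uint u0 by (simp add: nn_integral_eq_integral)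
    also have "\<dots> = ennreal (\<Sum>n. \<integral>x. u n x \<partial>lborel)"
      using sumI u0 by (intro suminf_ennreal2) auto
    finally have "(\<integral>\<^sup>+x. (\<Sum>n. ennreal (u n x)) \<partial>lborel) \<noteq> \<infinity>" by simp
    then have "AE x in lborel. (\<Sum>n. ennreal (u n x)) \<noteq> \<infinity>"
      by (intro nn_integral_PInf_AE) measurable
    then show ?thesis
      by eventually_elim (rule summable_suminf_not_top, use u0 in auto)
  qed
  have Hint: "integrable lborel H"
    unfolding H_def[abs_def] using uint good sumI u0 by (intro integrable_suminf) auto
  have half: "((1 / 2 :: real) ^ n)\<^sup>2 = (1 / 4) ^ n" for n
    unfolding power2_eq_square power_mult_distrib[symmetric] by simp
  have key: "(norm (s k x - f x))\<^sup>2 \<le> 4 * (1 / 4) ^ k * H x" if x: "summable (\<lambda>n. u n x)" for k x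
  proof -
    have H0: "0 \<le> H x" unfolding H_def using x u0 by (intro suminf_nonneg) auto
    have dn: "norm (s (Suc n) x - s n x) \<le> sqrt (H x) * (1 / 2) ^ n" for n
    proof (rule power2_le_imp_le)
      have "u n x \<le> H x" unfolding H_def using sum_le_suminf[OF x, of "{n}"] u0 by simp
      then have "(norm (s (Suc n) x - s n x))\<^sup>2 \<le> H x * (1 / 4) ^ n"
        by (simp add: u_def field_simps power_one_over)
      also have "\<dots> = (sqrt (H x) * (1 / 2) ^ n)\<^sup>2"
        using H0 by (simp add: power_mult_distrib half)
      finally show "(norm (s (Suc n) x - s n x))\<^sup>2 \<le> (sqrt (H x) * (1 / 2) ^ n)\<^sup>2" .
    qed (use H0 in simp)
    have sd: "summable (\<lambda>n. norm (s (Suc n) x - s n x))"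
      by (rule summable_comparison_test'[of "\<lambda>n. sqrt (H x) * (1 / 2) ^ n" 0])
        (use dn in \<open>auto intro!: summable_mult summable_geometric\<close>)
    have conv: "(\<lambda>n. s n x) \<longlonglongrightarrow> f x"
    proof -
      have "(\<lambda>n. \<Sum>i<n. s (Suc i) x - s i x) \<longlonglongrightarrow> (\<Sum>i. s (Suc i) x - s i x)"
        by (rule summable_LIMSEQ[OF summable_norm_cancel[OF sd]])
      then have "(\<lambda>n. (s n x - s 0 x) + s 0 x) \<longlonglongrightarrow> (\<Sum>i. s (Suc i) x - s i x) + s 0 x"
        unfolding sum_lessThan_telescope[of "\<lambda>i. s i x"] by (rule tendsto_add[OF _ tendsto_const])
      then have "convergent (\<lambda>n. s n x)" by (auto simp: convergent_def)
      then show ?thesis unfolding f_def by (simp add: convergent_LIMSEQ_iff)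
    qed
    have "(\<lambda>n. s (n + k) x) \<longlonglongrightarrow> f x" by (rule LIMSEQ_ignore_initial_segment[OF conv])
    from telescope_sums[OF this]
    have sums: "(\<lambda>n. s (Suc n + k) x - s (n + k) x) sums (f x - s k x)" by simp
    have geo: "(\<lambda>n. sqrt (H x) * (1 / 2) ^ k * (1 / 2) ^ n) sums (sqrt (H x) * (1 / 2) ^ k * 2)"
      using sums_mult[OF geometric_sums[of "1/2::real"], of "sqrt (H x) * (1 / 2) ^ k"] by simp
    have "norm (f x - s k x) \<le> sqrt (H x) * (1 / 2) ^ k * 2"
    proof -
      have sm: "summable (\<lambda>n. norm (s (Suc n + k) x - s (n + k) x))"
        using summable_ignore_initial_segment[OF sd, of k] by simp
      have "norm (f x - s k x) \<le> (\<Sum>n. norm (s (Suc n + k) x - s (n + k) x))"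
        unfolding sums_unique[OF sums] by (rule summable_norm[OF sm])
      also have "\<dots> \<le> (\<Sum>n. sqrt (H x) * (1 / 2) ^ k * (1 / 2) ^ n)"
      proof (rule suminf_le[OF _ sm sums_summable[OF geo]])
        show "norm (s (Suc n + k) x - s (n + k) x) \<le> sqrt (H x) * (1 / 2) ^ k * (1 / 2) ^ n" for n
          using dn[of "n + k"] by (simp add: power_add mult_ac)
      qed
      also have "\<dots> = sqrt (H x) * (1 / 2) ^ k * 2" using sums_unique[OF geo] by simp
      finally show ?thesis .
    qed
    then have "(norm (s k x - f x))\<^sup>2 \<le> (sqrt (H x) * (1 / 2) ^ k * 2)\<^sup>2"
      by (intro power_mono) (simp_all add: norm_minus_commute)
    also have "\<dots> = 4 * (1 / 4) ^ k * H x"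
      using H0 by (simp add: power_mult_distrib half)
    finally show ?thesis .
  qed
  have fm [measurable]: "f \<in> borel_measurable borel" unfolding f_def[abs_def] by measurable
  have diff: "square_integrable (\<lambda>x. s k x - f x)" for k
  proof (rule square_integrable_bound)
    show "integrable lborel (\<lambda>x. 4 * (1 / 4) ^ k * H x)" using Hint by simp
    show "AE x in lborel. (norm (s k x - f x))\<^sup>2 \<le> 4 * (1 / 4) ^ k * H x"
      using good by eventually_elim (rule key)
    show "(\<lambda>x. s k x - f x) \<in> borel_measurable borel" by measurable
  qed
  have "square_integrable f" using square_integrable_diff[OF s[of 0] diff[of 0]] by simp
  moreover have "(\<lambda>n. \<integral>x. (norm (s n x - f x))\<^sup>2 \<partial>lborel) \<longlonglongrightarrow> 0"
  proof (rule Lim_null_comparison)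
    show "\<forall>\<^sub>F n in sequentially. norm (\<integral>x. (norm (s n x - f x))\<^sup>2 \<partial>lborel) \<le> 4 * (1 / 4) ^ n * (\<integral>x. H x \<partial>lborel)"
    proof (rule always_eventually, rule allI)
      fix n
      have "(\<integral>x. (norm (s n x - f x))\<^sup>2 \<partial>lborel) \<le> (\<integral>x. 4 * (1 / 4) ^ n * H x \<partial>lborel)"
      proof (rule integral_mono_AE)
        show "AE x in lborel. (norm (s n x - f x))\<^sup>2 \<le> 4 * (1 / 4) ^ n * H x"
          using good by eventually_elim (rule key)
        show "integrable lborel (\<lambda>x. (norm (s n x - f x))\<^sup>2)" by (rule square_integrableD(2)[OF diff])
        show "integrable lborel (\<lambda>x. 4 * (1 / 4) ^ n * H x)" by (rule integrable_mult_right[OF Hint])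
      qed
      then show "norm (\<integral>x. (norm (s n x - f x))\<^sup>2 \<partial>lborel) \<le> 4 * (1 / 4) ^ n * (\<integral>x. H x \<partial>lborel)"
        by simp
    qed
    show "(\<lambda>n. 4 * (1 / 4) ^ n * (\<integral>x. H x \<partial>lborel)) \<longlonglongrightarrow> 0"
      by (intro tendsto_mult_left_zero tendsto_mult_right_zero LIMSEQ_realpow_zero) auto
  qed
  ultimately show ?thesis by (rule that)
qed

text \<open>The solution minimises \<open>J\<close>, the integral of T f \<bullet> f + 2 (k
  \<bullet> f), over the L2 closure of \<open>D\<close>. As \<open>D\<close> need not be closed, the
  minimiser is delivered together with a sequence in \<open>D\<close> converging to it; the last
  conclusion is the Euler-Lagrange equation.\<close>

lemma variational_solution:
  fixes T :: "real \<Rightarrow> 'e::euclidean_space \<Rightarrow> 'e" and D :: "(real \<Rightarrow> 'e) set"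
  assumes zero: "(\<lambda>x. 0) \<in> D"
    and add: "\<And>f g. f \<in> D \<Longrightarrow> g \<in> D \<Longrightarrow> (\<lambda>x. f x + g x) \<in> D"
    and scale: "\<And>c f. f \<in> D \<Longrightarrow> (\<lambda>x. c *\<^sub>R f x) \<in> D"
    and D: "\<And>f. f \<in> D \<Longrightarrow> square_integrable f"
    and lin: "\<And>x. linear (T x)" and sym: "\<And>x u v. T x u \<bullet> v = T x v \<bullet> u"
    and coercive: "\<And>x u. (norm u)\<^sup>2 \<le> T x u \<bullet> u" and bdd: "\<And>x u. norm (T x u) \<le> C * norm u"
    and meas: "\<And>f. f \<in> borel_measurable borel \<Longrightarrow> (\<lambda>x. T x (f x)) \<in> borel_measurable borel"
    and k: "square_integrable k"
  obtains f s where "square_integrable f" "\<And>n. s n \<in> D"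
    "(\<lambda>n. \<integral>x. (norm (s n x - f x))\<^sup>2 \<partial>lborel) \<longlonglongrightarrow> 0"
    "\<And>h. h \<in> D \<Longrightarrow> (\<integral>x. (T x (f x) + k x) \<bullet> h x \<partial>lborel) = 0"
proof -
  note [measurable (raw)] = meas
  note [measurable] = square_integrableD(1)[OF k]
  have iT: "integrable lborel (\<lambda>x. T x (f x) \<bullet> g x)" if "square_integrable f" "square_integrable g" for f g
  proof (rule integrable_product_bound[OF that, of _ C])
    note [measurable] = that[THEN square_integrableD(1)]
    show "(\<lambda>x. T x (f x) \<bullet> g x) \<in> borel_measurable borel" by measurable
    show "norm (T x (f x) \<bullet> g x) \<le> C * (norm (f x) * norm (g x))" for x
      using order_trans[OF Cauchy_Schwarz_ineq2[of "T x (f x)" "g x"] mult_right_mono[OF bdd[of x "f x"] norm_ge_zero[of "g x"]]]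
      by (simp add: mult.assoc)
  qed
  have ik: "integrable lborel (\<lambda>x. k x \<bullet> g x)" if "square_integrable g" for g
  proof (rule integrable_product_bound[OF k that, of _ 1])
    note [measurable] = that[THEN square_integrableD(1)]
    show "(\<lambda>x. k x \<bullet> g x) \<in> borel_measurable borel" by measurable
  qed (simp add: Cauchy_Schwarz_ineq2)
  define J where "J f = (\<integral>x. T x (f x) \<bullet> f x + 2 * (k x \<bullet> f x) \<partial>lborel)" for f
  define \<beta> where "\<beta> f h = (\<integral>x. (T x (f x) + k x) \<bullet> h x \<partial>lborel)" for f h
  define \<gamma> where "\<gamma> h = (\<integral>x. T x (h x) \<bullet> h x \<partial>lborel)" for h
  have i\<beta>: "integrable lborel (\<lambda>x. (T x (f x) + k x) \<bullet> h x)" if "square_integrable f" "square_integrable h" for f h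
    unfolding inner_add_left using iT[OF that] ik[OF that(2)] by simp
  have expand: "J (\<lambda>x. f x + c *\<^sub>R h x) = J f + (2 * c * \<beta> f h + c\<^sup>2 * \<gamma> h)"
    if f: "square_integrable f" and h: "square_integrable h" for f h c
  proof -
    have "T x (f x + c *\<^sub>R h x) \<bullet> (f x + c *\<^sub>R h x) + 2 * (k x \<bullet> (f x + c *\<^sub>R h x))
      = (T x (f x) \<bullet> f x + 2 * (k x \<bullet> f x)) + (2 * c * ((T x (f x) + k x) \<bullet> h x) + c\<^sup>2 * (T x (h x) \<bullet> h x))" for x
      using sym[of x "h x" "f x"]
      by (simp add: linear_add[OF lin] linear_scale[OF lin] inner_add_left inner_add_right algebra_simps power2_eq_square)
    then show ?thesis
      unfolding J_def \<beta>_def \<gamma>_def using iT[OF f f] iT[OF h h] ik[OF f] i\<beta>[OF f h]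
      by simp
  qed
  have \<gamma>: "(\<integral>x. (norm (h x))\<^sup>2 \<partial>lborel) \<le> \<gamma> h" if "square_integrable h" for h
    unfolding \<gamma>_def using square_integrableD(2)[OF that] iT[OF that that] coercive by (intro integral_mono) auto
  have \<gamma>0: "0 \<le> \<gamma> h" if "square_integrable h" for h
    using order_trans[OF _ \<gamma>[OF that]] by simp
  \<comment> \<open>Completing the square: coercivity bounds the integrand below by |f + k|^2 -
    |k|^2, so the infimum \<open>m\<close> is finite.\<close>
  have Jlow: "- (\<integral>x. (norm (k x))\<^sup>2 \<partial>lborel) \<le> J f" if f: "square_integrable f" for f
  proof -
    have "(\<integral>x. - (norm (k x))\<^sup>2 \<partial>lborel) \<le> J f"
      unfolding J_def
    proof (rule integral_mono)
      fix x
      have "0 \<le> (f x + k x) \<bullet> (f x + k x)" by simp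
      also have "\<dots> = (norm (f x))\<^sup>2 + 2 * (k x \<bullet> f x) + (norm (k x))\<^sup>2"
        by (simp add: inner_add_left inner_add_right inner_commute power2_norm_eq_inner)
      finally show "- (norm (k x))\<^sup>2 \<le> T x (f x) \<bullet> f x + 2 * (k x \<bullet> f x)"
        using coercive[of "f x" x] by linarith
    qed (use iT[OF f f] ik[OF f] square_integrableD(2)[OF k] in simp_all)
    then show ?thesis by simp
  qed
  define m where "m = Inf (J ` D)"
  have bddb: "bdd_below (J ` D)"
    by (rule bdd_belowI[where m = "- (\<integral>x. (norm (k x))\<^sup>2 \<partial>lborel)"]) (use Jlow D in auto)
  have mJ: "m \<le> J f" if "f \<in> D" for f unfolding m_def using bddb that by (intro cInf_lower) auto
  have "\<exists>f\<in>D. J f < m + (1 / 16) ^ n" for n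
    using cInf_lessD[of "J ` D" "m + (1 / 16) ^ n"] zero unfolding m_def by auto
  then obtain s where s: "\<And>n. s n \<in> D" "\<And>n. J (s n) < m + (1 / 16) ^ n" by metis
  note sL = D[OF s(1)]
  have var: "m \<le> J (s n) + (2 * c * \<beta> (s n) h + c\<^sup>2 * \<gamma> h)" if h: "h \<in> D" for n c h
    using mJ[OF add[OF s(1) scale[OF h]]] expand[OF sL D[OF h]] by simp
  have \<beta>: "(\<beta> (s n) h)\<^sup>2 \<le> (\<gamma> h + 1) * (1 / 16) ^ n" if h: "h \<in> D" for n h
  proof -
    define b where "b = \<beta> (s n) h"
    define g where "g = \<gamma> h"
    have g: "0 \<le> g" unfolding g_def by (rule \<gamma>0[OF D[OF h]])
    \<comment> \<open>The quadratic 2 c b + c^2 g in c has its minimum at c = - b / g. Adding 1 to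
      the denominator avoids the case g = 0 and costs only the constant in the bound for
      b^2.\<close>
    have "- ((1 / 16) ^ n) \<le> 2 * (- b / (g + 1)) * b + (- b / (g + 1))\<^sup>2 * g"
      using var[OF h, of n "- b / (g + 1)"] s(2)[of n] by (simp add: b_def g_def)
    also have "\<dots> = - (b\<^sup>2 / (g + 1)) - b\<^sup>2 / (g + 1)\<^sup>2"
      using g by (simp add: divide_simps add_nonneg_eq_0_iff) (simp add: power2_eq_square algebra_simps)
    also have "\<dots> \<le> - (b\<^sup>2 / (g + 1))" by simp
    finally have "b\<^sup>2 / (g + 1) \<le> (1 / 16) ^ n" by simp
    then show ?thesis using g by (simp add: b_def[symmetric] g_def[symmetric] divide_le_eq mult.commute)
  qed
  have fast: "(\<integral>x. (norm (s (Suc n) x - s n x))\<^sup>2 \<partial>lborel) \<le> 4 * (1 / 16) ^ n" for n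
  proof -
    define d where "d x = s (Suc n) x + (- 1) *\<^sub>R s n x" for x
    have d: "d \<in> D" unfolding d_def[abs_def] by (intro add scale s)
    have "J (s (Suc n)) = J (\<lambda>x. s n x + 1 *\<^sub>R d x)" by (simp add: d_def)
    also have "\<dots> = J (s n) + (2 * 1 * \<beta> (s n) d + 1\<^sup>2 * \<gamma> d)" by (rule expand[OF sL D[OF d]])
    finally have "J (s (Suc n)) = J (s n) + 2 * \<beta> (s n) d + \<gamma> d" by simp
    \<comment> \<open>The choice c = 1/2 evaluates \<open>J\<close> at the midpoint of two
      consecutive terms. Together with the expansion of \<open>J (s (Suc n))\<close> this is the
      parallelogram identity, by which \<gamma> d is at most twice the sum of the two excesses over
      \<open>m\<close>; hence the factor 4.\<close>
    moreover have "m \<le> J (s n) + (\<beta> (s n) d + \<gamma> d / 4)"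
      using var[OF d, of n "1 / 2"] by (simp add: power2_eq_square)
    moreover have "(1 / 16 :: real) ^ Suc n \<le> (1 / 16) ^ n" by simp
    ultimately have "\<gamma> d \<le> 4 * (1 / 16) ^ n" using s(2)[of n] s(2)[of "Suc n"] by linarith
    with \<gamma>[OF D[OF d]] show ?thesis by (simp add: d_def)
  qed
  obtain f where f: "square_integrable f" and lim: "(\<lambda>n. \<integral>x. (norm (s n x - f x))\<^sup>2 \<partial>lborel) \<longlonglongrightarrow> 0"
    by (rule square_integrable_fast_Cauchy_limit[of s 4]) (use sL fast in auto)
  have "\<beta> f h = 0" if h: "h \<in> D" for h
  proof (rule LIMSEQ_unique)
    show "(\<lambda>n. \<beta> (s n) h) \<longlonglongrightarrow> \<beta> f h"
      unfolding \<beta>_def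
    proof (rule tendsto_integral_L2[OF D[OF h] f sL lim])
      show "norm ((T x (s n x) + k x) \<bullet> h x - (T x (f x) + k x) \<bullet> h x) \<le> C * (norm (h x) * norm (s n x - f x))" for n x
      proof -
        have "(T x (s n x) + k x) \<bullet> h x - (T x (f x) + k x) \<bullet> h x = T x (s n x - f x) \<bullet> h x"
          by (simp add: linear_diff[OF lin] inner_add_left inner_diff_left)
        then show ?thesis
          using order_trans[OF Cauchy_Schwarz_ineq2 mult_right_mono[OF bdd[of x "s n x - f x"] norm_ge_zero[of "h x"]]]
          by (simp add: mult_ac)
      qed
    qed (intro i\<beta> sL f D h)+
    show "(\<lambda>n. \<beta> (s n) h) \<longlonglongrightarrow> 0"
    proof (rule Lim_null_comparison)
      show "\<forall>\<^sub>F n in sequentially. norm (\<beta> (s n) h) \<le> sqrt ((\<gamma> h + 1) * (1 / 16) ^ n)"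
        using \<beta>[OF h] by (intro always_eventually allI) (simp add: real_le_rsqrt)
      have "(\<lambda>n. sqrt ((\<gamma> h + 1) * (1 / 16) ^ n)) \<longlonglongrightarrow> sqrt ((\<gamma> h + 1) * 0)"
        by (intro tendsto_real_sqrt tendsto_mult tendsto_const LIMSEQ_realpow_zero) auto
      then show "(\<lambda>n. sqrt ((\<gamma> h + 1) * (1 / 16) ^ n)) \<longlonglongrightarrow> 0" by simp
    qed
  qed
  then show ?thesis using that[OF f s(1) lim] by (simp add: \<beta>_def)
qed

section \<open>The Hardy space of the upper half-plane\<close>

text \<open>A convenient supply of elements of the Hardy space: holomorphy across the axis lets
  contours run along the real line, and decay of order 1/|z| makes products of two of them decay
  quadratically. The class is an algebra and contains the Cauchy kernels with pole in the lower
  half-plane.\<close>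

definition hardy_test :: "(real \<Rightarrow> complex) \<Rightarrow> bool"
  where "hardy_test r \<longleftrightarrow> (\<exists>F d C. 0 < d \<and> F holomorphic_on {z. - d < Im z} \<and>
    (\<forall>z. - d < Im z \<longrightarrow> cmod (F z) \<le> C / (1 + cmod z)) \<and> (\<forall>t. r t = F (of_real t)))"

lemma hardy_testE:
  assumes "hardy_test r"
  obtains F d C where "0 < d" "F holomorphic_on {z. - d < Im z}" "0 \<le> C"
    "\<And>z. - d < Im z \<Longrightarrow> cmod (F z) \<le> C / (1 + cmod z)" "r = (\<lambda>t. F (of_real t))"
proof -
  obtain F d C where F: "0 < d" "F holomorphic_on {z. - d < Im z}"
    "\<And>z. - d < Im z \<Longrightarrow> cmod (F z) \<le> C / (1 + cmod z)" "\<And>t. r t = F (of_real t)"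
    using assms unfolding hardy_test_def by blast
  have "cmod (F 0) \<le> C" using F(3)[of 0] F(1) by simp
  then have "0 \<le> C" using norm_ge_zero[of "F 0"] by linarith
  then show thesis using F by (intro that[of d F C]) auto
qed

lemma hardy_testI:
  assumes "0 < d" "F holomorphic_on {z. - d < Im z}"
    "\<And>z. - d < Im z \<Longrightarrow> cmod (F z) \<le> C / (1 + cmod z)"
  shows "hardy_test (\<lambda>t. F (of_real t))"
  unfolding hardy_test_def using assms by blast

lemma hardy_test_zero: "hardy_test (\<lambda>t. 0)"
  using hardy_testI[of 1 "\<lambda>z. 0" 0] by simp

lemma hardy_test_add:
  assumes "hardy_test r" "hardy_test s"
  shows "hardy_test (\<lambda>t. r t + s t)"
proof -
  obtain F d C where F: "0 < d" "F holomorphic_on {z. - d < Im z}" "0 \<le> C"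
    "\<And>z. - d < Im z \<Longrightarrow> cmod (F z) \<le> C / (1 + cmod z)" "r = (\<lambda>t. F (of_real t))"
    by (rule hardy_testE[OF assms(1)]) (rule that)
  obtain G e B where G: "0 < e" "G holomorphic_on {z. - e < Im z}" "0 \<le> B"
    "\<And>z. - e < Im z \<Longrightarrow> cmod (G z) \<le> B / (1 + cmod z)" "s = (\<lambda>t. G (of_real t))"
    by (rule hardy_testE[OF assms(2)]) (rule that)
  have "hardy_test (\<lambda>t. F (of_real t) + G (of_real t))"
  proof (rule hardy_testI[where d = "min d e" and C = "C + B" and F = "\<lambda>z. F z + G z"])
    show "(\<lambda>z. F z + G z) holomorphic_on {z. - min d e < Im z}"
      by (intro holomorphic_on_add holomorphic_on_subset[OF F(2)] holomorphic_on_subset[OF G(2)]) auto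
    show "cmod (F z + G z) \<le> (C + B) / (1 + cmod z)" if "- min d e < Im z" for z
    proof -
      have "cmod (F z) \<le> C / (1 + cmod z)" "cmod (G z) \<le> B / (1 + cmod z)"
        using that by (intro F(4) G(4); simp)+
      then show ?thesis
        using norm_triangle_ineq[of "F z" "G z"] unfolding add_divide_distrib by linarith
    qed
  qed (use F G in simp)
  then show ?thesis by (simp add: F(5) G(5))
qed

text \<open>The product decays like 1/|z|^2, so Cauchy's theorem on the half-plane yields integral
  zero. Boundary functions of the same half-plane thus annihilate each other under the pairing
  without conjugation.\<close>

lemma hardy_test_mult:
  assumes "hardy_test r" "hardy_test s"
  shows "hardy_test (\<lambda>t. r t * s t)" "integrable lborel (\<lambda>t. r t * s t)" "(\<integral>t. r t * s t \<partial>lborel) = 0"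
proof -
  obtain F d C where F: "0 < d" "F holomorphic_on {z. - d < Im z}" "0 \<le> C"
    "\<And>z. - d < Im z \<Longrightarrow> cmod (F z) \<le> C / (1 + cmod z)" "r = (\<lambda>t. F (of_real t))"
    by (rule hardy_testE[OF assms(1)]) (rule that)
  obtain G e B where G: "0 < e" "G holomorphic_on {z. - e < Im z}" "0 \<le> B"
    "\<And>z. - e < Im z \<Longrightarrow> cmod (G z) \<le> B / (1 + cmod z)" "s = (\<lambda>t. G (of_real t))"
    by (rule hardy_testE[OF assms(2)]) (rule that)
  have hol: "(\<lambda>z. F z * G z) holomorphic_on {z. - min d e < Im z}"
    by (intro holomorphic_on_mult holomorphic_on_subset[OF F(2)] holomorphic_on_subset[OF G(2)]) auto
  have pos: "0 < min d e" using F G by simp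
  have b: "cmod (F z * G z) \<le> (C * B) / (1 + cmod z)\<^sup>2" if "- min d e < Im z" for z
  proof -
    have "cmod (F z) * cmod (G z) \<le> (C / (1 + cmod z)) * (B / (1 + cmod z))"
      using F G that by (intro mult_mono) auto
    then show ?thesis by (simp add: norm_mult power2_eq_square)
  qed
  have "hardy_test (\<lambda>t. F (of_real t) * G (of_real t))"
  proof (rule hardy_testI[OF pos hol])
    show "cmod (F z * G z) \<le> (C * B) / (1 + cmod z)" if "- min d e < Im z" for z
    proof (rule order_trans[OF b[OF that]])
      show "C * B / (1 + cmod z)\<^sup>2 \<le> C * B / (1 + cmod z)"
      proof (rule divide_left_mono)
        show "1 + cmod z \<le> (1 + cmod z)\<^sup>2" by (rule self_le_power) auto
        show "0 < (1 + cmod z)\<^sup>2 * (1 + cmod z)"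
          using norm_ge_zero[of z] by (intro mult_pos_pos zero_less_power add_pos_nonneg) auto
      qed (use F G in simp)
    qed
  qed
  then show "hardy_test (\<lambda>t. r t * s t)" by (simp add: F(5) G(5))
  have b2: "cmod (F z * G z) \<le> (C * B) / (cmod z)\<^sup>2" if "0 \<le> Im z" "1 \<le> cmod z" for z
  proof (rule order_trans[OF b])
    show "C * B / (1 + cmod z)\<^sup>2 \<le> C * B / (cmod z)\<^sup>2"
    proof (rule divide_left_mono)
      show "(cmod z)\<^sup>2 \<le> (1 + cmod z)\<^sup>2" by (rule power_mono) auto
      show "0 < (1 + cmod z)\<^sup>2 * (cmod z)\<^sup>2"
        using that(2) by (intro mult_pos_pos zero_less_power) auto
    qed (use F G in simp)
  qed (use that pos in linarith)
  from half_plane_Cauchy[OF hol pos b2]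
  show "integrable lborel (\<lambda>t. r t * s t)" "(\<integral>t. r t * s t \<partial>lborel) = 0"
    by (simp_all add: F(5) G(5))
qed

lemma hardy_test_cmult:
  assumes "hardy_test r"
  shows "hardy_test (\<lambda>t. c * r t)"
proof -
  obtain F d C where F: "0 < d" "F holomorphic_on {z. - d < Im z}" "0 \<le> C"
    "\<And>z. - d < Im z \<Longrightarrow> cmod (F z) \<le> C / (1 + cmod z)" "r = (\<lambda>t. F (of_real t))"
    by (rule hardy_testE[OF assms]) (rule that)
  have "hardy_test (\<lambda>t. c * F (of_real t))"
  proof (rule hardy_testI[OF F(1), of "\<lambda>z. c * F z" "cmod c * C"])
    show "cmod (c * F z) \<le> cmod c * C / (1 + cmod z)" if "- d < Im z" for z
      using mult_left_mono[OF F(4)[OF that], of "cmod c"] by (simp add: norm_mult)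
  qed (intro holomorphic_intros F)
  then show ?thesis by (simp add: F(5))
qed

lemma hardy_test_cauchy_kernel:
  assumes w: "Im w < 0"
  shows "hardy_test (\<lambda>t. 1 / (of_real t - w))"
proof -
  \<comment> \<open>Half the distance of the pole from the axis: on the half-plane Im z > -k the
    distance to \<open>w\<close> is still at least \<open>k\<close>.\<close>
  define k where "k = - Im w / 2"
  have k: "0 < k" using w by (simp add: k_def)
  have far: "k \<le> cmod (z - w)" if "- k < Im z" for z
    using that abs_Im_le_cmod[of "z - w"] by (simp add: k_def)
  show ?thesis
  proof (rule hardy_testI[OF k, of "\<lambda>z. 1 / (z - w)"])
    show "(\<lambda>z. 1 / (z - w)) holomorphic_on {z. - k < Im z}"
      using far k by (intro holomorphic_intros) force
    show "cmod (1 / (z - w)) \<le> ((1 + cmod w) / k + 1) / (1 + cmod z)" if z: "- k < Im z" for z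
    proof -
      have "cmod z \<le> cmod w + cmod (z - w)" using norm_triangle_sub[of z w] by (simp add: add.commute)
      moreover have "1 + cmod w \<le> ((1 + cmod w) / k) * cmod (z - w)"
        using mult_left_mono[OF far[OF z], of "(1 + cmod w) / k"] k by simp
      ultimately have "1 + cmod z \<le> ((1 + cmod w) / k + 1) * cmod (z - w)" by (simp add: distrib_right)
      moreover have "0 < cmod (z - w)" "0 < 1 + cmod z" using far[OF z] k norm_ge_zero[of z] by linarith+
      ultimately show ?thesis by (simp add: norm_divide divide_le_eq le_divide_eq mult.commute)
    qed
  qed
qed

lemma hardy_test_bounded:
  assumes "hardy_test r"
  obtains B where "\<And>t. cmod (r t) \<le> B"
proof -
  obtain F d C where F: "0 < d" "F holomorphic_on {z. - d < Im z}" "0 \<le> C"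
    "\<And>z. - d < Im z \<Longrightarrow> cmod (F z) \<le> C / (1 + cmod z)" "r = (\<lambda>t. F (of_real t))"
    by (rule hardy_testE[OF assms]) (rule that)
  have "cmod (r t) \<le> C" for t
  proof -
    have "cmod (r t) \<le> C / (1 + cmod (of_real t))" using F(4)[of "of_real t"] F(1) by (simp add: F(5))
    also have "\<dots> \<le> C / 1" using F(3) by (intro divide_left_mono) (auto intro: add_pos_nonneg)
    finally show ?thesis by simp
  qed
  then show thesis by (rule that)
qed

lemma hardy_test_square_integrable:
  assumes "hardy_test r"
  shows "square_integrable r"
proof -
  obtain F d C where F: "0 < d" "F holomorphic_on {z. - d < Im z}" "0 \<le> C"
    "\<And>z. - d < Im z \<Longrightarrow> cmod (F z) \<le> C / (1 + cmod z)" "r = (\<lambda>t. F (of_real t))"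
    by (rule hardy_testE[OF assms]) (rule that)
  show ?thesis
  proof (rule square_integrable_bound)
    show "integrable lborel (\<lambda>t. C\<^sup>2 * pi * poisson \<i> t)" using integrable_poisson[of \<i>] by simp
    show "r \<in> borel_measurable borel"
      unfolding F(5)
      by (rule borel_measurable_continuous_onI, rule continuous_on_compose2[OF holomorphic_on_imp_continuous_on[OF F(2)]])
        (use F in \<open>auto intro: continuous_intros\<close>)
    show "AE t in lborel. (cmod (r t))\<^sup>2 \<le> C\<^sup>2 * pi * poisson \<i> t"
    proof (rule AE_I2)
      fix t :: real
      have "cmod (r t) \<le> C / (1 + cmod (of_real t))" using F(4)[of "of_real t"] F(1) by (simp add: F(5))
      then have "(cmod (r t))\<^sup>2 \<le> (C / (1 + \<bar>t\<bar>))\<^sup>2" by (intro power_mono) auto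
      also have "\<dots> = C\<^sup>2 / (1 + \<bar>t\<bar>)\<^sup>2" by (simp add: power_divide)
      also have "\<dots> \<le> C\<^sup>2 / (1 + t\<^sup>2)"
      proof (rule divide_left_mono)
        show "1 + t\<^sup>2 \<le> (1 + \<bar>t\<bar>)\<^sup>2" by (simp add: power2_sum)
        show "0 < (1 + \<bar>t\<bar>)\<^sup>2 * (1 + t\<^sup>2)" by (intro mult_pos_pos zero_less_power add_pos_nonneg) auto
      qed simp
      also have "\<dots> = C\<^sup>2 * pi * poisson \<i> t" by (simp add: poisson_def add.commute)
      finally show "(cmod (r t))\<^sup>2 \<le> C\<^sup>2 * pi * poisson \<i> t" .
    qed
  qed
qed

text \<open>Two descriptions of the boundary values of functions in the Hardy space: limits of test
  functions, and functions orthogonal to the conjugates of all test functions.\<close>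

definition hardy :: "(real \<Rightarrow> complex) \<Rightarrow> bool"
  where "hardy f \<longleftrightarrow> square_integrable f \<and>
    (\<exists>s. (\<forall>n. hardy_test (s n)) \<and> (\<lambda>n. \<integral>x. (cmod (s n x - f x))\<^sup>2 \<partial>lborel) \<longlonglongrightarrow> 0)"

definition annihilates_hardy :: "(real \<Rightarrow> complex) \<Rightarrow> bool"
  where "annihilates_hardy f \<longleftrightarrow> square_integrable f \<and>
    (\<forall>r. hardy_test r \<longrightarrow> (\<integral>x. f x * r x \<partial>lborel) = 0)"

lemma integrable_mult_square_integrable:
  fixes f g :: "real \<Rightarrow> complex"
  assumes "square_integrable f" "square_integrable g"
  shows "integrable lborel (\<lambda>x. f x * g x)"
  by (rule integrable_product_bound[OF assms, of _ 1])
    (use assms[THEN square_integrableD(1)] in \<open>simp_all add: norm_mult\<close>)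

text \<open>For a test function s in place of \<open>f\<close>, the product s r is again a test
  function, so \<open>g\<close> annihilates it; L2 convergence and boundedness of \<open>r\<close>
  carry this over to \<open>f\<close>. The product g f is only integrable, which is why the
  conclusion is phrased by pairing it with \<open>r\<close>.\<close>

lemma hardy_mult_annihilates:
  assumes g: "annihilates_hardy g" and f: "hardy f" and r: "hardy_test r"
  shows "integrable lborel (\<lambda>x. g x * f x * r x)" "(\<integral>x. g x * f x * r x \<partial>lborel) = 0"
proof -
  obtain s where s: "\<And>n. hardy_test (s n)" "(\<lambda>n. \<integral>x. (cmod (s n x - f x))\<^sup>2 \<partial>lborel) \<longlonglongrightarrow> 0"
    using f unfolding hardy_def by blast
  have gL: "square_integrable g" and fL: "square_integrable f"
    using g f by (auto simp: annihilates_hardy_def hardy_def)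
  obtain B where B: "\<And>t. cmod (r t) \<le> B" using hardy_test_bounded[OF r] by blast
  note [measurable] = square_integrableD(1)[OF gL] square_integrableD(1)[OF fL]
    square_integrableD(1)[OF hardy_test_square_integrable[OF r]]
  have int: "integrable lborel (\<lambda>x. g x * h x * r x)" if h: "square_integrable h" for h
  proof (rule integrable_product_bound[OF gL h, of _ B])
    show "(\<lambda>x. g x * h x * r x) \<in> borel_measurable borel"
      using square_integrableD(1)[OF h] by measurable
    show "cmod (g x * h x * r x) \<le> B * (cmod (g x) * cmod (h x))" for x
      using mult_left_mono[OF B[of x], of "cmod (g x) * cmod (h x)"] by (simp add: norm_mult mult_ac)
  qed
  show "integrable lborel (\<lambda>x. g x * f x * r x)" by (rule int[OF fL])
  have "(\<lambda>n. \<integral>x. g x * s n x * r x \<partial>lborel) \<longlonglongrightarrow> (\<integral>x. g x * f x * r x \<partial>lborel)"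
  proof (rule tendsto_integral_L2[OF gL fL _ s(2), where C = B])
    show "square_integrable (s n)" for n by (rule hardy_test_square_integrable[OF s(1)])
    then show "integrable lborel (\<lambda>x. g x * s n x * r x)" for n by (rule int)
    show "integrable lborel (\<lambda>x. g x * f x * r x)" by (rule int[OF fL])
    show "cmod (g x * s n x * r x - g x * f x * r x) \<le> B * (cmod (g x) * cmod (s n x - f x))" for n x
    proof -
      have "g x * s n x * r x - g x * f x * r x = g x * (s n x - f x) * r x" by (simp add: algebra_simps)
      then show ?thesis
        using mult_left_mono[OF B[of x], of "cmod (g x) * cmod (s n x - f x)"] by (simp add: norm_mult mult_ac)
    qed
  qed
  moreover have "(\<integral>x. g x * s n x * r x \<partial>lborel) = 0" for n
    using g hardy_test_mult(1)[OF s(1) r, of n] unfolding annihilates_hardy_def by (simp add: mult.assoc)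
  ultimately show "(\<integral>x. g x * f x * r x \<partial>lborel) = 0"
    by (simp add: LIMSEQ_const_iff)
qed

text \<open>Products of two test functions have integral zero, and the pairing with a fixed test
  function is continuous in L2.\<close>

lemma hardy_annihilates:
  assumes f: "hardy f"
  shows "annihilates_hardy f"
  unfolding annihilates_hardy_def
proof (intro conjI allI impI)
  show fL: "square_integrable f" using f by (simp add: hardy_def)
  fix r assume r: "hardy_test r"
  note rL = hardy_test_square_integrable[OF r]
  obtain s where s: "\<And>n. hardy_test (s n)" "(\<lambda>n. \<integral>x. (cmod (s n x - f x))\<^sup>2 \<partial>lborel) \<longlonglongrightarrow> 0"
    using f unfolding hardy_def by blast
  have "(\<lambda>n. \<integral>x. s n x * r x \<partial>lborel) \<longlonglongrightarrow> (\<integral>x. f x * r x \<partial>lborel)"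
  proof (rule tendsto_integral_L2[OF rL fL _ s(2), where C = 1])
    show "square_integrable (s n)" for n by (rule hardy_test_square_integrable[OF s(1)])
    then show "integrable lborel (\<lambda>x. s n x * r x)" for n by (rule integrable_mult_square_integrable[OF _ rL])
    show "integrable lborel (\<lambda>x. f x * r x)" by (rule integrable_mult_square_integrable[OF fL rL])
    show "cmod (s n x * r x - f x * r x) \<le> 1 * (cmod (r x) * cmod (s n x - f x))" for n x
      by (simp add: norm_mult[symmetric] algebra_simps)
  qed
  moreover have "(\<integral>x. s n x * r x \<partial>lborel) = 0" for n by (rule hardy_test_mult(3)[OF s(1) r])
  ultimately show "(\<integral>x. f x * r x \<partial>lborel) = 0" by (simp add: LIMSEQ_const_iff)
qed

section \<open>Cauchy integrals on the line and their relation to Poisson integrals\<close>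

lemma poisson_eq_cauchy_kernels:
  assumes "0 < Im z"
  shows "complex_of_real (poisson z t) = (1 / (2 * pi * \<i>)) * (1 / (of_real t - z) - 1 / (of_real t - cnj z))"
proof -
  have ne: "of_real t - z \<noteq> 0" "of_real t - cnj z \<noteq> 0" using assms by (auto simp: complex_eq_iff)
  have m: "(of_real t - z) * (of_real t - cnj z) = of_real ((t - Re z)\<^sup>2 + (Im z)\<^sup>2)"
    by (simp add: complex_eq_iff power2_eq_square algebra_simps)
  have "1 / (of_real t - z) - 1 / (of_real t - cnj z) = (z - cnj z) / ((of_real t - z) * (of_real t - cnj z))"
    using ne by (simp add: diff_frac_eq)
  also have "z - cnj z = 2 * \<i> * of_real (Im z)" by (simp add: complex_eq_iff)
  finally show ?thesis unfolding m by (simp add: poisson_def)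
qed

lemma poisson_integral_eq_cauchy:
  assumes z: "0 < Im z"
    and i1: "integrable lborel (\<lambda>t. f t / (of_real t - z))"
    and i2: "integrable lborel (\<lambda>t. f t / (of_real t - cnj z))"
  shows "integrable lborel (\<lambda>t. poisson z t *\<^sub>R f t)"
    and "poisson_integral f z = (1 / (2 * pi * \<i>)) *
      ((\<integral>t. f t / (of_real t - z) \<partial>lborel) - (\<integral>t. f t / (of_real t - cnj z) \<partial>lborel))"
proof -
  have eq: "poisson z t *\<^sub>R f t = (1 / (2 * pi * \<i>)) * (f t / (of_real t - z) - f t / (of_real t - cnj z))" for t
    unfolding scaleR_conv_of_real poisson_eq_cauchy_kernels[OF z] by (simp add: diff_divide_distrib algebra_simps)
  show "integrable lborel (\<lambda>t. poisson z t *\<^sub>R f t)"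
    unfolding eq by (intro integrable_mult_right Bochner_Integration.integrable_diff i1 i2)
  show "poisson_integral f z = (1 / (2 * pi * \<i>)) *
      ((\<integral>t. f t / (of_real t - z) \<partial>lborel) - (\<integral>t. f t / (of_real t - cnj z) \<partial>lborel))"
    unfolding poisson_integral_def eq using i1 i2 by simp
qed

text \<open>The Poisson kernel at z is a multiple of the difference of the Cauchy kernels at z and
  \<open>cnj z\<close>. All Poisson integrals of \<open>f\<close> therefore vanish, and their
  vertical limits are \<open>f\<close> almost everywhere.\<close>

lemma AE_zero_if_cauchy_zero:
  assumes f: "f \<in> borel_measurable borel"
    and int: "\<And>w. Im w \<noteq> 0 \<Longrightarrow> integrable lborel (\<lambda>t. f t / (of_real t - w))"
    and zero: "\<And>w. Im w \<noteq> 0 \<Longrightarrow> (\<integral>t. f t / (of_real t - w) \<partial>lborel) = 0"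
  shows "AE x in lborel. f x = 0"
proof -
  have "AE x in lborel. ((\<lambda>y. poisson_integral f (Complex x y)) \<longlongrightarrow> f x) (at_right 0)"
  proof (rule poisson_vertical_limit[OF f])
    show "integrable lborel (\<lambda>t. poisson z t *\<^sub>R f t)" if "0 < Im z" for z
      using that by (intro poisson_integral_eq_cauchy(1) int) auto
  qed
  then show ?thesis
  proof eventually_elim
    case (elim x)
    have "\<forall>\<^sub>F y in at_right 0. (0::real) < y" by (simp add: eventually_at_right_less)
    then have "\<forall>\<^sub>F y in at_right 0. poisson_integral f (Complex x y) = 0"
    proof eventually_elim
      case (elim y)
      then show ?case
        by (subst poisson_integral_eq_cauchy(2)) (use int zero in auto)
    qed
    then have "((\<lambda>y. poisson_integral f (Complex x y)) \<longlongrightarrow> 0) (at_right 0)" by (rule tendsto_eventually)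
    from tendsto_unique[OF _ elim this] show ?case by simp
  qed
qed

lemma square_integrable_cnj:
  assumes "square_integrable f"
  shows "square_integrable (\<lambda>x. cnj (f x))"
proof -
  note [measurable] = square_integrableD(1)[OF assms]
  have "cnj \<in> borel_measurable borel" by (intro borel_measurable_continuous_onI continuous_intros)
  then have "(\<lambda>x. cnj (f x)) \<in> borel_measurable borel" by measurable
  with assms show ?thesis by (simp add: square_integrable_def)
qed

lemma square_integrable_cauchy_kernel:
  assumes "Im w \<noteq> 0"
  shows "square_integrable (\<lambda>t. 1 / (of_real t - w))"
proof (cases "Im w < 0")
  case False
  then have "square_integrable (\<lambda>t. cnj (1 / (of_real t - cnj w)))"
    using assms by (intro square_integrable_cnj hardy_test_square_integrable hardy_test_cauchy_kernel) auto
  then show ?thesis by simp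
qed (intro hardy_test_square_integrable hardy_test_cauchy_kernel, assumption)

lemma integrable_cauchy:
  assumes "square_integrable f" "Im w \<noteq> 0"
  shows "integrable lborel (\<lambda>t. f t / (of_real t - w))"
  using integrable_mult_square_integrable[OF assms(1) square_integrable_cauchy_kernel[OF assms(2)]] by simp

text \<open>Differentiation under the integral by hand: two applications of 1/(t - w) - 1/(t - z) =
  (w - z) / ((t - w)(t - z)) show that the difference quotient misses the expected derivative by w -
  z times a bounded integral.\<close>

lemma cauchy_transform_holomorphic:
  assumes G: "integrable lborel G"
  shows "(\<lambda>z. \<integral>t. G t / (of_real t - z) \<partial>lborel) holomorphic_on {z. 0 < Im z}"
proof -
  note [measurable] = borel_measurable_integrable[OF G]
  have far: "Im z \<le> cmod (of_real t - z)" for z t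
    using abs_Im_le_cmod[of "of_real t - z"] by simp
  have kernel: "integrable lborel (\<lambda>t. G t * (1 / (of_real t - z)) * (1 / (of_real t - w)))"
    if "0 < Im z" "0 < Im w" for z w
  proof (rule Bochner_Integration.integrable_bound)
    show "integrable lborel (\<lambda>t. (1 / Im z * (1 / Im w)) *\<^sub>R G t)" using G by (intro integrable_scaleR_right)
    show "AE t in lborel. cmod (G t * (1 / (of_real t - z)) * (1 / (of_real t - w))) \<le> norm ((1 / Im z * (1 / Im w)) *\<^sub>R G t)"
    proof (rule AE_I2)
      fix t
      have "(1 / cmod (of_real t - z)) * (1 / cmod (of_real t - w)) \<le> (1 / Im z) * (1 / Im w)"
        using far[of z t] far[of w t] that by (intro mult_mono divide_left_mono) (auto intro!: mult_pos_pos)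
      from mult_left_mono[OF this, of "cmod (G t)"]
      show "cmod (G t * (1 / (of_real t - z)) * (1 / (of_real t - w))) \<le> norm ((1 / Im z * (1 / Im w)) *\<^sub>R G t)"
        using that by (simp add: norm_mult norm_divide mult_ac)
    qed
  qed measurable
  have single: "integrable lborel (\<lambda>t. G t / (of_real t - z))" if "0 < Im z" for z
  proof (rule Bochner_Integration.integrable_bound)
    show "integrable lborel (\<lambda>t. (1 / Im z) *\<^sub>R G t)" using G by (intro integrable_scaleR_right)
    show "AE t in lborel. cmod (G t / (of_real t - z)) \<le> norm ((1 / Im z) *\<^sub>R G t)"
    proof (rule AE_I2)
      fix t
      have "1 / cmod (of_real t - z) \<le> 1 / Im z"
        using far[of z t] that by (intro divide_left_mono mult_pos_pos) auto
      from mult_left_mono[OF this, of "cmod (G t)"]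
      show "cmod (G t / (of_real t - z)) \<le> norm ((1 / Im z) *\<^sub>R G t)"
        using that by (simp add: norm_divide)
    qed
  qed measurable
  have "((\<lambda>z. \<integral>t. G t / (of_real t - z) \<partial>lborel) has_field_derivative
      (\<integral>t. G t * (1 / (of_real t - z)) * (1 / (of_real t - z)) \<partial>lborel)) (at z)" if z: "0 < Im z" for z
    unfolding has_field_derivative_iff
  proof (rule LIM_zero_cancel[OF Lim_null_comparison])
    define y where "y = Im z"
    have y: "0 < y" using z by (simp add: y_def)
    define A where "A = (\<integral>t. cmod (G t) \<partial>lborel)"
    have evb: "cmod ((((\<integral>t. G t / (of_real t - w) \<partial>lborel) - (\<integral>t. G t / (of_real t - z) \<partial>lborel)) / (w - z))
        - (\<integral>t. G t * (1 / (of_real t - z)) * (1 / (of_real t - z)) \<partial>lborel)) \<le> cmod (w - z) * (2 / y ^ 3) * A"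
      if w: "w \<noteq> z" "dist w z < y / 2" for w
    proof -
      \<comment> \<open>Within distance y / 2 of z the height stays above y / 2. The three kernels
        are then bounded by 1/y, 2/y and 1/y, which is the factor 2 / y^3.\<close>
      have Imw: "y / 2 < Im w"
        using w(2) abs_Im_le_cmod[of "w - z"] by (auto simp: dist_norm y_def)
      then have wp: "0 < Im w" using y by linarith
      have e1: "G t / (of_real t - w) - G t / (of_real t - z) = (w - z) * (G t * (1 / (of_real t - z)) * (1 / (of_real t - w)))" for t
      proof -
        have "of_real t - z \<noteq> 0" "of_real t - w \<noteq> 0" using z wp by (auto simp: complex_eq_iff)
        then show ?thesis by (simp add: divide_simps) (simp add: algebra_simps)
      qed
      have e2: "G t * (1 / (of_real t - z)) * (1 / (of_real t - w)) - G t * (1 / (of_real t - z)) * (1 / (of_real t - z))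
          = (w - z) * (G t * (1 / (of_real t - z)) * (1 / (of_real t - w)) * (1 / (of_real t - z)))" for t
      proof -
        have "of_real t - z \<noteq> 0" "of_real t - w \<noteq> 0" using z wp by (auto simp: complex_eq_iff)
        then show ?thesis by (simp add: divide_simps) (simp add: algebra_simps)
      qed
      have "(\<integral>t. G t / (of_real t - w) \<partial>lborel) - (\<integral>t. G t / (of_real t - z) \<partial>lborel)
          = (w - z) * (\<integral>t. G t * (1 / (of_real t - z)) * (1 / (of_real t - w)) \<partial>lborel)"
        unfolding Bochner_Integration.integral_diff[OF single[OF wp] single[OF z], symmetric] e1 by (rule integral_mult_right_zero)
      then have "((\<integral>t. G t / (of_real t - w) \<partial>lborel) - (\<integral>t. G t / (of_real t - z) \<partial>lborel)) / (w - z)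
          - (\<integral>t. G t * (1 / (of_real t - z)) * (1 / (of_real t - z)) \<partial>lborel)
          = (\<integral>t. G t * (1 / (of_real t - z)) * (1 / (of_real t - w)) - G t * (1 / (of_real t - z)) * (1 / (of_real t - z)) \<partial>lborel)"
        unfolding Bochner_Integration.integral_diff[OF kernel[OF z wp] kernel[OF z z]] using w by simp
      also have "cmod \<dots> \<le> (\<integral>t. (cmod (w - z) * (2 / y ^ 3)) * cmod (G t) \<partial>lborel)"
      proof (rule Bochner_Integration.integral_norm_bound_integral)
        show "integrable lborel (\<lambda>t. G t * (1 / (of_real t - z)) * (1 / (of_real t - w)) - G t * (1 / (of_real t - z)) * (1 / (of_real t - z)))"
          by (intro Bochner_Integration.integrable_diff kernel z wp)
        show "integrable lborel (\<lambda>t. (cmod (w - z) * (2 / y ^ 3)) * cmod (G t))"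
          using G by (intro integrable_mult_right integrable_norm)
        fix t
        have "(1 / cmod (of_real t - z)) * (1 / cmod (of_real t - w)) * (1 / cmod (of_real t - z)) \<le> (1 / y) * (1 / (y / 2)) * (1 / y)"
          using far[of z t] far[of w t] Imw y
          by (intro mult_mono divide_left_mono) (auto simp: y_def intro!: mult_pos_pos mult_nonneg_nonneg)
        also have "\<dots> = 2 / y ^ 3" by (simp add: power3_eq_cube)
        finally have "(1 / cmod (of_real t - z)) * (1 / cmod (of_real t - w)) * (1 / cmod (of_real t - z)) \<le> 2 / y ^ 3" .
        from mult_left_mono[OF this, of "cmod (w - z) * cmod (G t)"]
        show "cmod (G t * (1 / (of_real t - z)) * (1 / (of_real t - w)) - G t * (1 / (of_real t - z)) * (1 / (of_real t - z)))
            \<le> (cmod (w - z) * (2 / y ^ 3)) * cmod (G t)"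
          unfolding e2 by (simp add: norm_mult norm_divide mult_ac)
      qed
      finally show ?thesis unfolding A_def by simp
    qed
    show "\<forall>\<^sub>F w in at z. norm ((((\<integral>t. G t / (of_real t - w) \<partial>lborel) - (\<integral>t. G t / (of_real t - z) \<partial>lborel)) / (w - z))
        - (\<integral>t. G t * (1 / (of_real t - z)) * (1 / (of_real t - z)) \<partial>lborel)) \<le> cmod (w - z) * (2 / Im z ^ 3) * (\<integral>t. cmod (G t) \<partial>lborel)"
      unfolding eventually_at
    proof (intro exI[of _ "y / 2"] conjI ballI impI)
      fix w assume "w \<noteq> z \<and> dist w z < y / 2"
      then show "norm ((((\<integral>t. G t / (of_real t - w) \<partial>lborel) - (\<integral>t. G t / (of_real t - z) \<partial>lborel)) / (w - z))
        - (\<integral>t. G t * (1 / (of_real t - z)) * (1 / (of_real t - z)) \<partial>lborel)) \<le> cmod (w - z) * (2 / Im z ^ 3) * (\<integral>t. cmod (G t) \<partial>lborel)"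
        using evb[of w] by (simp add: A_def y_def)
    qed (use y in simp)
    show "((\<lambda>w. cmod (w - z) * (2 / Im z ^ 3) * (\<integral>t. cmod (G t) \<partial>lborel)) \<longlongrightarrow> 0) (at z)"
      using z by (auto intro!: tendsto_eq_intros)
  qed
  then show ?thesis
    by (intro holomorphic_onI) (auto simp: field_differentiable_def intro: has_field_derivative_at_within)
qed

text \<open>Once |z| is at least twice a bound for the support, |t - z| \<ge> |z| / 2 on the
  support. No lower bound on the height of z enters, so the limit holds along the whole half-plane,
  also near the axis.\<close>

lemma cauchy_transform_at_infinity:
  assumes G: "integrable lborel G" and supp: "\<And>t. t \<notin> {a..b} \<Longrightarrow> G t = 0"
  shows "((\<lambda>z. \<integral>t. G t / (of_real t - z) \<partial>lborel) \<longlongrightarrow> 0) (inf at_infinity (principal {z. 0 < Im z}))"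
proof (rule Lim_null_comparison)
  define R where "R = \<bar>a\<bar> + \<bar>b\<bar> + 1"
  define A where "A = (\<integral>t. cmod (G t) \<partial>lborel)"
  have R: "0 < R" by (simp add: R_def)
  have bound: "cmod (\<integral>t. G t / (of_real t - z) \<partial>lborel) \<le> (2 * A) * inverse (cmod z)"
    if z: "0 < Im z" "2 * R \<le> cmod z" for z
  proof -
    have zp: "0 < cmod z" using z R by linarith
    have pt: "cmod (G t / (of_real t - z)) \<le> (2 * inverse (cmod z)) * cmod (G t)" for t
    proof (cases "t \<in> {a..b}")
      case True
      then have "\<bar>t\<bar> \<le> R" by (auto simp: R_def)
      then have "cmod z / 2 \<le> cmod (of_real t - z)"
        using norm_triangle_ineq2[of z "of_real t"] z(2) by (simp add: norm_minus_commute)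
      then have "1 / cmod (of_real t - z) \<le> 1 / (cmod z / 2)" using zp by (intro divide_left_mono mult_pos_pos) auto
      from mult_left_mono[OF this, of "cmod (G t)"] show ?thesis
        by (simp add: norm_divide inverse_eq_divide mult.commute)
    qed (simp add: supp)
    have "integrable lborel (\<lambda>t. (2 * inverse (cmod z)) * cmod (G t))" using G by simp
    moreover have "integrable lborel (\<lambda>t. G t / (of_real t - z))"
    proof (rule Bochner_Integration.integrable_bound)
      show "integrable lborel (\<lambda>t. (2 * inverse (cmod z)) * cmod (G t))" using G by simp
      show "(\<lambda>t. G t / (of_real t - z)) \<in> borel_measurable lborel"
        using borel_measurable_integrable[OF G] by measurable
      show "AE t in lborel. norm (G t / (of_real t - z)) \<le> norm ((2 * inverse (cmod z)) * cmod (G t))"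
        using pt by (intro AE_I2) (auto intro: order_trans[OF _ abs_ge_self])
    qed
    ultimately have "cmod (\<integral>t. G t / (of_real t - z) \<partial>lborel) \<le> (\<integral>t. (2 * inverse (cmod z)) * cmod (G t) \<partial>lborel)"
      by (intro Bochner_Integration.integral_norm_bound_integral pt)
    then show ?thesis by (simp add: A_def mult_ac)
  qed
  have "\<forall>\<^sub>F z in at_infinity. 2 * R \<le> cmod z" by (rule eventually_at_infinityI)
  then show "\<forall>\<^sub>F z in inf at_infinity (principal {z. 0 < Im z}).
      cmod (\<integral>t. G t / (of_real t - z) \<partial>lborel) \<le> (2 * A) * inverse (cmod z)"
    unfolding eventually_inf_principal by eventually_elim (use bound in auto)
  have "((\<lambda>z::complex. (2 * A) * inverse (cmod z)) \<longlongrightarrow> 0) at_infinity"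
    by (intro tendsto_mult_right_zero tendsto_inverse_0_at_top filterlim_norm_at_top)
  then show "((\<lambda>z. (2 * A) * inverse (cmod z)) \<longlongrightarrow> 0) (inf at_infinity (principal {z. 0 < Im z}))"
    by (rule tendsto_mono[OF inf_le1])
qed

lemma annihilates_cauchy_zero:
  assumes "annihilates_hardy f" "Im w < 0"
  shows "(\<integral>t. f t / (of_real t - w) \<partial>lborel) = 0"
  using assms hardy_test_cauchy_kernel[OF assms(2)] by (auto simp: annihilates_hardy_def)

text \<open>If \<^term>\<open>f\<close> and the conjugate of \<^term>\<open>g\<close> are boundary values of functions on the upper
  half-plane, then on that half-plane the Cauchy integral of \<^term>\<open>g\<close> vanishes, so that
  \<^term>\<open>f\<close> may be replaced by the compactly supported jump \<^term>\<open>f - g\<close>.\<close>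

lemma poisson_integral_jump:
  assumes f: "annihilates_hardy f" and g: "annihilates_hardy (\<lambda>t. cnj (g t))"
    and supp: "\<And>t. t \<notin> {a..b} \<Longrightarrow> f t = g t"
  shows "poisson_integral f holomorphic_on {z. 0 < Im z}"
    and "(poisson_integral f \<longlongrightarrow> 0) (inf at_infinity (principal {z. 0 < Im z}))"
proof -
  have fL: "square_integrable f" using f by (simp add: annihilates_hardy_def)
  have gL: "square_integrable g"
    using square_integrable_cnj[of "\<lambda>t. cnj (g t)"] g by (simp add: annihilates_hardy_def)
  define G where "G t = f t - g t" for t
  have GL: "square_integrable G" unfolding G_def[abs_def] by (intro square_integrable_diff fL gL)
  \<comment> \<open>Multiplying \<open>G\<close> by this square-integrable indicator does not change
    it, so the square-integrable jump is integrable, as the Cauchy transform lemmas require.\<close>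
  have ind: "square_integrable (\<lambda>t. indicator {a..b} t :: complex)"
  proof (rule square_integrable_bound)
    show "integrable lborel (\<lambda>t. indicator {a..b} t :: real)"
      by (simp add: integrable_indicator_iff emeasure_lborel_Icc_eq)
    show "AE t in lborel. (norm (indicator {a..b} t :: complex))\<^sup>2 \<le> indicator {a..b} t"
      by (intro AE_I2) (simp add: indicator_def)
  qed simp
  have supp': "G t = 0" if "t \<notin> {a..b}" for t using supp[OF that] by (simp add: G_def)
  have Gi: "integrable lborel G"
  proof -
    have "(\<lambda>t. G t * indicator {a..b} t) = G" using supp' by (auto simp: indicator_def fun_eq_iff)
    then show ?thesis using integrable_mult_square_integrable[OF GL ind] by (simp only:)
  qed
  have eq: "poisson_integral f z = (1 / (2 * pi * \<i>)) * (\<integral>t. G t / (of_real t - z) \<partial>lborel)" if z: "0 < Im z" for z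
  proof -
    \<comment> \<open>Conjugation turns \<open>g\<close> into its conjugate and moves the pole from
      z to \<open>cnj z\<close> in the lower half-plane, where
      \<open>1 / (of_real t - cnj z)\<close> is a test function.\<close>
    have "(\<integral>t. g t / (of_real t - z) \<partial>lborel) = cnj (\<integral>t. cnj (g t) / (of_real t - cnj z) \<partial>lborel)"
      unfolding Bochner_Integration.integral_cnj[symmetric] by (simp del: Bochner_Integration.integral_cnj)
    also have "\<dots> = 0" using annihilates_cauchy_zero[OF g, of "cnj z"] z by simp
    finally have g0: "(\<integral>t. g t / (of_real t - z) \<partial>lborel) = 0" .
    have i: "integrable lborel (\<lambda>t. f t / (of_real t - z))" "integrable lborel (\<lambda>t. g t / (of_real t - z))"
      "integrable lborel (\<lambda>t. f t / (of_real t - cnj z))"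
      using z by (intro integrable_cauchy fL gL; simp)+
    have "(\<integral>t. G t / (of_real t - z) \<partial>lborel) = (\<integral>t. f t / (of_real t - z) \<partial>lborel)"
      using g0 i by (simp add: G_def diff_divide_distrib)
    moreover have "(\<integral>t. f t / (of_real t - cnj z) \<partial>lborel) = 0"
      using annihilates_cauchy_zero[OF f, of "cnj z"] z by simp
    ultimately show ?thesis using poisson_integral_eq_cauchy(2)[OF z i(1) i(3)] by simp
  qed
  have "(\<lambda>z. (1 / (2 * pi * \<i>)) * (\<integral>t. G t / (of_real t - z) \<partial>lborel)) holomorphic_on {z. 0 < Im z}"
    by (intro holomorphic_intros cauchy_transform_holomorphic Gi)
  then show "poisson_integral f holomorphic_on {z. 0 < Im z}"
    by (rule holomorphic_transform) (simp add: eq)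
  have "((\<lambda>z. (1 / (2 * pi * \<i>)) * (\<integral>t. G t / (of_real t - z) \<partial>lborel)) \<longlongrightarrow> 0) (inf at_infinity (principal {z. 0 < Im z}))"
    by (intro tendsto_mult_right_zero cauchy_transform_at_infinity[OF Gi supp'])
  then show "(poisson_integral f \<longlongrightarrow> 0) (inf at_infinity (principal {z. 0 < Im z}))"
    by (rule Lim_transform_eventually) (simp add: eventually_inf_principal eq)
qed

lemma poisson_integral_bound:
  assumes f: "f \<in> borel_measurable borel" and b: "AE t in lborel. cmod (f t) \<le> B" and z: "0 < Im z"
  shows "cmod (poisson_integral f z) \<le> B"
proof -
  have int: "integrable lborel (\<lambda>t. poisson z t * B)" using integrable_poisson[OF z] by simp
  have ae: "AE t in lborel. cmod (poisson z t *\<^sub>R f t) \<le> poisson z t * B"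
    using b by eventually_elim (use z in \<open>simp add: poisson_nonneg mult_left_mono\<close>)
  have i2: "integrable lborel (\<lambda>t. poisson z t *\<^sub>R f t)"
  proof (rule Bochner_Integration.integrable_bound[OF int])
    show "AE t in lborel. cmod (poisson z t *\<^sub>R f t) \<le> norm (poisson z t * B)"
      using ae by eventually_elim (auto intro: order_trans[OF _ abs_ge_self])
  qed (use f in measurable)
  have "cmod (poisson_integral f z) \<le> (\<integral>t. cmod (poisson z t *\<^sub>R f t) \<partial>lborel)"
    unfolding poisson_integral_def by (rule integral_norm_bound)
  also have "\<dots> \<le> (\<integral>t. poisson z t * B \<partial>lborel)"
    by (rule integral_mono_AE[OF integrable_norm[OF i2] int ae])
  also have "\<dots> = B" using integral_poisson[OF z] by simp
  finally show ?thesis .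
qed

section \<open>Complex matrices and the Riemann--Hilbert problem\<close>

text \<open>The Hermitian inner product, conjugate-linear in the first argument. Its real part is
  the Euclidean inner product of the underlying real space, and this connects complex matrices with
  the real variational problem.\<close>

definition cdot :: "complex^'n \<Rightarrow> complex^'n \<Rightarrow> complex"
  where "cdot u v = (\<Sum>i\<in>UNIV. cnj (u $ i) * v $ i)"

lemma adj_nth [simp]: "adj A $ i $ j = cnj (A $ j $ i)"
  by (simp add: adj_def map_matrix_def transpose_def)

lemma adj_adj [simp]: "adj (adj A) = A"
  by (simp add: vec_eq_iff)

lemma adj_mat1 [simp]: "adj (mat 1) = mat 1"
  by (simp add: vec_eq_iff mat_def)

lemma adj_matrix_mul: "adj (A ** B) = adj B ** adj A"
  by (simp add: vec_eq_iff matrix_matrix_mult_def mult.commute)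

lemma matrix_add_mult_distrib: "(A + B) ** C = A ** C + B ** (C :: 'a::semiring_1^'n^'m)"
  by (simp add: vec_eq_iff matrix_matrix_mult_def distrib_right sum.distrib)

lemma quad_form_cdot: "quad_form A v = cdot v (A *v v)"
  by (simp add: quad_form_def cdot_def)

lemma inner_cdot: "u \<bullet> v = Re (cdot u v)"
  by (simp add: inner_vec_def cdot_def inner_complex_def)

lemma cdot_self: "cdot v v = of_real ((norm v)\<^sup>2)"
proof -
  have "Im (cdot v v) = 0" by (simp add: cdot_def)
  moreover have "Re (cdot v v) = (norm v)\<^sup>2" by (simp add: inner_cdot[symmetric] power2_norm_eq_inner)
  ultimately show ?thesis by (simp add: complex_eq_iff)
qed

lemma cdot_matrix_left: "cdot (A *v u) v = cdot u (adj A *v v)"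
proof -
  have "cdot (A *v u) v = (\<Sum>i\<in>UNIV. \<Sum>j\<in>UNIV. cnj (A $ i $ j) * cnj (u $ j) * v $ i)"
    by (simp add: cdot_def matrix_vector_mult_def sum_distrib_right)
  also have "\<dots> = (\<Sum>j\<in>UNIV. \<Sum>i\<in>UNIV. cnj (A $ i $ j) * cnj (u $ j) * v $ i)"
    by (rule sum.swap)
  also have "\<dots> = cdot u (adj A *v v)"
    by (simp add: cdot_def matrix_vector_mult_def sum_distrib_left mult_ac)
  finally show ?thesis .
qed

lemma cdot_scale_left: "cdot (c *s u) v = cnj c * cdot u v"
  by (simp add: cdot_def sum_distrib_left mult_ac)

lemma cdot_scale_right: "cdot u (c *s v) = c * cdot u v"
  by (simp add: cdot_def sum_distrib_left mult_ac)

lemma norm_vector_scale_complex: "norm (c *s (u :: complex^'n)) = cmod c * norm u"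
proof -
  have "complex_of_real ((norm (c *s u))\<^sup>2) = (c * cnj c) * cdot u u"
    unfolding cdot_self[symmetric] cdot_scale_left cdot_scale_right by (simp only: mult_ac)
  also have "\<dots> = of_real ((cmod c * norm u)\<^sup>2)"
    unfolding complex_norm_square[symmetric] cdot_self by (simp add: power_mult_distrib)
  finally have "complex_of_real ((norm (c *s u))\<^sup>2) = of_real ((cmod c * norm u)\<^sup>2)" .
  then have "(norm (c *s u))\<^sup>2 = (cmod c * norm u)\<^sup>2" unfolding of_real_eq_iff .
  then show ?thesis by (simp add: power2_eq_iff_nonneg)
qed

lemma cmod_cdot_le: "cmod (cdot u v) \<le> norm u * norm v"
proof (cases "cdot u v = 0")
  case False
  \<comment> \<open>Multiplying \<open>u\<close> by the value of the product makes the pairing real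
    and equal to |a|^2, which reduces the claim to the real Cauchy-Schwarz inequality.\<close>
  define a where "a = cdot u v"
  have "(cmod a)\<^sup>2 = Re (cdot (a *s u) v)"
    unfolding cdot_scale_left a_def[symmetric] cmod_power2 by (simp add: power2_eq_square)
  also have "\<dots> \<le> norm (a *s u) * norm v"
    unfolding inner_cdot[symmetric] by (rule norm_cauchy_schwarz)
  finally have "cmod a * cmod a \<le> cmod a * (norm u * norm v)"
    by (simp add: norm_vector_scale_complex power2_eq_square mult.assoc)
  with False show ?thesis by (simp add: a_def)
qed simp

lemma norm_adj_mul_form: "quad_form (adj A ** A) v = of_real ((norm (A *v v))\<^sup>2)"
  using cdot_matrix_left[of A v "A *v v"]
  by (simp add: quad_form_cdot matrix_vector_mul_assoc[symmetric] cdot_self)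

text \<open>The quadratic form of adj A ** A is |A v|^2. Maximality thus becomes a comparison of
  norms of image vectors.\<close>

lemma loewner_le_adj_mul_iff:
  "loewner_le (adj A ** A) (adj B ** B) \<longleftrightarrow> (\<forall>v. norm (A *v v) \<le> norm (B *v v))"
  by (simp add: loewner_le_def hermitian_def adj_matrix_mul norm_adj_mul_form power2_le_iff_abs_le)

lemma matrix_entry_bound:
  assumes "\<And>v. norm (A *v v) \<le> C * norm v"
  shows "cmod (A $ i $ j) \<le> C"
proof -
  have "cmod (A $ i $ j) = cmod ((A *v axis j 1) $ i)" by (simp add: matrix_vector_mult_def axis_def if_distrib cong: if_cong)
  also have "\<dots> \<le> norm (A *v axis j 1)" by (rule Finite_Cartesian_Product.norm_nth_le)
  also have "\<dots> \<le> C" using assms[of "axis j 1"] by simp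
  finally show ?thesis .
qed

section \<open>Measurability and square integrability of vector functions by components\<close>

lemma borel_measurable_vec:
  fixes f :: "real \<Rightarrow> 'b::euclidean_space^'n"
  assumes "\<And>i. (\<lambda>x. f x $ i) \<in> borel_measurable borel"
  shows "f \<in> borel_measurable borel"
proof -
  have "(\<lambda>x. f x \<bullet> b) \<in> borel_measurable borel" if b: "b \<in> Basis" for b
  proof -
    obtain i u where "u \<in> Basis" "b = axis i u" using b unfolding Basis_vec_def by blast
    then have "f x \<bullet> b = f x $ i \<bullet> u" for x by (simp add: inner_axis)
    then show ?thesis using assms[of i] by simp
  qed
  then show ?thesis unfolding borel_measurable_euclidean_space[of f] by blast
qed

lemma borel_measurable_vec_nth:
  assumes "f \<in> borel_measurable borel"
  shows "(\<lambda>x. f x $ i) \<in> borel_measurable borel"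
  by (rule borel_measurable_continuous_on[OF _ assms, of "\<lambda>v. v $ i"]) (intro continuous_intros)

lemma square_integrable_vec:
  fixes f :: "real \<Rightarrow> complex^'n"
  assumes "\<And>i. square_integrable (\<lambda>x. f x $ i)"
  shows "square_integrable f"
proof (rule square_integrable_bound)
  show "integrable lborel (\<lambda>x. \<Sum>i\<in>UNIV. (cmod (f x $ i))\<^sup>2)"
    using assms by (intro Bochner_Integration.integrable_sum square_integrableD(2))
  show "f \<in> borel_measurable borel" using assms by (intro borel_measurable_vec square_integrableD(1))
  show "AE x in lborel. (norm (f x))\<^sup>2 \<le> (\<Sum>i\<in>UNIV. (cmod (f x $ i))\<^sup>2)"
    by (simp add: norm_vec_def L2_set_def sum_nonneg)
qed

lemma square_integrable_vec_nth:
  fixes f :: "real \<Rightarrow> complex^'n"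
  assumes "square_integrable f"
  shows "square_integrable (\<lambda>x. f x $ i)"
proof (rule square_integrable_bound[OF square_integrableD(2)[OF assms]])
  show "(\<lambda>x. f x $ i) \<in> borel_measurable borel"
    by (rule borel_measurable_vec_nth[OF square_integrableD(1)[OF assms]])
  show "AE x in lborel. (cmod (f x $ i))\<^sup>2 \<le> (norm (f x))\<^sup>2"
    by (intro AE_I2 power_mono Finite_Cartesian_Product.norm_nth_le) auto
qed

lemma matrix_vector_linear_real: "linear (\<lambda>v. (A :: complex^'n^'n) *v v)"
proof (rule linearI)
  show "A *v (u + v) = A *v u + A *v v" for u v by (rule matrix_vector_right_distrib)
  show "A *v (c *\<^sub>R v) = c *\<^sub>R (A *v v)" for c v
    by (simp add: vec_eq_iff matrix_vector_mult_def scaleR_sum_right)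
qed

text \<open>One column of the solution of the Riemann--Hilbert problem: \<^term>\<open>f\<close> and the conjugate of
  \<^term>\<open>\<lambda>x. S x *v (f x + e) - e\<close> both lie in the Hardy space.\<close>

lemma riemann_hilbert_column:
  fixes S :: "real \<Rightarrow> complex^'n^'n" and e :: "complex^'n"
  assumes meas: "\<And>i j. (\<lambda>x. S x $ i $ j) \<in> borel_measurable borel"
    and herm: "\<And>x. adj (S x) = S x" and coercive: "\<And>x v. (norm v)\<^sup>2 \<le> (S x *v v) \<bullet> v"
    and bdd: "\<And>x v. norm (S x *v v) \<le> C * norm v"
    and outside: "\<And>x. x \<notin> {a..b} \<Longrightarrow> S x = mat 1"
  obtains f where "square_integrable f" "\<And>i. hardy (\<lambda>x. f x $ i)"
    "\<And>i. annihilates_hardy (\<lambda>x. cnj ((S x *v (f x + e) - e) $ i))"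
proof -
  have Tm: "(\<lambda>x. S x *v f x) \<in> borel_measurable borel" if "f \<in> borel_measurable borel" for f
  proof (rule borel_measurable_vec)
    fix i
    have "(\<lambda>x. \<Sum>j\<in>UNIV. S x $ i $ j * f x $ j) \<in> borel_measurable borel"
      by (intro borel_measurable_sum borel_measurable_times meas borel_measurable_vec_nth[OF that])
    then show "(\<lambda>x. (S x *v f x) $ i) \<in> borel_measurable borel" by (simp add: matrix_vector_mult_def)
  qed
  \<comment> \<open>This is (S - I) e, which vanishes off [a,b] and hence is square-integrable
    although the constant \<open>e\<close> is not. The expression S (f + e) - e equals S f + k, the
    Euler-Lagrange term.\<close>
  define k where "k x = S x *v e - e" for x
  have kL: "square_integrable k"
  proof (rule square_integrable_bound)
    show "integrable lborel (\<lambda>x. indicator {a..b} x * (\<bar>C\<bar> * norm e + norm e)\<^sup>2)"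
      by (intro integrable_mult_left) (simp add: integrable_indicator_iff emeasure_lborel_Icc_eq)
    show "k \<in> borel_measurable borel"
      unfolding k_def[abs_def] by (intro borel_measurable_diff Tm) auto
    show "AE x in lborel. (norm (k x))\<^sup>2 \<le> indicator {a..b} x * (\<bar>C\<bar> * norm e + norm e)\<^sup>2"
    proof (rule AE_I2)
      fix x
      have "norm (S x *v e) \<le> \<bar>C\<bar> * norm e"
        by (rule order_trans[OF bdd]) (intro mult_right_mono, auto)
      then have "norm (k x) \<le> \<bar>C\<bar> * norm e + norm e"
        using norm_triangle_ineq4[of "S x *v e" e] unfolding k_def by linarith
      then have "(norm (k x))\<^sup>2 \<le> (\<bar>C\<bar> * norm e + norm e)\<^sup>2" by (rule power_mono) simp
      then show "(norm (k x))\<^sup>2 \<le> indicator {a..b} x * (\<bar>C\<bar> * norm e + norm e)\<^sup>2"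
        by (cases "x \<in> {a..b}") (simp_all add: k_def outside matrix_vector_mul_lid)
    qed
  qed
  define D where "D = {h :: real \<Rightarrow> complex^'n. \<forall>i. hardy_test (\<lambda>x. h x $ i)}"
  obtain f s where f: "square_integrable f" and s: "\<And>n. s n \<in> D"
    and lim: "(\<lambda>n. \<integral>x. (norm (s n x - f x))\<^sup>2 \<partial>lborel) \<longlonglongrightarrow> 0"
    and orth: "\<And>h. h \<in> D \<Longrightarrow> (\<integral>x. (S x *v f x + k x) \<bullet> h x \<partial>lborel) = 0"
  proof (rule variational_solution[of D "\<lambda>x v. S x *v v" C k])
    show "(\<lambda>x. 0) \<in> D" by (simp add: D_def hardy_test_zero)
    show "(\<lambda>x. f x + g x) \<in> D" if "f \<in> D" "g \<in> D" for f g
      using that by (simp add: D_def hardy_test_add)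
    show "(\<lambda>x. c *\<^sub>R f x) \<in> D" if "f \<in> D" for c f
      using that by (simp add: D_def scaleR_conv_of_real hardy_test_cmult)
    show "square_integrable f" if "f \<in> D" for f
      using that by (intro square_integrable_vec hardy_test_square_integrable) (simp add: D_def)
    show "(S x *v u) \<bullet> v = (S x *v v) \<bullet> u" for x u v
    proof -
      have "(S x *v u) \<bullet> v = u \<bullet> (S x *v v)" by (simp add: inner_cdot cdot_matrix_left herm)
      then show ?thesis by (simp add: inner_commute)
    qed
    show "linear (\<lambda>v. S x *v v)" for x by (rule matrix_vector_linear_real)
    show "(norm v)\<^sup>2 \<le> (S x *v v) \<bullet> v" for x v by (rule coercive)
    show "norm (S x *v v) \<le> C * norm v" for x v by (rule bdd)
    show "(\<lambda>x. S x *v f x) \<in> borel_measurable borel" if "f \<in> borel_measurable borel" for f by (rule Tm[OF that])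
    show "square_integrable k" by (rule kL)
  qed (rule that, assumption+)
  have hardy: "hardy (\<lambda>x. f x $ i)" for i
    unfolding hardy_def
  proof (intro conjI exI[of _ "\<lambda>n x. s n x $ i"] allI)
    show "square_integrable (\<lambda>x. f x $ i)" by (rule square_integrable_vec_nth[OF f])
    show "hardy_test (\<lambda>x. s n x $ i)" for n using s[of n] by (simp add: D_def)
    have sL: "square_integrable (s n)" for n
      using s[of n] by (intro square_integrable_vec hardy_test_square_integrable) (simp add: D_def)
    show "(\<lambda>n. \<integral>x. (cmod (s n x $ i - f x $ i))\<^sup>2 \<partial>lborel) \<longlonglongrightarrow> 0"
    proof (rule Lim_null_comparison[OF always_eventually lim], rule allI)
      fix n
      have d: "square_integrable (\<lambda>x. s n x - f x)" by (intro square_integrable_diff sL f)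
      have "(\<integral>x. (cmod (s n x $ i - f x $ i))\<^sup>2 \<partial>lborel) \<le> (\<integral>x. (norm (s n x - f x))\<^sup>2 \<partial>lborel)"
      proof (rule integral_mono)
        show "integrable lborel (\<lambda>x. (cmod (s n x $ i - f x $ i))\<^sup>2)"
          using square_integrableD(2)[OF square_integrable_vec_nth[OF d, of i]] by simp
        show "integrable lborel (\<lambda>x. (norm (s n x - f x))\<^sup>2)" by (rule square_integrableD(2)[OF d])
        show "(cmod (s n x $ i - f x $ i))\<^sup>2 \<le> (norm (s n x - f x))\<^sup>2" for x
          using Finite_Cartesian_Product.norm_nth_le[where x = "s n x - f x" and i = i] by (intro power_mono) auto
      qed
      then show "norm (\<integral>x. (cmod (s n x $ i - f x $ i))\<^sup>2 \<partial>lborel) \<le> (\<integral>x. (norm (s n x - f x))\<^sup>2 \<partial>lborel)"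
        by simp
    qed
  qed
  have ann: "annihilates_hardy (\<lambda>x. cnj ((S x *v (f x + e) - e) $ i))" for i
    unfolding annihilates_hardy_def
  proof (intro conjI allI impI)
    define g where "g x = (S x *v (f x + e) - e) $ i" for x
    have gk: "g x = (S x *v f x + k x) $ i" for x
      by (simp add: g_def k_def matrix_vector_right_distrib)
    have TfL: "square_integrable (\<lambda>x. S x *v f x)"
    proof (rule square_integrable_bound)
      show "integrable lborel (\<lambda>x. C\<^sup>2 * (norm (f x))\<^sup>2)" using square_integrableD(2)[OF f] by simp
      show "(\<lambda>x. S x *v f x) \<in> borel_measurable borel" by (rule Tm[OF square_integrableD(1)[OF f]])
      show "AE x in lborel. (norm (S x *v f x))\<^sup>2 \<le> C\<^sup>2 * (norm (f x))\<^sup>2"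
      proof (rule AE_I2)
        fix x
        have "(norm (S x *v f x))\<^sup>2 \<le> (C * norm (f x))\<^sup>2" by (intro power_mono bdd) simp
        then show "(norm (S x *v f x))\<^sup>2 \<le> C\<^sup>2 * (norm (f x))\<^sup>2" by (simp add: power_mult_distrib)
      qed
    qed
    have gL: "square_integrable g"
      using square_integrable_vec_nth[OF square_integrable_add[OF TfL kL], of i] by (simp add: gk[abs_def])
    then show "square_integrable (\<lambda>x. cnj ((S x *v (f x + e) - e) $ i))"
      unfolding g_def by (rule square_integrable_cnj)
    fix r assume r: "hardy_test r"
    \<comment> \<open>The variational equation uses the real inner product and so gives only real
      parts. Since \<open>D\<close> admits complex factors, testing with c = 1 and c = -i recovers
      the whole complex integral.\<close>
    have re0: "(\<integral>x. Re (cnj (g x) * (c * r x)) \<partial>lborel) = 0" for c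
    proof -
      have "(\<lambda>x. axis i (c * r x)) \<in> D"
        unfolding D_def
      proof (intro CollectI allI)
        show "hardy_test (\<lambda>x. axis i (c * r x) $ j)" for j
          by (cases "j = i") (simp_all add: axis_def hardy_test_cmult[OF r] hardy_test_zero)
      qed
      from orth[OF this] have "(\<integral>x. g x \<bullet> (c * r x) \<partial>lborel) = 0"
        by (simp only: inner_axis gk)
      moreover have "u \<bullet> v = Re (cnj u * v)" for u v :: complex by (simp add: inner_complex_def)
      ultimately show ?thesis by (simp only:)
    qed
    have int: "integrable lborel (\<lambda>x. cnj (g x) * r x)"
      by (rule integrable_mult_square_integrable[OF square_integrable_cnj[OF gL] hardy_test_square_integrable[OF r]])
    have "Re (\<integral>x. cnj (g x) * r x \<partial>lborel) = 0"
      using re0[of 1] integral_Re[OF int] by simp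
    moreover have "Im (\<integral>x. cnj (g x) * r x \<partial>lborel) = 0"
    proof -
      have "Re (cnj (g x) * (- \<i> * r x)) = Im (cnj (g x) * r x)" for x by (simp add: algebra_simps)
      then show ?thesis using re0[of "- \<i>"] integral_Im[OF int] by simp
    qed
    ultimately show "(\<integral>x. cnj ((S x *v (f x + e) - e) $ i) * r x \<partial>lborel) = 0"
      by (simp add: complex_eq_iff g_def)
  qed
  show thesis by (rule that[OF f hardy ann])
qed

section \<open>Factorization of matrix functions\<close>

text \<open>Besides the factor \<open>W\<close> its inverse \<open>X\<close> is exported with
  bounds, limit and boundary values of its own, because a competitor is compared with
  \<open>W\<close> after multiplication by \<open>X\<close>.\<close>

lemma spectral_factorization:
  fixes S :: "real \<Rightarrow> complex^'n^'n"
  assumes meas: "\<And>i j. (\<lambda>x. S x $ i $ j) \<in> borel_measurable borel"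
    and herm: "\<And>x. adj (S x) = S x" and coercive: "\<And>x v. (norm v)\<^sup>2 \<le> (S x *v v) \<bullet> v"
    and bdd: "\<And>x v. norm (S x *v v) \<le> C * norm v"
    and outside: "\<And>x. x \<notin> {a..b} \<Longrightarrow> S x = mat 1"
  obtains W X :: "complex \<Rightarrow> complex^'n^'n" and B where
    "\<And>i j. (\<lambda>z. W z $ i $ j) holomorphic_on {z. 0 < Im z}"
    "\<And>i j. (\<lambda>z. X z $ i $ j) holomorphic_on {z. 0 < Im z}"
    "\<And>z i j. 0 < Im z \<Longrightarrow> cmod (W z $ i $ j) \<le> B"
    "\<And>z i j. 0 < Im z \<Longrightarrow> cmod (X z $ i $ j) \<le> B"
    "(W \<longlongrightarrow> mat 1) (inf at_infinity (principal {z. 0 < Im z}))"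
    "(X \<longlongrightarrow> mat 1) (inf at_infinity (principal {z. 0 < Im z}))"
    "\<And>z. 0 < Im z \<Longrightarrow> W z ** X z = mat 1"
    "AE x in lborel. \<exists>L Y. has_boundary_value W x L \<and> has_boundary_value X x Y \<and>
      adj L ** L = S x \<and> adj Y ** S x ** Y = mat 1"
proof -
  have C0: "0 \<le> C"
  proof -
    have "0 \<le> norm (S 0 *v axis undefined 1)" by simp
    also have "\<dots> \<le> C" using bdd[of 0 "axis undefined 1"] by simp
    finally show ?thesis .
  qed
  have "\<forall>j. \<exists>f. square_integrable f \<and> (\<forall>i. hardy (\<lambda>x. f x $ i)) \<and>
      (\<forall>i. annihilates_hardy (\<lambda>x. cnj ((S x *v (f x + axis j 1) - axis j 1) $ i)))"
  proof
    fix j :: 'n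
    obtain f where "square_integrable f" "\<And>i. hardy (\<lambda>x. f x $ i)"
      "\<And>i. annihilates_hardy (\<lambda>x. cnj ((S x *v (f x + axis j 1) - axis j 1) $ i))"
    proof (rule riemann_hilbert_column[where S = S and C = C and a = a and b = b and e = "axis j 1"])
      show "(\<lambda>x. S x $ i $ j) \<in> borel_measurable borel" for i j by (rule meas)
      show "adj (S x) = S x" for x by (rule herm)
      show "(norm v)\<^sup>2 \<le> (S x *v v) \<bullet> v" for x v by (rule coercive)
      show "norm (S x *v v) \<le> C * norm v" for x v by (rule bdd)
      show "S x = mat 1" if "x \<notin> {a..b}" for x by (rule outside[OF that])
    qed (rule that, assumption+)
    then show "\<exists>f. square_integrable f \<and> (\<forall>i. hardy (\<lambda>x. f x $ i)) \<and>
      (\<forall>i. annihilates_hardy (\<lambda>x. cnj ((S x *v (f x + axis j 1) - axis j 1) $ i)))" by blast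
  qed
  from choice[OF this] obtain \<phi> where \<phi>: "\<And>i j. hardy (\<lambda>x. \<phi> j x $ i)"
    "\<And>i j. annihilates_hardy (\<lambda>x. cnj ((S x *v (\<phi> j x + axis j 1) - axis j 1) $ i))"
    by blast
  \<comment> \<open>Column j of \<open>P\<close> solves the column problem for the j-th unit vector.
    \<open>Y\<close> will be the boundary function of \<open>X\<close> and \<open>L\<close> that of
    \<open>W\<close>.\<close>
  define P where "P x = (\<chi> i j. \<phi> j x $ i)" for x
  define Y where "Y x = mat 1 + P x" for x
  define Q where "Q x = S x ** Y x - mat 1" for x
  define L where "L x = adj (S x ** Y x)" for x
  have hP: "hardy (\<lambda>x. P x $ i $ j)" for i j using \<phi>(1) by (simp add: P_def)
  have aP: "annihilates_hardy (\<lambda>x. P x $ i $ j)" for i j by (rule hardy_annihilates[OF hP])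
  have Qcol: "Q x $ i $ j = (S x *v (\<phi> j x + axis j 1) - axis j 1) $ i" for x i j
  proof -
    have "Y x $ k $ j = (\<phi> j x + axis j 1) $ k" for k
      by (simp add: Y_def P_def mat_def axis_def)
    then show ?thesis
      by (simp add: Q_def matrix_matrix_mult_def matrix_vector_mult_def mat_def axis_def)
  qed
  have aQ: "annihilates_hardy (\<lambda>x. cnj (Q x $ i $ j))" for i j
    unfolding Qcol by (rule \<phi>(2))
  have QP: "Q x $ i $ j = P x $ i $ j" if "x \<notin> {a..b}" for x i j
    using outside[OF that] by (simp add: Q_def Y_def)
  have Ladj: "L x = mat 1 + adj (Q x)" for x
    by (simp add: L_def Q_def vec_eq_iff mat_def)
  have Lform: "L x ** Y x = adj (Y x) ** S x ** Y x" for x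
    by (simp add: L_def adj_matrix_mul herm)
  define E where "E x = L x ** Y x - mat 1" for x
  have Eherm: "adj (E x) = E x" for x
  proof -
    have "adj (adj (Y x) ** S x ** Y x) = adj (Y x) ** S x ** Y x"
      by (simp add: adj_matrix_mul herm matrix_mul_assoc)
    then show ?thesis unfolding E_def Lform by (simp add: vec_eq_iff mat_def)
  qed
  have Eentry: "E x $ i $ j = P x $ i $ j + cnj (Q x $ j $ i) + (\<Sum>k\<in>UNIV. cnj (Q x $ k $ i) * P x $ k $ j)" for x i j
  proof -
    have "E x = P x + adj (Q x) + adj (Q x) ** P x"
      unfolding E_def Ladj Y_def
      by (simp add: matrix_add_ldistrib matrix_add_mult_distrib algebra_simps)
    then show ?thesis by (simp add: matrix_matrix_mult_def)
  qed
  have PL: "square_integrable (\<lambda>x. P x $ i $ j)" for i j using aP by (simp add: annihilates_hardy_def)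
  have QL: "square_integrable (\<lambda>x. cnj (Q x $ i $ j))" for i j using aQ by (simp add: annihilates_hardy_def)
  have Pm: "(\<lambda>x. P x $ i $ j) \<in> borel_measurable borel" for i j by (rule square_integrableD(1)[OF PL])
  have Qm: "(\<lambda>x. cnj (Q x $ i $ j)) \<in> borel_measurable borel" for i j by (rule square_integrableD(1)[OF QL])
  have Em: "(\<lambda>x. E x $ i $ j) \<in> borel_measurable borel" for i j
    unfolding Eentry by (intro borel_measurable_add borel_measurable_sum borel_measurable_times Pm Qm)
  have lower: "integrable lborel (\<lambda>t. E t $ i $ j / (of_real t - w)) \<and> (\<integral>t. E t $ i $ j / (of_real t - w) \<partial>lborel) = 0"
    if w: "Im w < 0" for w i j
  proof -
    \<comment> \<open>The first two terms vanish against the kernel because \<open>P\<close> and the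
      conjugates of \<open>Q\<close> annihilate test functions. For the product the two descriptions
      cooperate: \<open>P\<close> is a limit of test functions, while \<open>Q\<close> is known only
      through annihilation.\<close>
    have eq: "E t $ i $ j / (of_real t - w) = P t $ i $ j / (of_real t - w) + cnj (Q t $ j $ i) / (of_real t - w)
      + (\<Sum>k\<in>UNIV. cnj (Q t $ k $ i) * P t $ k $ j * (1 / (of_real t - w)))" for t
      unfolding Eentry by (simp add: add_divide_distrib sum_divide_distrib)
    have w': "Im w \<noteq> 0" using w by simp
    note i1 = integrable_cauchy[OF PL[of i j] w'] and i2 = integrable_cauchy[OF QL[of j i] w']
    note i3 = hardy_mult_annihilates[OF aQ hP hardy_test_cauchy_kernel[OF w]]
    have i4: "integrable lborel (\<lambda>t. \<Sum>k\<in>UNIV. cnj (Q t $ k $ i) * P t $ k $ j * (1 / (of_real t - w)))"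
      by (intro Bochner_Integration.integrable_sum i3(1))
    have i5: "(\<integral>t. (\<Sum>k\<in>UNIV. cnj (Q t $ k $ i) * P t $ k $ j * (1 / (of_real t - w))) \<partial>lborel) = 0"
      by (subst Bochner_Integration.integral_sum) (use i3 in simp_all)
    show ?thesis
      unfolding eq
      using Bochner_Integration.integral_add[OF Bochner_Integration.integrable_add[OF i1 i2] i4]
        Bochner_Integration.integral_add[OF i1 i2] i5
        annihilates_cauchy_zero[OF aP w, of i j] annihilates_cauchy_zero[OF aQ w, of j i]
      by (intro conjI Bochner_Integration.integrable_add i1 i2 i4) simp
  qed
  have both: "integrable lborel (\<lambda>t. E t $ i $ j / (of_real t - w)) \<and> (\<integral>t. E t $ i $ j / (of_real t - w) \<partial>lborel) = 0"
    if w: "Im w \<noteq> 0" for w i j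
  proof (cases "Im w < 0")
    case False
    then have w': "Im (cnj w) < 0" using w by simp
    \<comment> \<open>Entry (i, j) at \<open>w\<close> is thereby reduced to the conjugate of entry
      (j, i) at \<open>cnj w\<close>, which lies in the lower half-plane.\<close>
    have "E t $ i $ j = cnj (E t $ j $ i)" for t using arg_cong[OF Eherm[of t], of "\<lambda>A. A $ i $ j"] by simp
    then have eq: "E t $ i $ j / (of_real t - w) = cnj (E t $ j $ i / (of_real t - cnj w))" for t by simp
    show ?thesis
      using lower[OF w', of j i] unfolding eq by (simp only: integrable_cnj Bochner_Integration.integral_cnj complex_cnj_zero simp_thms)
  qed (rule lower, assumption)
  have "AE x in lborel. E x $ i $ j = 0" for i j
    by (rule AE_zero_if_cauchy_zero[OF Em]) (use both in auto)
  then have "AE x in lborel. \<forall>i\<in>UNIV. \<forall>j\<in>UNIV. E x $ i $ j = 0"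
    by (intro AE_finite_allI) auto
  then have good: "AE x in lborel. L x ** Y x = mat 1"
    by eventually_elim (simp add: E_def vec_eq_iff)
  have contr: "norm (Y x *v v) \<le> norm v" if "L x ** Y x = mat 1" for x v
  proof -
    have "(norm (Y x *v v))\<^sup>2 \<le> (S x *v (Y x *v v)) \<bullet> (Y x *v v)" by (rule coercive)
    also have "\<dots> = Re (cdot v (L x *v (Y x *v v)))"
      by (simp add: inner_commute inner_cdot cdot_matrix_left L_def adj_matrix_mul herm matrix_vector_mul_assoc matrix_mul_assoc)
    also have "\<dots> = (norm v)\<^sup>2"
      using that by (simp add: matrix_vector_mul_assoc cdot_self)
    finally show ?thesis by (simp add: power2_le_iff_abs_le)
  qed
  have Yb: "cmod (Y x $ i $ j) \<le> 1" and Lb: "cmod (L x $ i $ j) \<le> C" if x: "L x ** Y x = mat 1" for x i j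
  proof -
    show "cmod (Y x $ i $ j) \<le> 1" by (rule matrix_entry_bound) (use contr[OF x] in simp)
    have "cmod ((S x ** Y x) $ j $ i) \<le> C"
    proof (rule matrix_entry_bound)
      fix v
      have "norm ((S x ** Y x) *v v) \<le> C * norm (Y x *v v)"
        using bdd[of x "Y x *v v"] by (simp add: matrix_vector_mul_assoc)
      also have "\<dots> \<le> C * norm v" using contr[OF x, of v] C0 by (rule mult_left_mono)
      finally show "norm ((S x ** Y x) *v v) \<le> C * norm v" .
    qed
    then show "cmod (L x $ i $ j) \<le> C" by (simp add: L_def)
  qed
  define X where "X z = (\<chi> i j. mat 1 $ i $ j + poisson_integral (\<lambda>x. P x $ i $ j) z)" for z
  \<comment> \<open>The indices of \<open>Q\<close> are swapped and its entries conjugated: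
    \<open>W\<close> extends I + adj Q, which is \<open>L\<close> on the boundary.\<close>
  define W where "W z = (\<chi> i j. mat 1 $ i $ j + poisson_integral (\<lambda>x. cnj (Q x $ j $ i)) z)" for z
  \<comment> \<open>A common bound with room to spare: entries of \<open>X\<close> are at most 1 +
    2, those of \<open>W\<close> at most 1 + (C + 1).\<close>
  define B where "B = C + 4"
  have mat1: "cmod ((mat 1 :: complex^'n^'n) $ i $ j) \<le> 1" for i j by (simp add: mat_def)
  have Pb: "AE x in lborel. cmod (P x $ i $ j) \<le> 2" for i j
    using good
  proof eventually_elim
    case (elim x)
    have "P x $ i $ j = Y x $ i $ j - mat 1 $ i $ j" by (simp add: Y_def)
    then show ?case using Yb[OF elim, of i j] mat1[of i j] norm_triangle_ineq4[of "Y x $ i $ j" "mat 1 $ i $ j"] by simp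
  qed
  have Qb: "AE x in lborel. cmod (cnj (Q x $ j $ i)) \<le> C + 1" for i j
    using good
  proof eventually_elim
    case (elim x)
    have "cnj (Q x $ j $ i) = L x $ i $ j - mat 1 $ i $ j" by (simp add: Ladj)
    then show ?case using Lb[OF elim, of i j] mat1[of i j] norm_triangle_ineq4[of "L x $ i $ j" "mat 1 $ i $ j"] by simp
  qed
  \<comment> \<open>\<open>P\<close> and \<open>Q\<close> agree off [a,b] because S = I there. The
    jump lemma is used for the pair \<open>P\<close>, \<open>Q\<close>, and again with roles
    exchanged for the conjugates, which gives the entries of \<open>W\<close>.\<close>
  note jP = poisson_integral_jump[OF aP aQ QP[symmetric]]
  have aP': "annihilates_hardy (\<lambda>x. cnj (cnj (P x $ i $ j)))" for i j using aP by simp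
  have QP': "cnj (Q x $ i $ j) = cnj (P x $ i $ j)" if "x \<notin> {a..b}" for x i j using QP[OF that] by simp
  note jQ = poisson_integral_jump[OF aQ aP' QP']
  have holW: "(\<lambda>z. W z $ i $ j) holomorphic_on {z. 0 < Im z}" for i j
    unfolding W_def by (simp, intro holomorphic_intros jQ)
  have holX: "(\<lambda>z. X z $ i $ j) holomorphic_on {z. 0 < Im z}" for i j
    unfolding X_def by (simp, intro holomorphic_intros jP)
  have Wb: "cmod (W z $ i $ j) \<le> B" if "0 < Im z" for z i j
    using poisson_integral_bound[OF Qm Qb that, of j i] mat1[of i j]
      norm_triangle_ineq[of "mat 1 $ i $ j" "poisson_integral (\<lambda>x. cnj (Q x $ j $ i)) z"]
    by (simp add: W_def B_def)
  have Xb: "cmod (X z $ i $ j) \<le> B" if "0 < Im z" for z i j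
    using poisson_integral_bound[OF Pm Pb that, of i j] mat1[of i j] C0
      norm_triangle_ineq[of "mat 1 $ i $ j" "poisson_integral (\<lambda>x. P x $ i $ j) z"]
    by (simp add: X_def B_def)
  have limW: "(W \<longlongrightarrow> mat 1) (inf at_infinity (principal {z. 0 < Im z}))"
  proof (intro vec_tendstoI)
    show "((\<lambda>z. W z $ i $ j) \<longlongrightarrow> mat 1 $ i $ j) (inf at_infinity (principal {z. 0 < Im z}))" for i j
      using tendsto_add[OF tendsto_const jQ(2)] by (simp add: W_def)
  qed
  have limX: "(X \<longlongrightarrow> mat 1) (inf at_infinity (principal {z. 0 < Im z}))"
  proof (intro vec_tendstoI)
    show "((\<lambda>z. X z $ i $ j) \<longlongrightarrow> mat 1 $ i $ j) (inf at_infinity (principal {z. 0 < Im z}))" for i j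
      using tendsto_add[OF tendsto_const jP(2)] by (simp add: X_def)
  qed
  have pint: "integrable lborel (\<lambda>t. poisson z t *\<^sub>R f t)" if "square_integrable f" "0 < Im z" for f :: "real \<Rightarrow> complex" and z
    using that by (intro poisson_integral_eq_cauchy(1) integrable_cauchy) auto
  have bvP: "AE x in lborel. \<forall>i\<in>UNIV. \<forall>j\<in>UNIV. ((\<lambda>y. poisson_integral (\<lambda>x. P x $ i $ j) (Complex x y)) \<longlongrightarrow> P x $ i $ j) (at_right 0)"
    by (intro AE_finite_allI poisson_vertical_limit Pm pint PL) auto
  have bvQ: "AE x in lborel. \<forall>i\<in>UNIV. \<forall>j\<in>UNIV. ((\<lambda>y. poisson_integral (\<lambda>x. cnj (Q x $ j $ i)) (Complex x y)) \<longlongrightarrow> cnj (Q x $ j $ i)) (at_right 0)"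
    by (intro AE_finite_allI poisson_vertical_limit Qm pint QL) auto
  have bvs: "AE x in lborel. has_boundary_value W x (L x) \<and> has_boundary_value X x (Y x) \<and> L x ** Y x = mat 1"
    using bvP bvQ good
  proof eventually_elim
    case (elim x)
    have "has_boundary_value W x (L x)"
      unfolding has_boundary_value_def
    proof (intro vec_tendstoI)
      show "((\<lambda>y. W (Complex x y) $ i $ j) \<longlongrightarrow> L x $ i $ j) (at_right 0)" for i j
        using elim(2) by (simp add: W_def Ladj tendsto_add)
    qed
    moreover have "has_boundary_value X x (Y x)"
      unfolding has_boundary_value_def
    proof (intro vec_tendstoI)
      show "((\<lambda>y. X (Complex x y) $ i $ j) \<longlongrightarrow> Y x $ i $ j) (at_right 0)" for i j
        using elim(1) by (simp add: X_def Y_def tendsto_add)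
    qed
    ultimately show ?case using elim(3) by blast
  qed
  have WX: "W z ** X z = mat 1" if z: "0 < Im z" for z
  proof -
    \<comment> \<open>A product of Poisson integrals is in general not the Poisson integral of the
      product, so L Y = I is carried inside by the boundary maximum principle with bound 0.\<close>
    have "cmod ((W z ** X z) $ i $ j - mat 1 $ i $ j) \<le> 0" for i j
    proof (rule half_plane_boundary_maximum[where f = "\<lambda>z. (W z ** X z) $ i $ j - mat 1 $ i $ j" and M = "real CARD('n) * (B * B) + 1"])
      show "(\<lambda>z. (W z ** X z) $ i $ j - mat 1 $ i $ j) holomorphic_on {z. 0 < Im z}"
        unfolding matrix_matrix_mult_def by (simp, intro holomorphic_intros holW holX)
      show "cmod ((W z ** X z) $ i $ j - mat 1 $ i $ j) \<le> real CARD('n) * (B * B) + 1" if z: "0 < Im z" for z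
      proof -
        have B0: "0 \<le> B" using C0 by (simp add: B_def)
        have "cmod ((W z ** X z) $ i $ j) \<le> (\<Sum>k\<in>UNIV. cmod (W z $ i $ k * X z $ k $ j))"
          unfolding matrix_matrix_mult_def by (simp add: norm_sum)
        also have "\<dots> \<le> (\<Sum>k\<in>(UNIV :: 'n set). B * B)"
          unfolding norm_mult using Wb[OF z] Xb[OF z] B0 by (intro sum_mono mult_mono) auto
        finally have "cmod ((W z ** X z) $ i $ j) \<le> real CARD('n) * (B * B)" by simp
        then show ?thesis
          using mat1[of i j] norm_triangle_ineq4[of "(W z ** X z) $ i $ j" "mat 1 $ i $ j"] by linarith
      qed
      show "AE x in lborel. \<exists>l. cmod l \<le> 0 \<and> ((\<lambda>y. (W (Complex x y) ** X (Complex x y)) $ i $ j - mat 1 $ i $ j) \<longlongrightarrow> l) (at_right 0)"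
        using bvs
      proof eventually_elim
        case (elim x)
        have "((\<lambda>y. (W (Complex x y) ** X (Complex x y)) $ i $ j - mat 1 $ i $ j) \<longlongrightarrow> (L x ** Y x) $ i $ j - mat 1 $ i $ j) (at_right 0)"
          unfolding matrix_matrix_mult_def
          using elim by (simp add: has_boundary_value_def) (intro tendsto_intros; simp)
        then show ?case using elim by (intro exI[of _ 0]) simp
      qed
    qed (use z in auto)
    then show ?thesis by (simp add: vec_eq_iff)
  qed
  have fin: "AE x in lborel. \<exists>L Y. has_boundary_value W x L \<and> has_boundary_value X x Y \<and>
      adj L ** L = S x \<and> adj Y ** S x ** Y = mat 1"
    using bvs
  proof eventually_elim
    case (elim x)
    then have LY: "L x ** Y x = mat 1" by simp
    \<comment> \<open>Left and right inverses of a square matrix coincide. As adj L = S Y, this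
      gives adj L ** L = S Y L = S.\<close>
    then have "Y x ** L x = mat 1" by (simp add: matrix_left_right_inverse)
    then have "adj (L x) ** L x = S x" by (simp add: L_def matrix_mul_assoc[symmetric])
    moreover have "adj (Y x) ** S x ** Y x = mat 1" using LY Lform by simp
    ultimately show ?case using elim by blast
  qed
  show thesis by (rule that[OF holW holX Wb Xb limW limX WX fin])
qed

section \<open>The Wiener--Masani problem\<close>

text \<open>The analysis on the line is carried out for Borel functions, while \<open>R\<close> is
  only Lebesgue measurable. Real and imaginary parts of the entries are replaced by Borel versions,
  with a common exceptional null set.\<close>

lemma lebesgue_matrix_borel_version:
  fixes R :: "real \<Rightarrow> complex^'n^'n"
  assumes R: "R \<in> borel_measurable lebesgue"
  obtains R' N where "\<And>i j. (\<lambda>x. R' x $ i $ j) \<in> borel_measurable borel"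
    "N \<in> null_sets lborel" "\<And>x. x \<notin> N \<Longrightarrow> R' x = R x"
proof -
  have version: "\<exists>g. g \<in> borel_measurable lborel \<and> (AE x in lborel. h (R x) = g x)"
    if h: "continuous_on UNIV h" for h :: "complex^'n^'n \<Rightarrow> real"
    using completion_ex_borel_measurable_real[OF borel_measurable_continuous_on[OF h R]] by blast
  have "\<forall>i j. \<exists>g. g \<in> borel_measurable lborel \<and> (AE x in lborel. Re (R x $ i $ j) = g x)"
    by (intro allI version continuous_intros)
  then obtain p where "\<forall>i j. p i j \<in> borel_measurable lborel \<and> (AE x in lborel. Re (R x $ i $ j) = p i j x)"
    unfolding choice_iff by blast
  then have p: "\<And>i j. p i j \<in> borel_measurable lborel" "\<And>i j. AE x in lborel. Re (R x $ i $ j) = p i j x"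
    by blast+
  have "\<forall>i j. \<exists>g. g \<in> borel_measurable lborel \<and> (AE x in lborel. Im (R x $ i $ j) = g x)"
    by (intro allI version continuous_intros)
  then obtain q where "\<forall>i j. q i j \<in> borel_measurable lborel \<and> (AE x in lborel. Im (R x $ i $ j) = q i j x)"
    unfolding choice_iff by blast
  then have q: "\<And>i j. q i j \<in> borel_measurable lborel" "\<And>i j. AE x in lborel. Im (R x $ i $ j) = q i j x"
    by blast+
  define R' where "R' x = (\<chi> i j. Complex (p i j x) (q i j x))" for x
  have meas: "(\<lambda>x. R' x $ i $ j) \<in> borel_measurable borel" for i j
    using p(1)[of i j] q(1)[of i j] by (simp add: R'_def borel_measurable_complex_iff)
  have "AE x in lborel. \<forall>i\<in>UNIV. \<forall>j\<in>UNIV. Re (R x $ i $ j) = p i j x"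
    by (intro AE_finite_allI p) auto
  moreover have "AE x in lborel. \<forall>i\<in>UNIV. \<forall>j\<in>UNIV. Im (R x $ i $ j) = q i j x"
    by (intro AE_finite_allI q) auto
  ultimately have "AE x in lborel. R' x = R x"
    by eventually_elim (simp add: R'_def vec_eq_iff complex_eq_iff)
  then obtain N where "\<And>x. x \<in> space lborel - N \<Longrightarrow> R' x = R x" "N \<in> null_sets lborel"
    by (rule AE_E3) (rule that; assumption)
  then show thesis by (intro that[OF meas]) auto
qed

text \<open>Turns bounds on the quadratic form into bounds on |A v| without diagonalising
  \<open>A\<close>: Cauchy-Schwarz gives the lower one, and positivity at a suitably chosen vector
  the upper one.\<close>

lemma hermitian_norm_bounds:
  assumes herm: "adj A = A" and M: "1 \<le> M"
    and lower: "\<And>v. (norm v)\<^sup>2 \<le> (A *v v) \<bullet> v" and upper: "\<And>v. (A *v v) \<bullet> v \<le> M * (norm v)\<^sup>2"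
  shows "norm v \<le> norm (A *v v)" and "norm (A *v v) \<le> M * norm v"
proof -
  have "(norm v)\<^sup>2 \<le> norm (A *v v) * norm v"
    using lower[of v] norm_cauchy_schwarz[of "A *v v" v] by linarith
  then show "norm v \<le> norm (A *v v)" by (cases "v = 0") (auto simp: power2_eq_square)
  define w where "w = A *v v"
  have self: "(A *v u) \<bullet> v = u \<bullet> w" for u by (simp add: inner_cdot cdot_matrix_left herm w_def)
  \<comment> \<open>With w = A v, the form of \<open>A\<close> at v - w / M is nonnegative.
    Expanding and using the upper bound at v and at w leaves |w|^2 / M \<le> M |v|^2.\<close>
  have "0 \<le> (norm (v - (1 / M) *\<^sub>R w))\<^sup>2" by simp
  also have "\<dots> \<le> (A *v (v - (1 / M) *\<^sub>R w)) \<bullet> (v - (1 / M) *\<^sub>R w)" by (rule lower)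
  also have "A *v (v - (1 / M) *\<^sub>R w) = w - (1 / M) *\<^sub>R (A *v w)"
    using linear_diff[OF matrix_vector_linear_real, of A v "(1 / M) *\<^sub>R w"]
      linear_scale[OF matrix_vector_linear_real, of A "1 / M" w] by (simp add: w_def)
  also have "(w - (1 / M) *\<^sub>R (A *v w)) \<bullet> (v - (1 / M) *\<^sub>R w)
      = w \<bullet> v - (2 / M) * (norm w)\<^sup>2 + (1 / M)\<^sup>2 * ((A *v w) \<bullet> w)"
    using self[of w] unfolding power2_norm_eq_inner
    by (simp add: inner_diff_left inner_diff_right inner_commute power2_eq_square algebra_simps)
  also have "\<dots> \<le> M * (norm v)\<^sup>2 - (2 / M) * (norm w)\<^sup>2 + (1 / M)\<^sup>2 * (M * (norm w)\<^sup>2)"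
    using upper[of v] upper[of w] by (intro add_mono diff_right_mono mult_left_mono) (auto simp: w_def)
  also have "\<dots> = M * (norm v)\<^sup>2 - (1 / M) * (norm w)\<^sup>2"
    using M by (simp add: power2_eq_square field_simps)
  finally have "(norm w)\<^sup>2 \<le> (M * norm v)\<^sup>2"
    using M by (simp add: power_mult_distrib field_simps power2_eq_square)
  then show "norm (A *v v) \<le> M * norm v" using M by (simp add: w_def power2_le_iff_abs_le)
qed

section \<open>Scalar pairings of products of matrix functions, and bounds by entries\<close>

lemma tendsto_cdot_matrix_mul:
  fixes A B :: "'a \<Rightarrow> complex^'n^'n"
  assumes "(A \<longlongrightarrow> A0) F" "(B \<longlongrightarrow> B0) F"
  shows "((\<lambda>x. cdot u ((A x ** B x) *v v)) \<longlongrightarrow> cdot u ((A0 ** B0) *v v)) F"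
proof -
  have "((\<lambda>x. A x $ i $ j) \<longlongrightarrow> A0 $ i $ j) F" "((\<lambda>x. B x $ i $ j) \<longlongrightarrow> B0 $ i $ j) F" for i j
    using assms by (auto intro!: tendsto_vec_nth)
  then show ?thesis
    unfolding cdot_def matrix_vector_mult_def matrix_matrix_mult_def vec_lambda_beta
    by (intro tendsto_sum tendsto_mult tendsto_const)
qed

lemma holomorphic_cdot_matrix_mul:
  assumes "\<And>i j. (\<lambda>z. A z $ i $ j) holomorphic_on D" "\<And>i j. (\<lambda>z. B z $ i $ j) holomorphic_on D"
  shows "(\<lambda>z. cdot u ((A z ** B z) *v v)) holomorphic_on D"
  unfolding cdot_def matrix_vector_mult_def matrix_matrix_mult_def vec_lambda_beta
  by (intro holomorphic_on_sum holomorphic_on_mult holomorphic_on_const assms)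

lemma cmod_cdot_matrix_mul_bound:
  fixes A B :: "complex^'n^'n"
  assumes "\<And>i j. cmod (A $ i $ j) \<le> a" "\<And>i j. cmod (B $ i $ j) \<le> b"
  shows "cmod (cdot u ((A ** B) *v v)) \<le>
    (\<Sum>i\<in>UNIV. cmod (u $ i) * (\<Sum>j\<in>UNIV. (\<Sum>k\<in>(UNIV :: 'n set). a * b) * cmod (v $ j)))"
proof -
  have "0 \<le> a" "0 \<le> b" by (rule order_trans[OF norm_ge_zero assms(1)], rule order_trans[OF norm_ge_zero assms(2)])
  then show ?thesis
    unfolding cdot_def matrix_vector_mult_def matrix_matrix_mult_def vec_lambda_beta
    by (intro order_trans[OF norm_sum] sum_mono order_trans[OF norm_mult_ineq] mult_mono assms
      order_trans[OF norm_sum] order_refl sum_nonneg mult_nonneg_nonneg norm_ge_zero) simp_all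
qed

lemma bounded_matrix_family:
  fixes A :: "'a \<Rightarrow> complex^'n^'n"
  assumes "\<And>x i j. x \<in> D \<Longrightarrow> cmod (A x $ i $ j) \<le> b"
  shows "bounded (A ` D)"
  unfolding bounded_iff
proof (intro exI ballI)
  fix y assume "y \<in> A ` D"
  then obtain x where x: "x \<in> D" "y = A x" by blast
  have "norm (A x) \<le> (\<Sum>i\<in>UNIV. norm (A x $ i))"
    unfolding norm_vec_def[of "A x"] by (rule L2_set_le_sum) simp
  also have "\<dots> \<le> (\<Sum>i\<in>UNIV. \<Sum>j\<in>UNIV. cmod (A x $ i $ j))"
    by (intro sum_mono) (unfold norm_vec_def, rule L2_set_le_sum, simp)
  also have "\<dots> \<le> (\<Sum>i\<in>(UNIV :: 'n set). \<Sum>j\<in>(UNIV :: 'n set). b)"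
    by (intro sum_mono assms x)
  finally show "norm y \<le> (\<Sum>i\<in>(UNIV :: 'n set). \<Sum>j\<in>(UNIV :: 'n set). b)" using x by simp
qed

lemma at_infinity_upper_half_plane_nontrivial:
  "inf at_infinity (principal {z. 0 < Im z}) \<noteq> bot"
proof
  assume "inf at_infinity (principal {z. 0 < Im z}) = bot"
  then have "\<forall>\<^sub>F z in at_infinity. \<not> 0 < Im z"
    unfolding trivial_limit_def eventually_inf_principal by simp
  then obtain b where b: "\<And>z. b \<le> cmod z \<Longrightarrow> \<not> 0 < Im z" by (auto simp: eventually_at_infinity)
  define z where "z = Complex 0 (\<bar>b\<bar> + 1)"
  have "cmod z = \<bar>b\<bar> + 1" "Im z = \<bar>b\<bar> + 1" by (simp_all add: z_def cmod_def)
  with b[of z] show False by linarith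
qed

text \<open>Right multiplication by the inverse of the factor turns a competitor into a bounded
  function with isometric boundary values, hence into a contraction.\<close>

lemma wiener_masani_class_contraction:
  fixes X :: "complex \<Rightarrow> complex^'n^'n"
  assumes V: "wiener_masani_class R V"
    and holX: "\<And>i j. (\<lambda>z. X z $ i $ j) holomorphic_on {z. 0 < Im z}"
    and bX: "\<And>z i j. 0 < Im z \<Longrightarrow> cmod (X z $ i $ j) \<le> B"
    and bvX: "AE x in lborel. \<exists>Y. has_boundary_value X x Y \<and> adj Y ** (R x ** R x) ** Y = mat 1"
    and z: "0 < Im z"
  shows "norm (V z *v (X z *v v)) \<le> norm v"
proof -
  have holV: "\<And>i j. (\<lambda>z. V z $ i $ j) holomorphic_on {z. 0 < Im z}"
    and bddV: "bounded (V ` {z. 0 < Im z})"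
    and bvV: "AE x in lebesgue. \<exists>L. has_boundary_value V x L \<and> adj L ** L = R x ** R x"
    using V by (auto simp: wiener_masani_class_def upper_half_plane_def)
  obtain b where b: "\<And>z. 0 < Im z \<Longrightarrow> norm (V z) \<le> b"
    using bddV by (auto simp: bounded_iff)
  have bV: "cmod (V z $ i $ j) \<le> b" if "0 < Im z" for z i j
    using Finite_Cartesian_Product.norm_nth_le[of "V z $ i" j]
      Finite_Cartesian_Product.norm_nth_le[of "V z" i] b[OF that] by linarith
  have bvV': "AE x in lborel. \<exists>L. has_boundary_value V x L \<and> adj L ** L = R x ** R x"
    using bvV by (simp add: AE_completion_iff)
  \<comment> \<open>With \<open>u\<close> frozen at its value at this z, the scalar function \<zeta>
    \<mapsto> cdot u (V \<zeta> X \<zeta> v) takes the value |u|^2 at z, while its boundary values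
    are bounded by |u| |v|.\<close>
  define u where "u = V z *v (X z *v v)"
  have "cmod (cdot u ((V z ** X z) *v v)) \<le> norm u * norm v"
  proof (rule half_plane_boundary_maximum[where f = "\<lambda>z. cdot u ((V z ** X z) *v v)"])
    show "(\<lambda>z. cdot u ((V z ** X z) *v v)) holomorphic_on {z. 0 < Im z}"
      by (rule holomorphic_cdot_matrix_mul[OF holV holX])
    show "cmod (cdot u ((V z ** X z) *v v)) \<le>
      (\<Sum>i\<in>UNIV. cmod (u $ i) * (\<Sum>j\<in>UNIV. (\<Sum>k\<in>(UNIV :: 'n set). b * B) * cmod (v $ j)))" if "0 < Im z" for z
      by (rule cmod_cdot_matrix_mul_bound[OF bV[OF that] bX[OF that]])
    show "AE x in lborel. \<exists>l. cmod l \<le> norm u * norm v \<and>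
      ((\<lambda>y. cdot u ((V (Complex x y) ** X (Complex x y)) *v v)) \<longlongrightarrow> l) (at_right 0)"
      using bvV' bvX
    proof eventually_elim
      case (elim x)
      then obtain L Y where L: "has_boundary_value V x L" "adj L ** L = R x ** R x"
        and Y: "has_boundary_value X x Y" "adj Y ** (R x ** R x) ** Y = mat 1" by blast
      \<comment> \<open>On the boundary adj (L Y) L Y = adj Y (R R) Y = I, so \<open>L ** Y\<close>
        preserves norms.\<close>
      have "quad_form (adj (L ** Y) ** (L ** Y)) v = quad_form (mat 1) v"
        using Y(2) unfolding L(2)[symmetric] by (simp add: adj_matrix_mul matrix_mul_assoc)
      then have "complex_of_real ((norm ((L ** Y) *v v))\<^sup>2) = of_real ((norm v)\<^sup>2)"
        unfolding norm_adj_mul_form by (simp add: quad_form_cdot cdot_self)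
      then have "norm ((L ** Y) *v v) = norm v"
        unfolding of_real_eq_iff by (simp add: power2_eq_iff_nonneg)
      then have "cmod (cdot u ((L ** Y) *v v)) \<le> norm u * norm v"
        using cmod_cdot_le[of u "(L ** Y) *v v"] by simp
      moreover have "((\<lambda>y. cdot u ((V (Complex x y) ** X (Complex x y)) *v v)) \<longlongrightarrow> cdot u ((L ** Y) *v v)) (at_right 0)"
        using L(1) Y(1) unfolding has_boundary_value_def by (rule tendsto_cdot_matrix_mul)
      ultimately show ?case by blast
    qed
  qed (use z in simp_all)
  moreover have "cdot u ((V z ** X z) *v v) = of_real ((norm u)\<^sup>2)"
    by (simp add: matrix_vector_mul_assoc[symmetric] u_def[symmetric] cdot_self)
  ultimately have "norm u * norm u \<le> norm u * norm v"
    by (simp add: power2_eq_square norm_mult)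
  then show ?thesis unfolding u_def[symmetric] by (cases "u = 0") auto
qed

text \<open>Pairing A B v with its own value w at z gives a scalar function whose modulus is largest
  at z, by Cauchy-Schwarz and the isometry, hence a constant one. Its limit at infinity shows w
  \<bullet> v = |v|^2, and since |w| = |v| this is the equality case that forces w = v.\<close>

lemma isometric_holomorphic_eq_identity:
  fixes A B :: "complex \<Rightarrow> complex^'n^'n"
  assumes holA: "\<And>i j. (\<lambda>z. A z $ i $ j) holomorphic_on {z. 0 < Im z}"
    and holB: "\<And>i j. (\<lambda>z. B z $ i $ j) holomorphic_on {z. 0 < Im z}"
    and iso: "\<And>z v. 0 < Im z \<Longrightarrow> norm ((A z ** B z) *v v) = norm v"
    and limA: "(A \<longlongrightarrow> mat 1) (inf at_infinity (principal {z. 0 < Im z}))"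
    and limB: "(B \<longlongrightarrow> mat 1) (inf at_infinity (principal {z. 0 < Im z}))"
    and z: "0 < Im z"
  shows "A z ** B z = mat 1"
proof -
  have "(A z ** B z) *v v = v" for v
  proof -
    define w where "w = (A z ** B z) *v v"
    define f where "f \<zeta> = cdot w ((A \<zeta> ** B \<zeta>) *v v)" for \<zeta>
    have nw: "norm w = norm v" unfolding w_def by (rule iso[OF z])
    have ww: "w \<bullet> w = v \<bullet> v" by (simp only: power2_norm_eq_inner[symmetric] nw)
    have fz: "f z = of_real ((norm v)\<^sup>2)" by (simp add: f_def w_def[symmetric] cdot_self nw)
    have holf: "f holomorphic_on {z. 0 < Im z}"
      unfolding f_def[abs_def] by (rule holomorphic_cdot_matrix_mul[OF holA holB])
    have "f constant_on {z. 0 < Im z}"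
    proof (rule maximum_modulus_principle[OF holf])
      show "open {z. 0 < Im z}" "open {z. 0 < Im z}" by (simp_all add: open_halfspace_Im_gt)
      show "connected {z. 0 < Im z}" by (intro convex_connected convex_halfspace_Im_gt)
      show "cmod (f \<zeta>) \<le> cmod (f z)" if "\<zeta> \<in> {z. 0 < Im z}" for \<zeta>
      proof -
        have "cmod (f \<zeta>) \<le> norm w * norm ((A \<zeta> ** B \<zeta>) *v v)" unfolding f_def by (rule cmod_cdot_le)
        also have "\<dots> = cmod (f z)" using that by (simp add: nw iso fz power2_eq_square norm_mult)
        finally show ?thesis .
      qed
    qed (use z in auto)
    then have const: "f \<zeta> = f z" if "0 < Im \<zeta>" for \<zeta> using that z by (auto simp: constant_on_def)
    have "(f \<longlongrightarrow> cdot w ((mat 1 ** mat 1) *v v)) (inf at_infinity (principal {z. 0 < Im z}))"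
      unfolding f_def[abs_def] by (rule tendsto_cdot_matrix_mul[OF limA limB])
    moreover have "(f \<longlongrightarrow> f z) (inf at_infinity (principal {z. 0 < Im z}))"
      by (rule tendsto_eventually) (simp add: eventually_inf_principal const)
    ultimately have "cdot w ((mat 1 ** mat 1) *v v) = f z"
      by (rule tendsto_unique[OF at_infinity_upper_half_plane_nontrivial])
    then have "w \<bullet> v = (norm v)\<^sup>2" by (simp add: inner_cdot fz)
    then have "(norm (w - v))\<^sup>2 = 0"
      by (simp add: power2_norm_eq_inner inner_diff_left inner_diff_right inner_commute ww)
    then show ?thesis by (simp add: w_def)
  qed
  then show ?thesis by (simp add: matrix_eq)
qed

text \<open>Membership in \<open>extensional\<close> fixes the values outside the half-plane, about
  which the problem says nothing; uniqueness is thus uniqueness of functions on the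
  half-plane.\<close>

theorem corollary5p2:
  fixes a b M :: real
    and R :: "real \<Rightarrow> complex^'n^'n"
  assumes "a < b" and "1 \<le> M"
    and "R \<in> borel_measurable lebesgue"
    and "\<And>x. hermitian (R x)"
    and "\<And>x. x \<in> {a..b} \<Longrightarrow> loewner_le (mat 1) (R x) \<and> loewner_le (R x) (M *\<^sub>R mat 1)"
    and "\<And>x. x \<notin> {a..b} \<Longrightarrow> R x = mat 1"
  shows "\<exists>!W. W \<in> extensional upper_half_plane \<and> wiener_masani_solution R W"
proof -
  obtain R' N where R': "\<And>i j. (\<lambda>x. R' x $ i $ j) \<in> borel_measurable borel"
    and N: "N \<in> null_sets lborel" and R'R: "\<And>x. x \<notin> N \<Longrightarrow> R' x = R x"
    by (rule lebesgue_matrix_borel_version[OF assms(3)]) (rule that)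
  have herm: "adj (R x) = R x" for x using assms(4)[of x] by (simp add: hermitian_def)
  have form: "Re (quad_form A v) = (A *v v) \<bullet> v" for A and v :: "complex^'n"
    by (simp add: quad_form_cdot inner_cdot[symmetric] inner_commute)
  have lower: "(norm v)\<^sup>2 \<le> (R x *v v) \<bullet> v" and upper: "(R x *v v) \<bullet> v \<le> M * (norm v)\<^sup>2" for x v
  proof -
    have "(M *\<^sub>R mat 1) *v v = M *\<^sub>R (mat 1 *v v)"
      by (simp add: vec_eq_iff matrix_vector_mult_def scaleR_sum_right)
    then have scale: "(M *\<^sub>R mat 1) *v v = M *\<^sub>R v" by simp
    have "(norm v)\<^sup>2 \<le> (R x *v v) \<bullet> v \<and> (R x *v v) \<bullet> v \<le> M * (norm v)\<^sup>2"
    proof (cases "x \<in> {a..b}")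
      case True
      have "(mat 1 *v v) \<bullet> v \<le> (R x *v v) \<bullet> v" "(R x *v v) \<bullet> v \<le> ((M *\<^sub>R mat 1) *v v) \<bullet> v"
        using assms(5)[OF True] unfolding loewner_le_def form by blast+
      then show ?thesis by (simp add: scale power2_norm_eq_inner)
    next
      case False
      have "1 * (v \<bullet> v) \<le> M * (v \<bullet> v)" using assms(2) by (intro mult_right_mono) auto
      then show ?thesis by (simp add: assms(6)[OF False] power2_norm_eq_inner)
    qed
    then show "(norm v)\<^sup>2 \<le> (R x *v v) \<bullet> v" "(R x *v v) \<bullet> v \<le> M * (norm v)\<^sup>2" by auto
  qed
  note nb = hermitian_norm_bounds[OF herm assms(2) lower upper]
  \<comment> \<open>On the null set \<open>N\<close> the Borel version \<open>R'\<close> is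
    uncontrolled. The value I there makes the pointwise hypotheses of the factorization hold at
    every x.\<close>
  define S where "S x = (if x \<in> N then mat 1 else R' x ** R' x)" for x
  have SR: "S x = R x ** R x" if "x \<notin> N" for x using that by (simp add: S_def R'R)
  have Smeas: "(\<lambda>x. S x $ i $ j) \<in> borel_measurable borel" for i j
  proof -
    have "(\<lambda>x. if x \<in> N then mat 1 $ i $ j else (\<Sum>k\<in>UNIV. R' x $ i $ k * R' x $ k $ j)) \<in> borel_measurable borel"
      using N by (intro measurable_If borel_measurable_sum borel_measurable_times R') auto
    moreover have "S x $ i $ j = (if x \<in> N then mat 1 $ i $ j else (\<Sum>k\<in>UNIV. R' x $ i $ k * R' x $ k $ j))" for x
      by (simp add: S_def matrix_matrix_mult_def)
    ultimately show ?thesis by simp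
  qed
  have Sherm: "adj (S x) = S x" for x
    by (cases "x \<in> N") (simp add: S_def, simp add: SR adj_matrix_mul herm)
  have Scoer: "(norm v)\<^sup>2 \<le> (S x *v v) \<bullet> v" for x v
  proof (cases "x \<in> N")
    case False
    have "(norm v)\<^sup>2 \<le> (norm (R x *v v))\<^sup>2" by (intro power_mono nb) simp
    also have "\<dots> = (S x *v v) \<bullet> v"
      using False by (simp add: SR power2_norm_eq_inner matrix_vector_mul_assoc[symmetric] inner_cdot cdot_matrix_left herm)
    finally show ?thesis .
  qed (simp add: S_def power2_norm_eq_inner)
  have Sbdd: "norm (S x *v v) \<le> (M * M) * norm v" for x v
  proof (cases "x \<in> N")
    case True
    have "1 \<le> M * M" using mult_mono[of 1 M 1 M] assms(2) by simp
    with True show ?thesis using mult_right_mono[of 1 "M * M" "norm v"] by (simp add: S_def)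
  next
    case False
    have "norm (R x *v (R x *v v)) \<le> M * norm (R x *v v)" by (rule nb)
    also have "\<dots> \<le> M * (M * norm v)" using assms(2) by (intro mult_left_mono nb) simp
    finally show ?thesis using False by (simp add: SR matrix_vector_mul_assoc mult.assoc)
  qed
  have Sout: "S x = mat 1" if "x \<notin> {a..b}" for x
    using assms(6)[OF that] SR[of x] by (cases "x \<in> N") (simp_all add: S_def)
  obtain W X B where
    holW: "\<And>i j. (\<lambda>z. W z $ i $ j) holomorphic_on {z. 0 < Im z}"
    and holX: "\<And>i j. (\<lambda>z. X z $ i $ j) holomorphic_on {z. 0 < Im z}"
    and bW: "\<And>z i j. 0 < Im z \<Longrightarrow> cmod (W z $ i $ j) \<le> B"
    and bX: "\<And>z i j. 0 < Im z \<Longrightarrow> cmod (X z $ i $ j) \<le> B"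
    and limW: "(W \<longlongrightarrow> mat 1) (inf at_infinity (principal {z. 0 < Im z}))"
    and limX: "(X \<longlongrightarrow> mat 1) (inf at_infinity (principal {z. 0 < Im z}))"
    and WX: "\<And>z. 0 < Im z \<Longrightarrow> W z ** X z = mat 1"
    and bv: "AE x in lborel. \<exists>L Y. has_boundary_value W x L \<and> has_boundary_value X x Y \<and>
      adj L ** L = S x \<and> adj Y ** S x ** Y = mat 1"
  proof (rule spectral_factorization[where S = S and C = "M * M" and a = a and b = b])
    show "(\<lambda>x. S x $ i $ j) \<in> borel_measurable borel" for i j by (rule Smeas)
    show "adj (S x) = S x" for x by (rule Sherm)
    show "(norm v)\<^sup>2 \<le> (S x *v v) \<bullet> v" for x v by (rule Scoer)
    show "norm (S x *v v) \<le> (M * M) * norm v" for x v by (rule Sbdd)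
    show "S x = mat 1" if "x \<notin> {a..b}" for x by (rule Sout[OF that])
  qed (rule that, assumption+)
  have XW: "X z ** W z = mat 1" if "0 < Im z" for z
    using WX[OF that] by (simp add: matrix_left_right_inverse)
  have AE_SR: "AE x in lborel. S x = R x ** R x"
    using AE_not_in[OF N] by eventually_elim (rule SR)
  have bvX: "AE x in lborel. \<exists>Y. has_boundary_value X x Y \<and> adj Y ** (R x ** R x) ** Y = mat 1"
    using bv AE_SR by eventually_elim auto
  \<comment> \<open>The contraction property of V X is applied to the vector W v, and X W = I turns
    V X W v into V v.\<close>
  have dom: "norm (V z *v v) \<le> norm (W z *v v)" if V: "wiener_masani_class R V" and z: "0 < Im z" for V z v
    using wiener_masani_class_contraction[OF V holX bX bvX z, of "W z *v v"]
    by (simp add: matrix_vector_mul_assoc XW[OF z])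
  define W' where "W' = restrict W upper_half_plane"
  have W'W: "W' z = W z" if "0 < Im z" for z using that by (simp add: W'_def upper_half_plane_def)
  have "wiener_masani_class R W'"
    unfolding wiener_masani_class_def upper_half_plane_def
  proof (intro conjI allI)
    show "(\<lambda>z. W' z $ i $ j) holomorphic_on {z. 0 < Im z}" for i j
      by (rule holomorphic_transform[OF holW]) (simp add: W'W)
    show "bounded (W' ` {z. 0 < Im z})"
      by (rule bounded_matrix_family[of _ _ B]) (simp add: W'W bW)
    show "(W' \<longlongrightarrow> mat 1) (inf at_infinity (principal {z. 0 < Im z}))"
      by (rule Lim_transform_eventually[OF limW]) (simp add: eventually_inf_principal W'W)
    have "AE x in lborel. \<exists>L. has_boundary_value W' x L \<and> adj L ** L = R x ** R x"
      using bv AE_SR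
    proof eventually_elim
      case (elim x)
      then obtain L where L: "has_boundary_value W x L" "adj L ** L = S x" by blast
      have "\<forall>\<^sub>F y in at_right 0. (0::real) < y" by (simp add: eventually_at_right_less)
      then have "\<forall>\<^sub>F y in at_right 0. W (Complex x y) = W' (Complex x y)"
        by eventually_elim (simp add: W'W)
      with L(1) have "has_boundary_value W' x L"
        unfolding has_boundary_value_def by (rule Lim_transform_eventually)
      with L(2) elim show ?case by auto
    qed
    then show "AE x in lebesgue. \<exists>L. has_boundary_value W' x L \<and> adj L ** L = R x ** R x"
      by (rule AE_completion)
  qed
  then have sol: "wiener_masani_solution R W'"
    unfolding wiener_masani_solution_def loewner_le_adj_mul_iff
    using dom by (auto simp: upper_half_plane_def W'W)
  show ?thesis
  proof (rule ex1I[of _ W'])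
    show "W' \<in> extensional upper_half_plane \<and> wiener_masani_solution R W'"
      using sol by (simp add: W'_def)
    fix U assume U: "U \<in> extensional upper_half_plane \<and> wiener_masani_solution R U"
    then have Uc: "wiener_masani_class R U" and Umax: "\<And>V z. wiener_masani_class R V \<Longrightarrow> 0 < Im z \<Longrightarrow>
        loewner_le (adj (V z) ** V z) (adj (U z) ** U z)"
      by (auto simp: wiener_masani_solution_def upper_half_plane_def)
    \<comment> \<open>Two maximal solutions dominate each other, so the images of each vector have
      equal norms at every point; U X then inherits the isometry from W X = I.\<close>
    have eqn: "norm (U z *v v) = norm (W z *v v)" if z: "0 < Im z" for z v
    proof (rule antisym)
      show "norm (U z *v v) \<le> norm (W z *v v)" by (rule dom[OF Uc z])
      show "norm (W z *v v) \<le> norm (U z *v v)"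
        using Umax[OF _ z, of W'] sol unfolding wiener_masani_solution_def loewner_le_adj_mul_iff by (simp add: W'W[OF z])
    qed
    have UX: "U z ** X z = mat 1" if z: "0 < Im z" for z
    proof (rule isometric_holomorphic_eq_identity[OF _ holX _ _ limX z])
      show "(\<lambda>z. U z $ i $ j) holomorphic_on {z. 0 < Im z}" for i j
        using Uc by (simp add: wiener_masani_class_def upper_half_plane_def)
      show "(U \<longlongrightarrow> mat 1) (inf at_infinity (principal {z. 0 < Im z}))"
        using Uc by (simp add: wiener_masani_class_def upper_half_plane_def)
      show "norm ((U z ** X z) *v v) = norm v" if "0 < Im z" for z v
        using eqn[OF that, of "X z *v v"] by (simp add: matrix_vector_mul_assoc[symmetric])
          (simp add: matrix_vector_mul_assoc WX[OF that])
    qed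
    show "U = W'"
    proof (rule extensionalityI)
      show "U \<in> extensional upper_half_plane" using U by blast
      show "W' \<in> extensional upper_half_plane" by (simp add: W'_def)
      fix z assume "z \<in> upper_half_plane"
      then have z: "0 < Im z" by (simp add: upper_half_plane_def)
      have "U z = (U z ** X z) ** W z" by (simp add: matrix_mul_assoc[symmetric] XW[OF z])
      also have "\<dots> = W z" by (simp add: UX[OF z])
      finally show "U z = W' z" by (simp add: W'W[OF z])
    qed
  qed
qed

end
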